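(* Let $f\in\mathbb{R}(z)_d$ be a real rational function of degree $d\geq 2$. Then the following are equivalent: (1) $f$ has only real periodic points; (2) there is a nonrepelling real cycle of $f$ of length at most $2$, and there is a closed semialgebraic subset $S\subset\overline{\mathbb{R}}$ that contains a nonattracting fixed point of $f$ and satisfies $f^{-1}(S)\subset S$. Moreover, if (1) and (2) hold, then (any such) $S$ contains all nonattracting periodic points of $f$.
   Context: $\overline{\mathbb{C}}=\mathbb{C}\cup\{\infty\}$ is the Riemann sphere and $\overline{\mathbb{R}}=\mathbb{R}\cup\{\infty\}\subset\overline{\mathbb{C}}$, identified with the real projective line $\mathbb{P}^1(\mathbb{R})$ (semialgebraic subsets of $\overline{\mathbb{R}}$ are understood as semialgebraic subsets of $\mathbb{P}^1(\mathbb{R})$). "Real" means lying in $\overline{\mathbb{R}}$. $\mathbb{R}(z)_d$ is the set of real rational functions of degree $d$: ratios $f=p/q$ of coprime polynomials $p,q\in\mathbb{R}[z]$ of degree at most $d$, whose coefficients of $z^d$ are not both zero. Such an $f$ is regarded as a map $\overline{\mathbb{C}}\to\overline{\mathbb{C}}$, and $f^{-1}(S)$ denotes the full preimage in $\overline{\mathbb{C}}$. Iterates are $f^1=f$, $f^{k+1}=f^k\circ f$. A point $z\in\overline{\mathbb{C}}$ is periodic for $f$ if $f^k(z)=z$ for some $k\geq1$; the smallest such $k$ is its period, and $\{z,f(z),\dots,f^{k-1}(z)\}$ is its cycle, of length $k$. It is a fixed point if $k=1$. $f$ has only real periodic points if for all $k\geq1$ every solution $z\in\overline{\mathbb{C}}$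 of $f^k(z)=z$ lies in $\overline{\mathbb{R}}$. The multiplier $\lambda_z$ of a periodic point $z$ of period $k$ is $(f^k)'(z)$ if $z\in\mathbb{C}$ (computed in any local coordinate when the orbit passes through $\infty$), and $\left(\lim_{w\to\infty}(f^k)'(w)\right)^{-1}$ if $z=\infty$ (with the convention $\infty^{-1}=0$); it is the same for all points of a cycle. The point $z$ (and its cycle) is attracting, indifferent or repelling if $|\lambda_z|<1$, $|\lambda_z|=1$ or $|\lambda_z|>1$, respectively; nonattracting means $|\lambda_z|\geq1$ and nonrepelling means $|\lambda_z|\leq1$. A real cycle is a cycle contained in $\overline{\mathbb{R}}$. *)

theory Defs
  imports
    "HOL-Analysis.Analysis"
    "HOL-Computational_Algebra.Computational_Algebra"
    "HOL-Combinatorics.Cycles"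
begin

text \<open>
  The Riemann sphere is the one-point compactification of the complex plane, on the carrier
  type \<open>complex option\<close> with \<open>None\<close> as the point at infinity.
\<close>

type_synonym sphere = "complex option"

abbreviation sphere_topology :: "sphere topology" where
  "sphere_topology \<equiv> Alexandroff_compactification (euclidean :: complex topology)"

definition real_points :: "sphere set" where
  "real_points = insert None (range (\<lambda>x::real. Some (complex_of_real x)))"


section \<open>Real rational functions as self-maps of the sphere\<close>

text \<open>
  For coprime \<open>p\<close>, \<open>q\<close> with \<open>d = max (degree p) (degree q)\<close>: the value at infinity is read off
  from the coefficients of \<open>z^d\<close>.
\<close>

definition ratfun_map :: "nat \<Rightarrow> real poly \<Rightarrow> real poly \<Rightarrow> sphere \<Rightarrow> sphere" where
  "ratfun_map d p q z =
     (case z of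
        Some w \<Rightarrow>
          (let a = poly (map_poly complex_of_real p) w; b = poly (map_poly complex_of_real q) w
           in if b = 0 then None else Some (a / b))
      | None \<Rightarrow>
          (if coeff q d = 0 then None else Some (complex_of_real (coeff p d / coeff q d))))"

definition real_ratfuns :: "nat \<Rightarrow> (sphere \<Rightarrow> sphere) set" where
  "real_ratfuns d =
     {ratfun_map d p q | p q. coprime p q \<and> q \<noteq> 0 \<and> degree p \<le> d \<and> degree q \<le> d \<and>
                              (coeff p d \<noteq> 0 \<or> coeff q d \<noteq> 0)}"


section \<open>Periodic points, cycles and multipliers\<close>

definition periodic_point :: "('a \<Rightarrow> 'a) \<Rightarrow> 'a \<Rightarrow> bool" where
  "periodic_point f z \<longleftrightarrow> (\<exists>k\<ge>1. (f ^^ k) z = z)"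

abbreviation period :: "('a \<Rightarrow> 'a) \<Rightarrow> 'a \<Rightarrow> nat" where
  "period \<equiv> least_power"

definition cycle_of_point :: "('a \<Rightarrow> 'a) \<Rightarrow> 'a \<Rightarrow> 'a set" where
  "cycle_of_point f z = {(f ^^ i) z | i. i < period f z}"

definition only_real_periodic_points :: "(sphere \<Rightarrow> sphere) \<Rightarrow> bool" where
  "only_real_periodic_points f \<longleftrightarrow> (\<forall>k\<ge>1. \<forall>z. (f ^^ k) z = z \<longrightarrow> z \<in> real_points)"

text \<open>
  The derivative of a sphere map in the affine coordinate. The value that \<open>the\<close> takes at
  \<open>None\<close> is immaterial below: if \<open>g\<close> is rational and fixes a point \<open>z\<close>, then \<open>g\<close> has no
  poles in a punctured neighbourhood of \<open>z\<close>, and none at \<open>z\<close> itself if \<open>z\<close> is finite.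
\<close>

definition affine_deriv :: "(sphere \<Rightarrow> sphere) \<Rightarrow> complex \<Rightarrow> complex" where
  "affine_deriv g = deriv (\<lambda>w. the (g (Some w)))"

text \<open>
  At infinity, the multiplier is the inverse of the limit of the derivative, where an infinite
  limit has inverse \<open>0\<close>.
\<close>

definition multiplier :: "(sphere \<Rightarrow> sphere) \<Rightarrow> sphere \<Rightarrow> complex" where
  "multiplier f z =
     (let g = f ^^ period f z in
      case z of
        Some w \<Rightarrow> affine_deriv g w
      | None \<Rightarrow>
          (if filterlim (affine_deriv g) at_infinity at_infinity then 0
           else inverse (Lim at_infinity (affine_deriv g))))"

definition nonattracting :: "(sphere \<Rightarrow> sphere) \<Rightarrow> sphere \<Rightarrow> bool" where
  "nonattracting f z \<longleftrightarrow> norm (multiplier f z) \<ge> 1"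

definition nonrepelling :: "(sphere \<Rightarrow> sphere) \<Rightarrow> sphere \<Rightarrow> bool" where
  "nonrepelling f z \<longleftrightarrow> norm (multiplier f z) \<le> 1"


section \<open>Semialgebraic subsets of the real projective line\<close>

text \<open>
  Semialgebraic subsets of the affine line: the smallest Boolean algebra of sets containing all
  \<open>{x. poly p x > 0}\<close>.
\<close>

inductive semialgebraic :: "real set \<Rightarrow> bool" where
  positive: "semialgebraic {x. poly p x > 0}"
| complement: "semialgebraic A \<Longrightarrow> semialgebraic (- A)"
| union: "semialgebraic A \<Longrightarrow> semialgebraic B \<Longrightarrow> semialgebraic (A \<union> B)"

text \<open>
  A subset of the projective line is semialgebraic if it is so in both standard affine charts;
  the chart at infinity has the coordinate \<open>1/x\<close>.
\<close>

definition semialgebraic_P1 :: "sphere set \<Rightarrow> bool" where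
  "semialgebraic_P1 S \<longleftrightarrow>
     S \<subseteq> real_points \<and>
     semialgebraic {x. Some (complex_of_real x) \<in> S} \<and>
     semialgebraic {t. (if t = 0 then None else Some (complex_of_real (1 / t))) \<in> S}"


section \<open>The two parts of the criterion\<close>

definition has_short_nonrepelling_real_cycle :: "(sphere \<Rightarrow> sphere) \<Rightarrow> bool" where
  "has_short_nonrepelling_real_cycle f \<longleftrightarrow>
     (\<exists>z. periodic_point f z \<and> period f z \<le> 2 \<and> cycle_of_point f z \<subseteq> real_points \<and>
          nonrepelling f z)"

definition backward_invariant_set :: "(sphere \<Rightarrow> sphere) \<Rightarrow> sphere set \<Rightarrow> bool" where
  "backward_invariant_set f S \<longleftrightarrow>
     closedin (subtopology sphere_topology real_points) S \<and> semialgebraic_P1 S \<and>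
     (\<exists>z\<in>S. f z = z \<and> nonattracting f z) \<and> f -` S \<subseteq> S"

end

theory Submission
  imports Defs "HOL-Complex_Analysis.Complex_Analysis" "HOL-Computational_Algebra.Field_as_Ring"
begin

text \<open>
  Conjugate by a real Moebius map so that a nonattracting, hence Lyapunov unstable, real fixed
  point lies at infinity, and let \<open>a\<close>, \<open>b\<close> be successive preimages of infinity. If a backward
  invariant \<open>S\<close> contains infinity then it contains \<open>a\<close> and \<open>b\<close>, so on each half-plane the iterates
  omit infinity, \<open>a\<close> and \<open>b\<close> and form a normal family (Schottky, Montel). A nonrepelling real cycle
  attracts an open set (a disc or a petal), so by the identity theorem every limit of suitable
  iterates is a real constant, which rules out nonreal periodic points; and a periodic point outside
  \<open>S\<close> is Lyapunov stable, hence attracting.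

  Conversely, the index formula \<open>\<Sum> 1 / (1 - \<lambda>) = 1\<close> provides a nonattracting fixed point. If all
  periodic points are real, cross ratios with inverse branches show that no nonreal point ever
  lands on infinity, so the iterates are again normal off the real line. A nonconstant limit would
  make the identity a limit of iterates, although \<open>f\<close> is not injective there; hence all nonreal orbits
  converge to one real fixed point \<open>c\<close>, which is nonrepelling. For \<open>S\<close> take the complement of the
  nonreal points, their real forward images and the real points attracted near \<open>c\<close>. This is
  semialgebraic: the first real images form finitely many intervals, and later images eventually
  meet the neighbourhood of \<open>c\<close>.
\<close>

section \<open>Homogeneous coordinates and rational maps\<close>

text \<open>Multipliers of real cycles are real, so a nonattracting real cycle has multiplier 1, -1
  or one of modulus above 1. Irrational indifference never arises, and instability follows from
  power series; passing to the second iterate treats 1 and -1 together. Lyapunov stability, rather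
  than the multiplier, is carried through changes of coordinate, because its invariance under
  conjugation is mere continuity.

  Instability of infinity enters twice. It forbids a superattracting point, so infinity has the
  finite preimage \<open>a\<close>; and it is the fact that a nonreal point landing on infinity
  would contradict. Before that contradiction no fixed value is known to be omitted, so moving
  values take their place: if \<open>f^k(z)\<close> were \<open>z\<close> or a preimage of
  \<open>z\<close>, then \<open>z\<close> would be a nonreal periodic point.

  Semialgebraicity is obtained from order and connectedness: every set concerned is shown to be a
  finite union of intervals. The forward images of such a union form an infinite family, and its
  finiteness up to merging rests on the convergence of all nonreal orbits to the single point
  \<open>c\<close>.\<close>

definition homog :: "nat \<Rightarrow> real poly \<Rightarrow> complex \<Rightarrow> complex \<Rightarrow> complex" where
  "homog d p x y = (\<Sum>i\<le>d. complex_of_real (coeff p i) * x ^ i * y ^ (d - i))"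

definition proj :: "complex \<Rightarrow> complex \<Rightarrow> sphere" where
  "proj x y = (if y = 0 then None else Some (x / y))"

text \<open>Nonvanishing of the resultant of two binary forms of degree \<open>d\<close>. It
  expresses coprimality and the condition on the coefficients of \<open>z^d\<close> at once, and it
  visibly survives composition.\<close>

definition nondeg :: "nat \<Rightarrow> real poly \<Rightarrow> real poly \<Rightarrow> bool" where
  "nondeg d p q \<longleftrightarrow> degree p \<le> d \<and> degree q \<le> d \<and>
     (\<forall>x y. homog d p x y = 0 \<and> homog d q x y = 0 \<longrightarrow> x = 0 \<and> y = 0)"

text \<open>This class contains the real Moebius maps in degree 1, and degrees multiply under
  composition, so iterates and conjugates need no separate treatment.\<close>

definition rational_map :: "nat \<Rightarrow> (sphere \<Rightarrow> sphere) \<Rightarrow> bool" where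
  "rational_map d f \<longleftrightarrow> (\<exists>p q. nondeg d p q \<and> f = ratfun_map d p q)"

lemma homog_1: "degree p \<le> d \<Longrightarrow> homog d p x 1 = poly (map_poly complex_of_real p) x"
  unfolding homog_def poly_altdef
  by (simp add: degree_map_poly coeff_map_poly)
     (rule sum.mono_neutral_right, auto simp: coeff_eq_0)

lemma homog_0: "homog d p x 0 = complex_of_real (coeff p d) * x ^ d"
proof -
  have "homog d p x 0 = (\<Sum>i\<le>d. if i = d then complex_of_real (coeff p d) * x ^ d else 0)"
    unfolding homog_def by (rule sum.cong) auto
  then show ?thesis by simp
qed

lemma homog_scale: "homog d p (s * x) (s * y) = s ^ d * homog d p x y"
  unfolding homog_def sum_distrib_left
  by (rule sum.cong)
     (auto simp: power_mult_distrib mult_ac simp flip: power_add)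

lemma homog_eq_poly:
  assumes "degree p \<le> d" "y \<noteq> 0"
  shows "homog d p x y = y ^ d * poly (map_poly complex_of_real p) (x / y)"
  using homog_scale[of d p y "x / y" 1] assms by (simp add: homog_1)

lemma proj_surj: obtains x y where "z = proj x y" "(x, y) \<noteq> (0, 0)"
proof (cases z)
  case None
  then show ?thesis using that[of 1 0] by (simp add: proj_def)
next
  case (Some w)
  then show ?thesis using that[of w 1] by (simp add: proj_def)
qed

lemma nondegD:
  assumes "nondeg d p q"
  shows "degree p \<le> d" "degree q \<le> d"
    "(x, y) \<noteq> (0, 0) \<Longrightarrow> (homog d p x y, homog d q x y) \<noteq> (0, 0)"
    "\<not> (poly (map_poly complex_of_real p) z = 0 \<and> poly (map_poly complex_of_real q) z = 0)"
    "\<not> (coeff p d = 0 \<and> coeff q d = 0)"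
proof -
  show 1: "degree p \<le> d" "degree q \<le> d" using assms unfolding nondeg_def by blast+
  have nz: "x = 0 \<and> y = 0" if "homog d p x y = 0" "homog d q x y = 0" for x y
    using assms that unfolding nondeg_def by blast
  show "(x, y) \<noteq> (0, 0) \<Longrightarrow> (homog d p x y, homog d q x y) \<noteq> (0, 0)"
    using nz[of x y] by auto
  show "\<not> (poly (map_poly complex_of_real p) z = 0 \<and> poly (map_poly complex_of_real q) z = 0)"
    using nz[of z 1] homog_1[OF 1(1), of z] homog_1[OF 1(2), of z] by auto
  show "\<not> (coeff p d = 0 \<and> coeff q d = 0)"
    using nz[of 1 0] homog_0[of d p 1] homog_0[of d q 1] by auto
qed

lemma ratfun_map_proj:
  assumes "nondeg d p q" "(x, y) \<noteq> (0, 0)"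
  shows "ratfun_map d p q (proj x y) = proj (homog d p x y) (homog d q x y)"
proof (cases "y = 0")
  case True
  then show ?thesis using assms by (auto simp: ratfun_map_def proj_def homog_0)
next
  case False
  then show ?thesis using assms nondegD(1,2)[OF assms(1)]
    by (simp add: ratfun_map_def proj_def homog_eq_poly Let_def)
qed

lemma ratfun_map_Some:
  assumes "nondeg d p q"
  shows "ratfun_map d p q (Some z) =
    proj (poly (map_poly complex_of_real p) z) (poly (map_poly complex_of_real q) z)"
  by (simp add: ratfun_map_def proj_def Let_def)

lemma homog_add: "homog d (p + q) x y = homog d p x y + homog d q x y"
  by (simp add: homog_def ring_distribs sum.distrib)

lemma homog_smult: "homog d (smult c p) x y = complex_of_real c * homog d p x y"
  by (simp add: homog_def sum_distrib_left mult_ac)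

lemma homog_zero [simp]: "homog d 0 x y = 0"
  by (simp add: homog_def)

lemma homog_sum: "homog d (sum f A) x y = (\<Sum>i\<in>A. homog d (f i) x y)"
  by (induction A rule: infinite_finite_induct) (auto simp: homog_add)

lemma coeff_mult_degree_le:
  assumes "degree p \<le> m" "degree q \<le> n"
  shows "coeff (p * q) (m + n) = coeff p m * coeff (q :: 'a::comm_semiring_0 poly) n"
proof -
  have "coeff (p * q) (m + n) = (\<Sum>i\<le>m + n. if i = m then coeff p m * coeff q n else 0)"
    unfolding coeff_mult
  proof (rule sum.cong)
    fix i assume "i \<in> {..m + n}"
    show "coeff p i * coeff q (m + n - i) = (if i = m then coeff p m * coeff q n else 0)"
    proof (cases "i = m")
      case False
      then consider "i > m" | "m + n - i > n" using \<open>i \<in> _\<close> by fastforce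
      then have "coeff p i * coeff q (m + n - i) = 0"
        using assms by cases (simp_all add: coeff_eq_0)
      then show ?thesis using False by simp
    qed auto
  qed auto
  then show ?thesis by simp
qed

lemma map_poly_of_real_mult:
  "map_poly complex_of_real (p * q) = map_poly complex_of_real p * map_poly complex_of_real q"
  by (intro poly_eqI) (simp add: coeff_map_poly coeff_mult)

lemma map_poly_of_real_add:
  "map_poly complex_of_real (p + q) = map_poly complex_of_real p + map_poly complex_of_real q"
  by (rule poly_eqI) (simp add: coeff_map_poly)

lemma homog_mult:
  assumes "degree p \<le> m" "degree q \<le> n"
  shows "homog (m + n) (p * q) x y = homog m p x y * homog n q x y"
proof (cases "y = 0")
  case True
  then show ?thesis using assms by (simp add: homog_0 coeff_mult_degree_le power_add)
next
  case False
  have "degree (p * q) \<le> m + n" using assms degree_mult_le[of p q] by linarith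
  then show ?thesis using assms False
    by (simp add: homog_eq_poly map_poly_of_real_mult power_add)
qed

lemma homog_power:
  assumes "degree p \<le> m"
  shows "homog (k * m) (p ^ k) x y = homog m p x y ^ k" and "degree (p ^ k) \<le> k * m"
proof -
  have *: "degree (p ^ k) \<le> k * m" for k
    using degree_power_le[of p k] mult_le_mono1[OF assms, of k] by (metis le_trans mult.commute)
  show "degree (p ^ k) \<le> k * m" by (rule *)
  show "homog (k * m) (p ^ k) x y = homog m p x y ^ k"
  proof (induction k)
    case 0
    show ?case by (simp add: homog_def)
  next
    case (Suc k)
    show ?case using homog_mult[OF assms *[of k], of x y] Suc by simp
  qed
qed

text \<open>The numerator of \<open>p (r / s)\<close> after multiplication by \<open>s ^ m\<close>,
  which in homogeneous terms is plain substitution.\<close>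

definition homog_subst :: "nat \<Rightarrow> real poly \<Rightarrow> real poly \<Rightarrow> real poly \<Rightarrow> real poly" where
  "homog_subst m p r s = (\<Sum>i\<le>m. smult (coeff p i) (r ^ i * s ^ (m - i)))"

lemma homog_homog_subst:
  assumes "degree r \<le> n" "degree s \<le> n"
  shows "homog (m * n) (homog_subst m p r s) x y = homog m p (homog n r x y) (homog n s x y)"
    and "degree (homog_subst m p r s) \<le> m * n"
proof -
  have eq: "m * n = i * n + (m - i) * n" if "i \<le> m" for i
    using that by (simp flip: add_mult_distrib)
  have "homog (m * n) (r ^ i * s ^ (m - i)) x y =
        homog n r x y ^ i * homog n s x y ^ (m - i)" if "i \<le> m" for i
    unfolding eq[OF that] using assms
    by (subst homog_mult) (auto simp: homog_power)
  then show "homog (m * n) (homog_subst m p r s) x y = homog m p (homog n r x y) (homog n s x y)"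
    unfolding homog_subst_def homog_sum homog_smult by (simp add: homog_def[of m] mult.assoc)
  have "degree (r ^ i * s ^ (m - i)) \<le> m * n" if "i \<le> m" for i
    unfolding eq[OF that] using degree_mult_le[of "r ^ i" "s ^ (m - i)"]
      homog_power(2)[OF assms(1), of i] homog_power(2)[OF assms(2), of "m - i"] by linarith
  then show "degree (homog_subst m p r s) \<le> m * n"
    unfolding homog_subst_def
    by (intro degree_sum_le) (auto intro: order_trans[OF degree_smult_le])
qed

lemma rational_map_comp:
  assumes "rational_map m f" "rational_map n g"
  shows "rational_map (m * n) (f \<circ> g)"
proof -
  obtain p q r s where f: "nondeg m p q" "f = ratfun_map m p q"
    and g: "nondeg n r s" "g = ratfun_map n r s"
    using assms by (auto simp: rational_map_def)
  note d = nondegD(1,2)[OF g(1)]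
  have nd: "nondeg (m * n) (homog_subst m p r s) (homog_subst m q r s)"
    unfolding nondeg_def
  proof (intro conjI allI impI)
    fix x y
    assume h: "homog (m * n) (homog_subst m p r s) x y = 0 \<and>
      homog (m * n) (homog_subst m q r s) x y = 0"
    have "(x, y) = (0, 0)"
    proof (rule ccontr)
      assume "(x, y) \<noteq> (0, 0)"
      from nondegD(3)[OF f(1) nondegD(3)[OF g(1) this]] h show False
        by (simp add: homog_homog_subst(1)[OF d])
    qed
    then show "x = 0" "y = 0" by auto
  qed (use homog_homog_subst(2)[OF d] in blast)+
  moreover have "f \<circ> g = ratfun_map (m * n) (homog_subst m p r s) (homog_subst m q r s)"
  proof
    fix z
    obtain x y where z: "z = proj x y" "(x, y) \<noteq> (0, 0)" by (rule proj_surj)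
    show "(f \<circ> g) z = ratfun_map (m * n) (homog_subst m p r s) (homog_subst m q r s) z"
      unfolding z f g comp_def
      by (simp only: ratfun_map_proj[OF nd z(2)] ratfun_map_proj[OF g(1) z(2)]
          ratfun_map_proj[OF f(1) nondegD(3)[OF g(1) z(2)]] homog_homog_subst[OF d])
  qed
  ultimately show ?thesis unfolding rational_map_def by blast
qed

lemma rational_map_id: "rational_map 1 id"
  unfolding rational_map_def
proof (intro exI conjI)
  show "nondeg 1 [:0, 1:] [:1:]" by (auto simp: nondeg_def homog_def)
  show "id = ratfun_map 1 [:0, 1:] [:1:]"
    by (auto simp: ratfun_map_def fun_eq_iff map_poly_pCons Let_def split: option.splits)
qed

lemma rational_map_funpow: "rational_map d f \<Longrightarrow> rational_map (d ^ k) (f ^^ k)"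
  using rational_map_id by (induction k) (auto intro: rational_map_comp simp: id_def)

lemma real_ratfuns_rational_map:
  assumes "f \<in> real_ratfuns d"
  shows "rational_map d f"
proof -
  obtain p q where pq: "f = ratfun_map d p q" "coprime p q" "degree p \<le> d" "degree q \<le> d"
    "coeff p d \<noteq> 0 \<or> coeff q d \<noteq> 0"
    using assms by (auto simp: real_ratfuns_def)
  have "x = 0 \<and> y = 0" if h: "homog d p x y = 0" "homog d q x y = 0" for x y
  proof (cases "y = 0")
    case True
    then show ?thesis using h pq(5) by (auto simp: homog_0)
  next
    case False
    \<comment> \<open>A Bezout identity over the reals survives the passage to complex coefficients
      and so excludes common complex zeros.\<close>
    obtain u v :: "real poly" where uv: "u * p + v * q = 1"
      using that[of "fst (bezout_coefficients p q)" "snd (bezout_coefficients p q)"]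
        bezout_coefficients_fst_snd[of p q] pq(2) by simp
    have "map_poly complex_of_real u * map_poly complex_of_real p +
          map_poly complex_of_real v * map_poly complex_of_real q = 1"
      unfolding map_poly_of_real_mult[symmetric] map_poly_of_real_add[symmetric] uv
      by (simp add: map_poly_1')
    then have "poly (map_poly complex_of_real u) z * poly (map_poly complex_of_real p) z +
          poly (map_poly complex_of_real v) z * poly (map_poly complex_of_real q) z = 1" for z
      by (metis poly_1 poly_add poly_mult)
    from this[of "x / y"] show ?thesis
      using h False pq(3,4) by (simp add: homog_eq_poly)
  qed
  then show ?thesis unfolding rational_map_def nondeg_def using pq by blast
qed

section \<open>Discs, convergence and stability on the sphere\<close>

definition chart :: "sphere \<Rightarrow> complex \<Rightarrow> sphere" where
  "chart z t = (case z of Some w \<Rightarrow> Some (w + t) | None \<Rightarrow> proj 1 t)"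

text \<open>The image of a disc in the coordinate centred at \<open>z\<close>. These sets form a
  neighbourhood basis, so no metric on the sphere has to be introduced.\<close>

definition disc :: "sphere \<Rightarrow> real \<Rightarrow> sphere set" where
  "disc z e = chart z ` ball 0 e"

lemma chart_simps [simp]:
  "chart (Some w) t = Some (w + t)" "chart None 0 = None" "t \<noteq> 0 \<Longrightarrow> chart None t = Some (1 / t)"
  by (auto simp: chart_def proj_def)

lemma chart_None: "chart None t = proj 1 t"
  by (simp add: chart_def)

lemma chart_0 [simp]: "chart z 0 = z"
  by (cases z) auto

lemma chart_inj: "chart z s = chart z t \<longleftrightarrow> s = t"
  by (cases z) (auto simp: chart_def proj_def)

lemma disc_mono: "e \<le> e' \<Longrightarrow> disc z e \<subseteq> disc z e'"
  unfolding disc_def by (intro image_mono subset_ball)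

lemma in_disc_Some [simp]:
  "Some u \<in> disc (Some w) e \<longleftrightarrow> norm (u - w) < e" "None \<notin> disc (Some w) e"
proof -
  show "Some u \<in> disc (Some w) e \<longleftrightarrow> norm (u - w) < e"
  proof
    assume "norm (u - w) < e"
    then have "u - w \<in> ball 0 e" by simp
    then show "Some u \<in> disc (Some w) e" unfolding disc_def
      by (rule rev_image_eqI) simp
  qed (auto simp: disc_def)
  show "None \<notin> disc (Some w) e" by (auto simp: disc_def)
qed

lemma in_disc_None [simp]:
  "None \<in> disc None e \<longleftrightarrow> e > 0" "Some u \<in> disc None e \<longleftrightarrow> 1 < e * norm u"
proof -
  show "None \<in> disc None e \<longleftrightarrow> e > 0"
  proof
    assume "e > 0"
    then have "0 \<in> ball (0::complex) e" by simp
    then show "None \<in> disc None e" unfolding disc_def by (rule rev_image_eqI) simp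
  qed (auto simp: disc_def intro: le_less_trans[OF norm_ge_zero])
  show "Some u \<in> disc None e \<longleftrightarrow> 1 < e * norm u"
  proof
    assume *: "1 < e * norm u"
    then have "u \<noteq> 0" by auto
    then have "1 / u \<in> ball 0 e" using * by (simp add: norm_divide field_simps)
    then show "Some u \<in> disc None e" unfolding disc_def
      by (rule rev_image_eqI) (use \<open>u \<noteq> 0\<close> in simp)
  next
    assume "Some u \<in> disc None e"
    then obtain t where t: "norm t < e" "Some u = chart None t" by (auto simp: disc_def)
    then have "t \<noteq> 0" by (metis chart_simps(2) option.distinct(1))
    then have "norm u = 1 / norm t" "norm t > 0" using t by (auto simp: norm_divide)
    then show "1 < e * norm u" using t(1) mult_strict_right_mono[of "norm t" e "norm u"] by auto
  qed
qed

lemma disc_separate: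
  assumes "a \<noteq> b"
  obtains e where "e > 0" "disc a e \<inter> disc b e = {}"
proof -
  have *: "\<exists>e>0. disc None e \<inter> disc (Some w) e = {}" for w
  proof (intro exI conjI)
    define e where "e = 1 / (norm w + 2)"
    have w2: "norm w + 2 > 0" by (simp add: add_nonneg_pos)
    show e: "e > 0" using w2 by (simp add: e_def)
    have e1: "e \<le> 1" using w2 by (simp add: e_def)
    show "disc None e \<inter> disc (Some w) e = {}"
    proof (intro equals0I)
      fix x assume x: "x \<in> disc None e \<inter> disc (Some w) e"
      then obtain u where u: "x = Some u" by (cases x) auto
      then have "1 < e * norm u" "norm (u - w) < e" using x by auto
      then have "norm u > norm w + 2" using w2 by (simp add: e_def field_simps)
      moreover have "norm u \<le> norm w + norm (u - w)" by norm
      ultimately show False using \<open>norm (u - w) < e\<close> e1 by linarith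
    qed
  qed
  have "\<exists>e>0. disc a e \<inter> disc b e = {}"
  proof (cases a; cases b)
    fix w v assume ab: "a = Some w" "b = Some v"
    with assms have n: "norm (w - v) > 0" by auto
    have False if x: "x \<in> disc a (norm (w - v) / 2)" "x \<in> disc b (norm (w - v) / 2)" for x
    proof -
      obtain u where u: "x = Some u" using x ab by (cases x) auto
      have "norm (u - w) < norm (w - v) / 2" "norm (u - v) < norm (w - v) / 2" using x ab u by auto
      moreover have "norm (w - v) \<le> norm (u - w) + norm (u - v)" by norm
      ultimately show False by simp
    qed
    then show ?thesis using n by (intro exI[of _ "norm (w - v) / 2"]) auto
  qed (use assms * in \<open>auto simp: Int_commute\<close>)
  then show thesis using that by blast
qed

text \<open>The germ of \<open>f\<close> at \<open>z\<close>, read in the charts centred at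
  \<open>z\<close> and at \<open>f z\<close>. At a fixed point \<open>deriv G 0\<close> is the
  multiplier, whether the point is finite or not.\<close>

definition local_rep :: "(sphere \<Rightarrow> sphere) \<Rightarrow> sphere \<Rightarrow> real \<Rightarrow> (complex \<Rightarrow> complex) \<Rightarrow> bool" where
  "local_rep f z r G \<longleftrightarrow> r > 0 \<and> G holomorphic_on ball 0 r \<and> G 0 = 0 \<and>
     (\<forall>t\<in>ball 0 r. f (chart z t) = chart (f z) (G t))"

text \<open>Whichever homogeneous coordinate is nonzero at \<open>0\<close> serves as denominator;
  this treats finite values and poles alike.\<close>

lemma proj_local_rep:
  assumes X: "X holomorphic_on UNIV" and Y: "Y holomorphic_on UNIV"
    and XY: "(X 0, Y 0) \<noteq> (0, 0)" and F: "\<And>t. F t = proj (X t) (Y t)"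
  obtains r G where "r > 0" "G holomorphic_on ball 0 r" "G 0 = 0"
    "\<And>t. t \<in> ball 0 r \<Longrightarrow> F t = chart (F 0) (G t)"
proof -
  have nz: "\<exists>r>0. \<forall>t\<in>ball 0 r. h t \<noteq> 0" if "h holomorphic_on UNIV" "h 0 \<noteq> 0" for h :: "complex \<Rightarrow>
      complex"
  proof -
    have "continuous (at 0) h"
      using holomorphic_on_imp_continuous_on[OF that(1)] by (simp add: continuous_on_eq_continuous_at)
    from continuous_at_avoid[OF this that(2)] show ?thesis
      by (auto simp: dist_commute)
  qed
  show thesis
  proof (cases "Y 0 = 0")
    case False
    obtain r where r: "r > 0" "\<And>t. t \<in> ball 0 r \<Longrightarrow> Y t \<noteq> 0" using nz[OF Y False] by auto
    show thesis
    proof (rule that[OF r(1), of "\<lambda>t. X t / Y t - X 0 / Y 0"])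
      show "(\<lambda>t. X t / Y t - X 0 / Y 0) holomorphic_on ball 0 r"
        using X Y r(2) by (intro holomorphic_intros) (auto intro: holomorphic_on_subset)
    qed (use F r False in \<open>auto simp: proj_def\<close>)
  next
    case True
    with XY have X0: "X 0 \<noteq> 0" by simp
    obtain r where r: "r > 0" "\<And>t. t \<in> ball 0 r \<Longrightarrow> X t \<noteq> 0" using nz[OF X X0] by auto
    show thesis
    proof (rule that[OF r(1), of "\<lambda>t. Y t / X t"])
      show "(\<lambda>t. Y t / X t) holomorphic_on ball 0 r"
        using X Y r(2) by (intro holomorphic_intros) (auto intro: holomorphic_on_subset)
    qed (use F r True X0 in \<open>auto simp: proj_def chart_def\<close>)
  qed
qed

lemma rational_map_local_rep:
  assumes "rational_map n f"
  obtains r G where "local_rep f z r G"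
proof -
  obtain p q where f: "nondeg n p q" "f = ratfun_map n p q"
    using assms by (auto simp: rational_map_def)
  define u v :: "complex \<Rightarrow> complex" where "u = (\<lambda>t. case z of Some w \<Rightarrow> w + t | None \<Rightarrow> 1)"
    and "v = (\<lambda>t. case z of Some w \<Rightarrow> 1 | None \<Rightarrow> t)"
  have uv: "chart z t = proj (u t) (v t)" "(u t, v t) \<noteq> (0, 0)" for t
    by (auto simp: u_def v_def chart_def proj_def split: option.splits)
  have uh: "u holomorphic_on UNIV" "v holomorphic_on UNIV"
    unfolding u_def v_def by (cases z; auto intro!: holomorphic_intros)+
  have h: "(\<lambda>t. homog n p (u t) (v t)) holomorphic_on UNIV" for p
    unfolding homog_def using uh by (intro holomorphic_intros)
  obtain r G where "r > 0" "G holomorphic_on ball 0 r" "G 0 = 0"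
    "\<And>t. t \<in> ball 0 r \<Longrightarrow> f (chart z t) = chart (f (chart z 0)) (G t)"
    by (rule proj_local_rep[OF h[of p] h[of q], of "\<lambda>t. f (chart z t)"])
       (use nondegD(3)[OF f(1) uv(2)] in \<open>auto simp: f(2) uv ratfun_map_proj[OF f(1) uv(2)]\<close>)
  then show thesis using that[of r G] unfolding local_rep_def by simp
qed

lemma local_rep_small:
  assumes "local_rep f z r G" "e > 0"
  obtains s where "s > 0" "s \<le> r" "\<And>t. norm t < s \<Longrightarrow> norm (G t) < e"
proof -
  from assms have r: "r > 0" and G: "G holomorphic_on ball 0 r" "G 0 = 0"
    by (auto simp: local_rep_def)
  have "continuous (at 0) G"
    using holomorphic_on_imp_continuous_on[OF G(1)] r continuous_on_interior[of "ball 0 r" G 0] by simp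
  then have "\<forall>e>0. \<exists>d>0. \<forall>x. dist x 0 < d \<longrightarrow> dist (G x) (G 0) < e"
    unfolding continuous_at_eps_delta by blast
  then obtain d where "d > 0" "\<And>x. dist x 0 < d \<Longrightarrow> dist (G x) (G 0) < e"
    using assms(2) by blast
  then show thesis using that[of "min d r"] r G by auto
qed

lemma rational_map_continuous:
  assumes "rational_map n f" "e > 0"
  obtains s where "s > 0" "f ` disc z s \<subseteq> disc (f z) e"
proof -
  obtain r G where G: "local_rep f z r G" by (rule rational_map_local_rep[OF assms(1)])
  obtain s where s: "s > 0" "s \<le> r" "\<And>t. norm t < s \<Longrightarrow> norm (G t) < e"
    using local_rep_small[OF G assms(2)] by blast
  have "f ` disc z s \<subseteq> disc (f z) e"
    using G s unfolding local_rep_def disc_def by auto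
  then show thesis using that s by blast
qed

section \<open>Convergence and Lyapunov stability on the sphere\<close>

definition sconv :: "(nat \<Rightarrow> sphere) \<Rightarrow> sphere \<Rightarrow> bool" where
  "sconv X z \<longleftrightarrow> (\<forall>e>0. \<forall>\<^sub>F n in sequentially. X n \<in> disc z e)"

text \<open>Lyapunov stability when \<open>z\<close> is fixed by \<open>g\<close>. Being a statement
  about neighbourhoods and orbits only, it passes through conjugations without any computation of
  derivatives.\<close>

definition stable :: "(sphere \<Rightarrow> sphere) \<Rightarrow> sphere \<Rightarrow> bool" where
  "stable g z \<longleftrightarrow> (\<forall>e>0. \<exists>s>0. \<forall>x\<in>disc z s. \<forall>n. (g ^^ n) x \<in> disc z e)"

lemma sconv_Some_iff: "sconv (\<lambda>n. Some (x n)) (Some c) \<longleftrightarrow> x \<longlonglongrightarrow> c"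
  by (simp add: sconv_def tendsto_iff dist_norm)

lemma sconv_chart_iff: "sconv (\<lambda>n. chart z (x n)) z \<longleftrightarrow> x \<longlonglongrightarrow> 0"
proof -
  have "chart z t \<in> disc z e \<longleftrightarrow> norm t < e" for t e
    unfolding disc_def using chart_inj by auto
  then show ?thesis by (simp add: sconv_def tendsto_iff)
qed

lemma sconv_unique:
  assumes "sconv X a" "sconv X b"
  shows "a = b"
proof (rule ccontr)
  assume "a \<noteq> b"
  then obtain e where e: "e > 0" "disc a e \<inter> disc b e = {}" by (rule disc_separate)
  then have "\<forall>\<^sub>F n in sequentially. X n \<in> disc a e \<and> X n \<in> disc b e"
    using assms by (auto simp: sconv_def intro: eventually_conj)
  then have "\<exists>n. X n \<in> disc a e \<and> X n \<in> disc b e"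
    using eventually_happens trivial_limit_sequentially by blast
  then show False using e by blast
qed

lemma sconv_map:
  assumes "rational_map n f" "sconv X z"
  shows "sconv (\<lambda>k. f (X k)) (f z)"
  unfolding sconv_def
proof (intro allI impI)
  fix e :: real assume "e > 0"
  then obtain s where "s > 0" "f ` disc z s \<subseteq> disc (f z) e"
    by (rule rational_map_continuous[OF assms(1)])
  then show "\<forall>\<^sub>F n in sequentially. f (X n) \<in> disc (f z) e"
    using assms(2) by (auto simp: sconv_def elim!: allE[of _ s] eventually_mono)
qed

lemma sconv_compose: "sconv X z \<Longrightarrow> filterlim r sequentially sequentially \<Longrightarrow> sconv (\<lambda>n. X (r n)) z"
  unfolding sconv_def by (auto simp: filterlim_iff)

lemma sconv_subseq: "sconv X z \<Longrightarrow> strict_mono r \<Longrightarrow> sconv (\<lambda>n. X (r n)) z"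
  by (rule sconv_compose[OF _ filterlim_subseq])

section \<open>Finiteness of fibres and of fixed points\<close>

lemma homog_nontrivial_zero:
  assumes "degree p \<le> n" "n \<ge> 1"
  obtains x y where "(x, y) \<noteq> (0, 0)" "homog n p x y = 0"
proof (cases "coeff p n = 0")
  case True
  then show ?thesis using that[of 1 0] by (simp add: homog_0)
next
  case False
  then have "degree p = n" using assms le_degree by fastforce
  then have "degree (map_poly complex_of_real p) \<noteq> 0"
    using assms degree_map_poly[of complex_of_real p] by simp
  then obtain z where "poly (map_poly complex_of_real p) z = 0"
    using alg_closed_imp_poly_has_root by blast
  then show ?thesis using that[of z 1] assms by (simp add: homog_1)
qed

lemma rational_map_finite_preimage:
  assumes "rational_map n f" "n \<ge> 1"
  shows "finite {z. f z = y}"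
proof -
  obtain p q where f: "nondeg n p q" "f = ratfun_map n p q"
    using assms by (auto simp: rational_map_def)
  let ?P = "map_poly complex_of_real p" and ?Q = "map_poly complex_of_real q"
  define R where "R = (case y of None \<Rightarrow> ?Q | Some c \<Rightarrow> ?P - smult c ?Q)"
  have "R \<noteq> 0"
  proof
    assume R: "R = 0"
    \<comment> \<open>If \<open>R\<close> vanished, either \<open>q\<close> would be zero or
      \<open>P\<close> would be a multiple of \<open>Q\<close>; in each case a nontrivial zero of
      the other form is a common zero.\<close>
    obtain u v where uv: "(u, v) \<noteq> (0, 0)" "homog n (if y = None then p else q) u v = 0"
      by (rule homog_nontrivial_zero[of "if y = None then p else q" n])
         (use nondegD(1,2)[OF f(1)] assms(2) in auto)
    show False
    proof (cases y)
      case None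
      then have "q = 0" using R by (auto simp: R_def map_poly_eq_0_iff)
      then show False using nondegD(3)[OF f(1) uv(1)] uv(2) None by simp
    next
      case (Some c)
      then have "?P = smult c ?Q" using R by (simp add: R_def)
      then have "coeff ?P i = coeff (smult c ?Q) i" for i by simp
      then have "complex_of_real (coeff p i) = c * complex_of_real (coeff q i)" for i
        by (simp add: coeff_map_poly)
      then have "homog n p u v = c * homog n q u v"
        unfolding homog_def sum_distrib_left by (simp add: mult_ac)
      then show False using nondegD(3)[OF f(1) uv(1)] uv(2) Some by simp
    qed
  qed
  have "{z. f z = y} \<subseteq> insert None (Some ` {z. poly R z = 0})"
  proof
    fix z assume z: "z \<in> {z. f z = y}"
    show "z \<in> insert None (Some ` {z. poly R z = 0})"
    proof (cases z)
      case (Some w)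
      have "poly R w = 0" using z unfolding Some f(2)
        by (cases y) (auto simp: ratfun_map_Some[OF f(1)] proj_def R_def field_simps split: if_splits)
      then show ?thesis using Some by simp
    qed simp
  qed
  moreover have "finite (insert None (Some ` {z. poly R z = 0}))"
    using poly_roots_finite[OF \<open>R \<noteq> 0\<close>] by simp
  ultimately show ?thesis by (rule finite_subset)
qed

text \<open>Infinitely many fixed points would force \<open>P = z * Q\<close>. A zero of
  \<open>Q\<close> would then be a zero of both, so \<open>Q\<close> is constant, and for
  \<open>n >= 2\<close> both coefficients of \<open>z ^ n\<close> vanish.\<close>

lemma rational_map_finite_fixed:
  assumes "rational_map n f" "n \<ge> 2"
  shows "finite {z. f z = z}"
proof -
  obtain p q where f: "nondeg n p q" "f = ratfun_map n p q"
    using assms by (auto simp: rational_map_def)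
  let ?P = "map_poly complex_of_real p" and ?Q = "map_poly complex_of_real q"
  define R where "R = ?P - pCons 0 ?Q"
  have "R \<noteq> 0"
  proof
    assume "R = 0"
    then have PQ: "?P = pCons 0 ?Q" by (simp add: R_def)
    have "\<exists>z. poly ?Q z = 0" if "degree ?Q \<noteq> 0"
      using alg_closed_imp_poly_has_root[of ?Q] that by simp
    then have "degree ?Q = 0"
      using nondegD(4)[OF f(1)] PQ by force
    then have "degree q = 0" using degree_map_poly[of complex_of_real q] by simp
    moreover have "coeff ?P n = coeff (pCons 0 ?Q) n" using PQ by simp
    then have "coeff p n = coeff q (n - 1)"
      using assms(2) by (cases n) (auto simp: coeff_map_poly)
    ultimately have "coeff p n = 0" "coeff q n = 0" using assms(2) by (auto simp: coeff_eq_0)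
    then show False using nondegD(5)[OF f(1)] by simp
  qed
  have "{z. f z = z} \<subseteq> insert None (Some ` {z. poly R z = 0})"
  proof
    fix z assume z: "z \<in> {z. f z = z}"
    show "z \<in> insert None (Some ` {z. poly R z = 0})"
    proof (cases z)
      case (Some w)
      have "poly R w = 0" using z unfolding Some f(2)
        by (auto simp: ratfun_map_Some[OF f(1)] proj_def R_def field_simps split: if_splits)
      then show ?thesis using Some by simp
    qed simp
  qed
  moreover have "finite (insert None (Some ` {z. poly R z = 0}))"
    using poly_roots_finite[OF \<open>R \<noteq> 0\<close>] by simp
  ultimately show ?thesis by (rule finite_subset)
qed

section \<open>Symmetry under complex conjugation\<close>

lemma real_points_iff: "z \<in> real_points \<longleftrightarrow> map_option cnj z = z"
  by (cases z) (auto simp: real_points_def complex_eq_iff image_iff complex_is_Real_iff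
      intro!: exI[of _ "Re _"])

lemma Some_in_real_points [simp]: "Some z \<in> real_points \<longleftrightarrow> Im z = 0"
  by (auto simp: real_points_iff complex_eq_iff)

lemma None_in_real_points [simp]: "None \<in> real_points"
  by (simp add: real_points_def)

lemma homog_cnj: "homog d p (cnj x) (cnj y) = cnj (homog d p x y)"
  by (simp add: homog_def)

lemma proj_cnj: "proj (cnj x) (cnj y) = map_option cnj (proj x y)"
  by (simp add: proj_def)

lemma rational_map_cnj:
  assumes "rational_map n f"
  shows "f (map_option cnj z) = map_option cnj (f z)"
proof -
  obtain p q where f: "nondeg n p q" "f = ratfun_map n p q"
    using assms by (auto simp: rational_map_def)
  obtain x y where z: "z = proj x y" "(x, y) \<noteq> (0, 0)" by (rule proj_surj)
  have "(cnj x, cnj y) \<noteq> (0, 0)" using z by auto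
  then show ?thesis
    by (simp only: z f proj_cnj[symmetric] ratfun_map_proj[OF f(1)] z(2) homog_cnj not_False_eq_True)
qed

lemma rational_map_real: "rational_map n f \<Longrightarrow> z \<in> real_points \<Longrightarrow> f z \<in> real_points"
  using rational_map_cnj unfolding real_points_iff by metis

lemma rational_map_holomorphic:
  assumes "rational_map n f" "\<And>z. z \<in> O' \<Longrightarrow> f (Some z) \<noteq> None"
  shows "(\<lambda>z. the (f (Some z))) holomorphic_on O'"
proof -
  obtain p q where f: "nondeg n p q" "f = ratfun_map n p q"
    using assms by (auto simp: rational_map_def)
  let ?P = "map_poly complex_of_real p" and ?Q = "map_poly complex_of_real q"
  have *: "poly ?Q z \<noteq> 0" "the (f (Some z)) = poly ?P z / poly ?Q z" if "z \<in> O'" for z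
    using assms(2)[OF that] by (auto simp: f(2) ratfun_map_Some[OF f(1)] proj_def split: if_splits)
  have "(\<lambda>z. poly ?P z / poly ?Q z) holomorphic_on O'"
    using * by (intro holomorphic_intros) auto
  then show ?thesis by (rule holomorphic_transform) (simp add: *)
qed

text \<open>The bridge between the one-point compactification and chart discs: neighbourhoods of
  infinity are complements of compact sets, that is, contain all points of large modulus.\<close>

lemma closedin_sphere_iff:
  "closedin sphere_topology S \<longleftrightarrow> (\<forall>z. z \<notin> S \<longrightarrow> (\<exists>e>0. disc z e \<inter> S = {}))"
proof -
  have 1: "openin sphere_topology V \<longleftrightarrow>
      open {z. Some z \<in> V} \<and> (None \<in> V \<longrightarrow> bounded {z. Some z \<notin> V})" for V
  proof
    assume "openin sphere_topology V"
    then consider U where "open U" "V = Some ` U"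
      | C where "compact C" "V = insert None (Some ` (- C))"
      by (auto simp: openin_Alexandroff_compactification Compl_eq_Diff_UNIV)
    then show "open {z. Some z \<in> V} \<and> (None \<in> V \<longrightarrow> bounded {z. Some z \<notin> V})"
    proof cases
      case 1
      then have "{z. Some z \<in> V} = U" by auto
      then show ?thesis using 1 by auto
    next
      case 2
      then have "{z. Some z \<in> V} = - C" "{z. Some z \<notin> V} = C" by auto
      then show ?thesis using 2(1) compact_imp_bounded compact_imp_closed by (auto simp: open_Compl)
    qed
  next
    assume V: "open {z. Some z \<in> V} \<and> (None \<in> V \<longrightarrow> bounded {z. Some z \<notin> V})"
    show "openin sphere_topology V"
    proof (cases "None \<in> V")
      case False
      have "x \<in> V \<longleftrightarrow> x \<in> Some ` {z. Some z \<in> V}" for x using False by (cases x) auto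
      then have "V = Some ` {z. Some z \<in> V}" by blast
      then show ?thesis unfolding openin_Alexandroff_compactification using V by auto
    next
      case True
      have "{z. Some z \<notin> V} = - {z. Some z \<in> V}" by auto
      then have "compact {z. Some z \<notin> V}"
        using V True by (simp add: compact_eq_bounded_closed closed_Compl)
      moreover have "x \<in> V \<longleftrightarrow> x \<in> insert None (Some ` (- {z. Some z \<notin> V}))" for x
        using True by (cases x) auto
      then have "V = insert None (Some ` (- {z. Some z \<notin> V}))" by blast
      ultimately have "compactin euclidean {z. Some z \<notin> V} \<and> closedin euclidean {z. Some z \<notin> V} \<and>
          V = insert None (Some ` (topspace euclidean - {z. Some z \<notin> V}))"
        using compact_imp_closed by (simp only: Compl_eq_Diff_UNIV topspace_euclidean
            compactin_euclidean_iff closed_closedin[symmetric] simp_thms)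
      then show ?thesis unfolding openin_Alexandroff_compactification by blast
    qed
  qed
  have 2: "openin sphere_topology V \<longleftrightarrow> (\<forall>z\<in>V. \<exists>e>0. disc z e \<subseteq> V)" for V
  proof
    assume V: "openin sphere_topology V"
    show "\<forall>z\<in>V. \<exists>e>0. disc z e \<subseteq> V"
    proof
      fix z assume z: "z \<in> V"
      show "\<exists>e>0. disc z e \<subseteq> V"
      proof (cases z)
        case None
        then obtain B where B: "B > 0" "\<And>w. Some w \<notin> V \<Longrightarrow> norm w \<le> B"
          using V z unfolding 1 bounded_pos by auto
        have "disc None (1 / B) \<subseteq> V"
        proof
          fix x assume x: "x \<in> disc None (1 / B)"
          show "x \<in> V"
          proof (cases x)
            case (Some u)
            then have "1 < 1 / B * norm u" using x by (simp only: in_disc_None)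
            then have "norm u > B" using B by (simp add: field_simps)
            then show ?thesis using B(2)[of u] Some by force
          qed (use z None in simp)
        qed
        then show ?thesis using None B(1) zero_less_divide_1_iff by blast
      next
        case (Some w)
        have "open {z. Some z \<in> V}" "w \<in> {z. Some z \<in> V}" using V z Some unfolding 1 by auto
        then obtain e where e: "e > 0" "ball w e \<subseteq> {z. Some z \<in> V}" by (rule openE)
        have "disc z e \<subseteq> V"
        proof
          fix x assume "x \<in> disc z e"
          then obtain t where "t \<in> ball 0 e" "x = Some (w + t)" using Some by (auto simp: disc_def)
          moreover from this have "w + t \<in> ball w e" by (simp add: dist_norm)
          ultimately show "x \<in> V" using e(2) by blast
        qed
        then show ?thesis using e(1) by blast
      qed
    qed
  next
    assume V: "\<forall>z\<in>V. \<exists>e>0. disc z e \<subseteq> V"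
    show "openin sphere_topology V" unfolding 1
    proof (intro conjI impI)
      show "open {z. Some z \<in> V}" unfolding open_contains_ball
      proof safe
        fix z assume "Some z \<in> V"
        then obtain e where "e > 0" "disc (Some z) e \<subseteq> V" using V by blast
        then show "\<exists>e>0. ball z e \<subseteq> {z. Some z \<in> V}"
          by (intro exI[of _ e]) (auto simp: dist_norm norm_minus_commute subset_iff)
      qed
      assume "None \<in> V"
      then obtain e where e: "e > 0" "disc None e \<subseteq> V" using V by blast
      have "norm z \<le> 1 / e" if "Some z \<notin> V" for z
      proof -
        have "Some z \<notin> disc None e" using e(2) that by blast
        then show ?thesis using e(1) by (simp add: field_simps)
      qed
      then show "bounded {z. Some z \<notin> V}" unfolding bounded_iff by blast
    qed
  qed
  have "closedin sphere_topology S \<longleftrightarrow> openin sphere_topology (- S)"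
  proof -
    have "openin sphere_topology UNIV" unfolding 1 by simp
    then have "topspace sphere_topology = UNIV" by (rule top_le[OF openin_subset])
    then show ?thesis unfolding closedin_def Compl_eq_Diff_UNIV by simp
  qed
  then show ?thesis unfolding 2 by (metis (no_types, lifting) Compl_iff disjoint_eq_subset_Compl)
qed


section \<open>Conjugation by real Moebius maps\<close>

lemma conj_funpow:
  assumes "\<psi> \<circ> \<phi> = id" "\<phi> \<circ> \<psi> = id"
  shows "(\<phi> \<circ> f \<circ> \<psi>) ^^ n = \<phi> \<circ> f ^^ n \<circ> \<psi>"
proof (induction n)
  case 0
  then show ?case using assms by simp
next
  case (Suc n)
  show ?case
  proof
    fix z
    show "((\<phi> \<circ> f \<circ> \<psi>) ^^ Suc n) z = (\<phi> \<circ> f ^^ Suc n \<circ> \<psi>) z"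
      using fun_cong[OF assms(1)] by (simp add: Suc)
  qed
qed

lemma conj_stable:
  assumes \<phi>: "rational_map 1 \<phi>" and \<psi>: "rational_map 1 \<psi>"
    and inv: "\<psi> \<circ> \<phi> = id" "\<phi> \<circ> \<psi> = id" and "stable f z"
  shows "stable (\<phi> \<circ> f \<circ> \<psi>) (\<phi> z)"
  unfolding stable_def
proof (intro allI impI)
  fix e :: real assume "e > 0"
  obtain e1 where e1: "e1 > 0" "\<phi> ` disc z e1 \<subseteq> disc (\<phi> z) e"
    by (rule rational_map_continuous[OF \<phi> \<open>e > 0\<close>])
  obtain s1 where s1: "s1 > 0" "\<And>x n. x \<in> disc z s1 \<Longrightarrow> (f ^^ n) x \<in> disc z e1"
    using assms(5) e1(1) unfolding stable_def by meson
  obtain s where s: "s > 0" "\<psi> ` disc (\<phi> z) s \<subseteq> disc (\<psi> (\<phi> z)) s1"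
    by (rule rational_map_continuous[OF \<psi> s1(1)])
  have [simp]: "\<psi> (\<phi> x) = x" for x using fun_cong[OF inv(1), of x] by simp
  have "((\<phi> \<circ> f \<circ> \<psi>) ^^ n) x \<in> disc (\<phi> z) e" if "x \<in> disc (\<phi> z) s" for x n
  proof -
    have "\<psi> x \<in> disc z s1" using that s(2) by auto
    then show ?thesis using s1(2) e1(2) by (auto simp: conj_funpow[OF inv])
  qed
  then show "\<exists>s>0. \<forall>x\<in>disc (\<phi> z) s. \<forall>n. ((\<phi> \<circ> f \<circ> \<psi>) ^^ n) x \<in> disc (\<phi> z) e"
    using s(1) by blast
qed

lemma conj_stable_iff:
  assumes \<phi>: "rational_map 1 \<phi>" and \<psi>: "rational_map 1 \<psi>"
    and inv: "\<psi> \<circ> \<phi> = id" "\<phi> \<circ> \<psi> = id"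
  shows "stable (\<phi> \<circ> f \<circ> \<psi>) (\<phi> z) \<longleftrightarrow> stable f z"
proof
  assume "stable (\<phi> \<circ> f \<circ> \<psi>) (\<phi> z)"
  from conj_stable[OF \<psi> \<phi> inv(2,1) this]
  have "stable ((\<psi> \<circ> \<phi>) \<circ> f \<circ> (\<psi> \<circ> \<phi>)) ((\<psi> \<circ> \<phi>) z)" by (simp add: comp_assoc)
  then show "stable f z" unfolding inv by simp
qed (rule conj_stable[OF assms])

definition real_moebius :: "(sphere \<Rightarrow> sphere) \<Rightarrow> (sphere \<Rightarrow> sphere) \<Rightarrow> bool" where
  "real_moebius \<phi> \<psi> \<longleftrightarrow> rational_map 1 \<phi> \<and> rational_map 1 \<psi> \<and> \<psi> \<circ> \<phi> = id \<and> \<phi> \<circ> \<psi> = id"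

lemma real_moebius_sym: "real_moebius \<phi> \<psi> \<Longrightarrow> real_moebius \<psi> \<phi>"
  by (simp add: real_moebius_def)

lemma real_moebiusD:
  assumes "real_moebius \<phi> \<psi>"
  shows "rational_map 1 \<phi>" "rational_map 1 \<psi>" "\<psi> \<circ> \<phi> = id" "\<phi> \<circ> \<psi> = id"
    "\<psi> (\<phi> z) = z" "\<phi> (\<psi> z) = z" "\<phi> z \<in> real_points \<longleftrightarrow> z \<in> real_points"
proof -
  show 1: "rational_map 1 \<phi>" "rational_map 1 \<psi>" "\<psi> \<circ> \<phi> = id" "\<phi> \<circ> \<psi> = id"
    using assms by (auto simp: real_moebius_def)
  show 2: "\<psi> (\<phi> z) = z" "\<phi> (\<psi> z) = z" for z
    using fun_cong[OF 1(3), of z] fun_cong[OF 1(4), of z] by auto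
  show "\<phi> z \<in> real_points \<longleftrightarrow> z \<in> real_points"
    using rational_map_real[OF 1(1), of z] rational_map_real[OF 1(2), of "\<phi> z"] 2 by auto
qed

lemma real_moebius_at:
  fixes r :: real
  obtains \<phi> \<psi> where "real_moebius \<phi> \<psi>" "\<phi> (Some (complex_of_real r)) = None"
    "\<And>t. \<psi> (Some t) = (if t = 0 then None else Some (of_real r + 1 / t))"
    "\<And>z. z \<noteq> of_real r \<Longrightarrow> \<phi> (Some z) = Some (1 / (z - of_real r))" "\<phi> None = Some 0"
proof -
  define \<phi> \<psi> where "\<phi> = ratfun_map 1 [:1:] [:- r, 1:]" and "\<psi> = ratfun_map 1 [:1, r:] [:0, 1:]"
  have h: "homog 1 [:a, b:] x y = of_real a * y + of_real b * x" for a b x y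
    by (simp add: homog_def)
  have h1: "homog 1 [:1:] x y = y" for x y by (simp add: homog_def)
  have "nondeg 1 [:1:] [:- r, 1:]" "nondeg 1 [:1, r:] [:0, 1:]"
    unfolding nondeg_def h h1 by auto
  then have rat: "rational_map 1 \<phi>" "rational_map 1 \<psi>"
    unfolding rational_map_def \<phi>_def \<psi>_def by blast+
  have \<phi>: "\<phi> z = (case z of None \<Rightarrow> Some 0 | Some w \<Rightarrow>
      if w = of_real r then None else Some (1 / (w - of_real r)))" for z
    by (cases z) (auto simp: \<phi>_def ratfun_map_def Let_def map_poly_pCons)
  have \<psi>: "\<psi> z = (case z of None \<Rightarrow> Some (of_real r) | Some t \<Rightarrow>
      if t = 0 then None else Some (of_real r + 1 / t))" for z
    by (cases z) (auto simp: \<psi>_def ratfun_map_def Let_def map_poly_pCons add_divide_distrib)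
  have "\<psi> (\<phi> z) = z" "\<phi> (\<psi> z) = z" for z
    by (cases z; auto simp: \<phi> \<psi>)+
  then have "real_moebius \<phi> \<psi>" using rat by (auto simp: real_moebius_def fun_eq_iff)
  then show thesis using that[of \<phi> \<psi>] by (simp add: \<phi> \<psi>)
qed

lemma real_moebius_id: "real_moebius id id"
  using rational_map_id by (simp add: real_moebius_def)

lemma rational_map_conj:
  assumes "real_moebius \<phi> \<psi>" "rational_map d f"
  shows "rational_map d (\<phi> \<circ> f \<circ> \<psi>)"
  using rational_map_comp[OF rational_map_comp[OF real_moebiusD(1)[OF assms(1)] assms(2)]
      real_moebiusD(2)[OF assms(1)]] by simp

lemma only_real_periodic_points_conj:
  assumes "real_moebius \<phi> \<psi>" "only_real_periodic_points f"
  shows "only_real_periodic_points (\<phi> \<circ> f \<circ> \<psi>)"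
  unfolding only_real_periodic_points_def
proof (intro allI impI)
  note m = real_moebiusD[OF assms(1)]
  fix k z assume "1 \<le> k" "((\<phi> \<circ> f \<circ> \<psi>) ^^ k) z = z"
  then have "\<psi> (\<phi> ((f ^^ k) (\<psi> z))) = \<psi> z" by (simp add: conj_funpow[OF m(3,4)])
  then have "(f ^^ k) (\<psi> z) = \<psi> z" by (simp only: m(5))
  then have "\<psi> z \<in> real_points"
    using assms(2) \<open>1 \<le> k\<close> unfolding only_real_periodic_points_def by blast
  then show "z \<in> real_points"
    using real_moebiusD(7)[OF real_moebius_sym[OF assms(1)]] by simp
qed

section \<open>Local dynamics at a fixed point\<close>

lemma quotient_tendsto_deriv:
  assumes "r > 0" "G holomorphic_on ball 0 r" "G 0 = (0::complex)"
  shows "((\<lambda>t. G t / t) \<longlongrightarrow> deriv G 0) (at 0)"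
proof -
  have "(G has_field_derivative deriv G 0) (at 0)"
    using assms by (intro holomorphic_derivI[of G "ball 0 r"]) auto
  then show ?thesis using assms(3) by (simp add: has_field_derivative_iff)
qed

lemma local_attracting:
  assumes "r > 0" "G holomorphic_on ball 0 r" "G 0 = (0::complex)" "norm (deriv G 0) < 1"
  obtains s \<rho> where "s > 0" "s \<le> r" "0 \<le> \<rho>" "\<rho> < 1" "\<And>t. norm t < s \<Longrightarrow> norm (G t) \<le> \<rho> * norm t"
proof -
  obtain \<rho> where \<rho>: "norm (deriv G 0) < \<rho>" "\<rho> < 1" using dense[OF assms(4)] by blast
  have "((\<lambda>t. norm (G t / t)) \<longlongrightarrow> norm (deriv G 0)) (at 0)"
    by (intro tendsto_norm quotient_tendsto_deriv[OF assms(1-3)])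
  from order_tendstoD(2)[OF this \<rho>(1)]
  obtain s where s: "s > 0" "\<And>t. t \<noteq> 0 \<Longrightarrow> norm t < s \<Longrightarrow> norm (G t / t) < \<rho>"
    unfolding eventually_at by auto
  have "norm (G t) \<le> \<rho> * norm t" if "norm t < min s r" for t
  proof (cases "t = 0")
    case False
    then have "norm (G t) / norm t < \<rho>" using s(2)[of t] that by (simp add: norm_divide)
    then show ?thesis using False by (simp add: divide_less_eq)
  qed (use assms in simp)
  moreover have "0 \<le> \<rho>" using \<rho>(1) norm_ge_zero order.strict_trans1 by (metis less_imp_le)
  ultimately show thesis using that[of "min s r" \<rho>] s(1) assms(1) \<rho>(2) by auto
qed

lemma local_repelling:
  assumes "r > 0" "G holomorphic_on ball 0 r" "G 0 = (0::complex)" "norm (deriv G 0) > 1"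
  obtains s \<rho> where "s > 0" "s \<le> r" "\<rho> > 1" "\<And>t. norm t < s \<Longrightarrow> norm (G t) \<ge> \<rho> * norm t"
proof -
  obtain \<rho> where \<rho>: "norm (deriv G 0) > \<rho>" "\<rho> > 1" using dense[OF assms(4)] by blast
  have "((\<lambda>t. norm (G t / t)) \<longlongrightarrow> norm (deriv G 0)) (at 0)"
    by (intro tendsto_norm quotient_tendsto_deriv[OF assms(1-3)])
  from order_tendstoD(1)[OF this \<rho>(1)]
  obtain s where s: "s > 0" "\<And>t. t \<noteq> 0 \<Longrightarrow> norm t < s \<Longrightarrow> norm (G t / t) > \<rho>"
    unfolding eventually_at by auto
  have "norm (G t) \<ge> \<rho> * norm t" if "norm t < min s r" for t
  proof (cases "t = 0")
    case False
    then have "norm (G t) / norm t > \<rho>" using s(2)[of t] that by (simp add: norm_divide)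
    then show ?thesis using False by (simp add: less_divide_eq)
  qed (use assms in simp)
  then show thesis using that[of "min s r" \<rho>] s(1) assms(1) \<rho>(2) by auto
qed

text \<open>Near a repelling fixed point the distance to it never decreases, so an orbit can
  converge to it only by landing on it exactly.\<close>

lemma local_repelling_landing:
  assumes "r > 0" "G holomorphic_on ball 0 r" "G 0 = (0::complex)" "norm (deriv G 0) > 1"
    and x: "x \<longlonglongrightarrow> 0" "\<And>n. norm (x n) < r \<Longrightarrow> x (Suc n) = G (x n)"
  shows "\<exists>n. x n = 0"
proof (rule ccontr)
  assume nz: "\<nexists>n. x n = 0"
  obtain s \<rho> where s: "s > 0" "s \<le> r" "\<rho> > 1" "\<And>t. norm t < s \<Longrightarrow> norm (G t) \<ge> \<rho> * norm t"
    using local_repelling[OF assms(1-4)] by metis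
  have "\<forall>\<^sub>F n in sequentially. norm (x n) < s"
    using x(1) s(1) by (simp add: tendsto_iff)
  then obtain N where N: "\<And>n. n \<ge> N \<Longrightarrow> norm (x n) < s"
    by (auto simp: eventually_sequentially)
  have "norm (x (N + k)) \<ge> norm (x N)" for k
  proof (induction k)
    case (Suc k)
    have "norm (x (N + k)) < s" using N by simp
    then have "norm (x (N + Suc k)) \<ge> \<rho> * norm (x (N + k))"
      using s(4)[of "x (N + k)"] x(2)[of "N + k"] s(2) by simp
    also have "\<rho> * norm (x (N + k)) \<ge> 1 * norm (x (N + k))"
      using s(3) by (intro mult_right_mono) auto
    finally show ?case using Suc by simp
  qed simp
  moreover have "(\<lambda>k. norm (x (N + k))) \<longlonglongrightarrow> 0"
    using LIMSEQ_ignore_initial_segment[OF tendsto_norm_zero[OF x(1)], of N] by (simp add: add.commute)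
  ultimately have "norm (x N) \<le> 0"
    by (intro tendsto_lowerbound[of _ _ sequentially]) (auto intro: always_eventually)
  then show False using nz by simp
qed

text \<open>The second iterate has derivative 1 for both signs of the multiplier; \<open>m\<close>
  is the order of vanishing of \<open>G (G t) - t\<close>, which \<open>nid\<close> makes
  finite.\<close>

lemma parabolic_factor:
  assumes "r > 0" "G holomorphic_on ball 0 r" "G 0 = (0::complex)"
    and \<lambda>: "deriv G 0 = 1 \<or> deriv G 0 = -1"
    and nid: "\<And>s. s > 0 \<Longrightarrow> \<exists>t\<in>ball 0 s. G (G t) \<noteq> t"
  obtains m s K where "m \<ge> 2" "s > 0" "s \<le> r" "K holomorphic_on ball 0 s"
    "\<And>t. t \<in> ball 0 s \<Longrightarrow> K t \<noteq> 0" "\<And>t. t \<in> ball 0 s \<Longrightarrow> norm (G t) < r"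
    "\<And>t. t \<in> ball 0 s \<Longrightarrow> G (G t) = t + t ^ m * K t"
proof -
  have "continuous (at 0) G"
    using holomorphic_on_imp_continuous_on[OF assms(2)] assms(1)
      continuous_on_interior[of "ball 0 r" G 0] by simp
  then have "\<forall>e>0. \<exists>d>0. \<forall>x. dist x 0 < d \<longrightarrow> dist (G x) (G 0) < e"
    unfolding continuous_at_eps_delta by blast
  then obtain d where d: "d > 0" "\<And>x. norm x < d \<Longrightarrow> norm (G x) < r"
    using assms(1,3) by (metis dist_0_norm dist_commute)
  define e where "e = min d r"
  have e: "e > 0" "e \<le> r" "\<And>x. norm x < e \<Longrightarrow> norm (G x) < r"
    using d assms(1) by (auto simp: e_def)
  have GG: "(G \<circ> G) holomorphic_on ball 0 e"
    using assms(2) e by (intro holomorphic_on_compose_gen[of G "ball 0 e" G "ball 0 r"])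
      (auto intro: holomorphic_on_subset)
  define D where "D = (\<lambda>t. G (G t) - t)"
  have hol: "D holomorphic_on ball 0 e"
    using GG unfolding comp_def D_def by (intro holomorphic_intros)
  have D0: "0 \<in> ball (0::complex) e" "D 0 = 0" using e(1) assms(3) by (simp_all add: D_def)
  have nc: "\<not> D constant_on ball 0 e"
  proof
    assume "D constant_on ball 0 e"
    then obtain c where c: "\<And>t. t \<in> ball 0 e \<Longrightarrow> D t = c" unfolding constant_on_def by blast
    have "c = 0" using c[of 0] D0 by simp
    then show False using nid[OF e(1)] c by (fastforce simp: D_def)
  qed
  obtain K s m where K: "0 < m" "0 < s" "ball 0 s \<subseteq> ball (0::complex) e" "K holomorphic_on ball 0 s"
    and D: "\<And>w. w \<in> ball 0 s \<Longrightarrow> D w = (w - 0) ^ m * K w"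
    and Knz: "\<And>w. w \<in> ball 0 s \<Longrightarrow> K w \<noteq> 0"
    by (rule holomorphic_factor_zero_nonconstant[OF hol open_ball connected_ball D0 nc]) (rule that)
  have s: "s \<le> e" using K(2,3) e(1) by (simp add: ball_subset_ball_iff)
  have eq: "G (G t) = t + t ^ m * K t" if "t \<in> ball 0 s" for t
    using D[OF that] by (simp add: D_def algebra_simps)
  \<comment> \<open>A simple zero would give the second iterate the derivative
    \<open>1 + K 0\<close>, with \<open>K 0\<close> nonzero, whereas the chain rule gives 1.\<close>
  have "m \<noteq> 1"
  proof
    assume "m = 1"
    have "(G has_field_derivative deriv G 0) (at 0)"
      using assms by (intro holomorphic_derivI[of G "ball 0 r"]) auto
    then have "((G \<circ> G) has_field_derivative deriv G 0 * deriv G 0) (at 0)"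
      using assms(3) by (intro DERIV_chain) auto
    then have "((G \<circ> G) has_field_derivative 1) (at 0)" using \<lambda> by auto
    then have 1: "((\<lambda>t. G (G t) / t) \<longlongrightarrow> 1) (at 0)"
      using assms(3) by (simp add: has_field_derivative_iff)
    have "continuous (at 0) K"
      using holomorphic_on_imp_continuous_on[OF K(4)] K(2)
        continuous_on_interior[of "ball 0 s" K 0] by simp
    then have "((\<lambda>t. 1 + K t) \<longlongrightarrow> 1 + K 0) (at 0)"
      by (intro tendsto_intros) (simp add: continuous_at)
    moreover have "\<forall>\<^sub>F t in at 0. 1 + K t = G (G t) / t"
      unfolding eventually_at using K(2) \<open>m = 1\<close>
      by (intro exI[of _ s]) (auto simp: eq field_simps)
    ultimately have "((\<lambda>t. G (G t) / t) \<longlongrightarrow> 1 + K 0) (at 0)"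
      by (rule Lim_transform_eventually)
    from tendsto_unique[OF _ this 1] have "K 0 = 0" by simp
    then show False using Knz[of 0] K(2) by simp
  qed
  then show thesis using that[of m s K] K Knz e s eq by auto
qed

text \<open>A repelling germ expands geometrically. For multiplier 1 or -1 the coefficient of
  \<open>t ^ m\<close> in the \<open>n\<close>-th iterate of \<open>G o G\<close> is
  \<open>n * K 0\<close>; if small starting points kept their orbits in a fixed disc, Cauchy's
  inequality would bound this coefficient uniformly in \<open>n\<close>.\<close>

lemma indifferent_or_repelling_unstable:
  assumes "r > 0" "G holomorphic_on ball 0 r" "G 0 = (0::complex)"
    and \<lambda>: "deriv G 0 = 1 \<or> deriv G 0 = -1 \<or> norm (deriv G 0) > 1"
    and nid: "\<And>s. s > 0 \<Longrightarrow> \<exists>t\<in>ball 0 s. G (G t) \<noteq> t"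
  obtains e where "e > 0" "e \<le> r" "\<And>s. s > 0 \<Longrightarrow> \<exists>t n. norm t < s \<and> norm ((G ^^ n) t) \<ge> e"
proof (cases "norm (deriv G 0) > 1")
  case True
  obtain e \<rho> where e: "e > 0" "e \<le> r" "\<rho> > 1" "\<And>t. norm t < e \<Longrightarrow> norm (G t) \<ge> \<rho> * norm t"
    using local_repelling[OF assms(1-3) True] by metis
  show thesis
  proof (rule that[OF e(1,2)], rule ccontr)
    fix s :: real assume s: "s > 0" and "\<nexists>t n. norm t < s \<and> norm ((G ^^ n) t) \<ge> e"
    then have lt: "norm ((G ^^ n) t) < e" if "norm t < s" for t n using that by (meson not_le)
    define t where "t = complex_of_real (s / 2)"
    have t: "norm t < s" "norm t > 0" using s by (auto simp: t_def)
    have "norm ((G ^^ n) t) \<ge> \<rho> ^ n * norm t" for n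
    proof (induction n)
      case (Suc n)
      have "norm ((G ^^ Suc n) t) \<ge> \<rho> * norm ((G ^^ n) t)" using e(4)[OF lt[OF t(1), of n]] by simp
      moreover have "\<rho> * norm ((G ^^ n) t) \<ge> \<rho> * (\<rho> ^ n * norm t)"
        using Suc e(3) by (intro mult_left_mono) auto
      ultimately show ?case by (simp add: mult.assoc)
    qed simp
    moreover obtain n where "e / norm t < \<rho> ^ n" using real_arch_pow[OF e(3)] by blast
    then have "e < \<rho> ^ n * norm t" using t(2) by (simp add: field_simps)
    ultimately show False using lt[OF t(1), of n] by (meson less_le_trans not_less_iff_gr_or_eq
        less_trans)
  qed
next
  case False
  then have "deriv G 0 = 1 \<or> deriv G 0 = -1" using \<lambda> by blast
  from parabolic_factor[OF assms(1-3) this nid]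
  obtain m e K where K: "m \<ge> 2" "e > 0" "e \<le> r" "K holomorphic_on ball 0 e"
    "\<And>t. t \<in> ball 0 e \<Longrightarrow> K t \<noteq> 0" "\<And>t. t \<in> ball 0 e \<Longrightarrow> norm (G t) < r"
    "\<And>t. t \<in> ball 0 e \<Longrightarrow> G (G t) = t + t ^ m * K t" by metis
  show thesis
  proof (rule that[OF K(2,3)], rule ccontr)
    fix s' :: real assume s': "s' > 0" and "\<nexists>t n. norm t < s' \<and> norm ((G ^^ n) t) \<ge> e"
    then have lt': "norm ((G ^^ n) t) < e" if "norm t < s'" for t n using that by (meson not_le)
    define s where "s = min s' e"
    have s: "s > 0" "s \<le> e" and lt: "norm ((G ^^ n) t) < e" if "norm t < s" for t n
      using s' K(2) lt' that by (auto simp: s_def)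
    have s: "s > 0" "s \<le> e" using s' K(2) by (auto simp: s_def)
    define H where "H = (\<lambda>n. G ^^ (2 * n))"
    have HSuc: "H (Suc n) t = G (G (H n t))" for n t by (simp add: H_def)
    have Hlt: "norm (H n t) < e" if "norm t < s" for n t using lt[OF that] by (simp add: H_def)
    \<comment> \<open>The iterate is tracked through \<open>L\<close>, so that only the value
      \<open>L 0\<close> of the growing coefficient has to be computed.\<close>
    have H: "\<exists>L. L holomorphic_on ball 0 s \<and> (\<forall>t\<in>ball 0 s. H n t = t + t ^ m * L t) \<and>
        L 0 = of_nat n * K 0" for n
    proof (induction n)
      case 0
      show ?case by (intro exI[of _ "\<lambda>t. 0"]) (simp add: H_def)
    next
      case (Suc n)
      then obtain L where L: "L holomorphic_on ball 0 s" "L 0 = of_nat n * K 0"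
        "\<And>t. t \<in> ball 0 s \<Longrightarrow> H n t = t + t ^ m * L t" by blast
      \<comment> \<open>Obtained by inserting \<open>t + t^m L\<close> into \<open>t + t^m K\<close>
        and dividing the increment by \<open>t^m\<close>.\<close>
      define L' where "L' = (\<lambda>t. L t + (1 + t ^ (m - 1) * L t) ^ m * K (t + t ^ m * L t))"
      have tm: "t ^ m = t * t ^ (m - 1)" for t :: complex
        using K(1) by (metis One_nat_def Suc_pred less_le_trans pos2 power_Suc)
      have "(K \<circ> (\<lambda>t. t + t ^ m * L t)) holomorphic_on ball 0 s"
      proof (rule holomorphic_on_compose_gen[OF _ K(4)])
        show "(\<lambda>t. t + t ^ m * L t) holomorphic_on ball 0 s" using L(1) by (intro holomorphic_intros)
        show "(\<lambda>t. t + t ^ m * L t) ` ball 0 s \<subseteq> ball 0 e" 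
        proof (rule image_subsetI)
          fix t :: complex assume t: "t \<in> ball 0 s"
          then show "t + t ^ m * L t \<in> ball 0 e" using Hlt[of t n] by (simp flip: L(3)[OF t])
        qed
      qed
      then have "L' holomorphic_on ball 0 s"
        unfolding L'_def using L(1) by (intro holomorphic_intros) (auto simp: comp_def)
      moreover have "H (Suc n) t = t + t ^ m * L' t" if "t \<in> ball 0 s" for t
      proof -
        have "H (Suc n) t = H n t + H n t ^ m * K (H n t)"
          using K(7)[of "H n t"] Hlt[of t n] that by (simp add: HSuc)
        moreover have "H n t = t * (1 + t ^ (m - 1) * L t)"
          unfolding L(3)[OF that] by (subst tm) (simp add: algebra_simps)
        then have "H n t ^ m = t ^ m * (1 + t ^ (m - 1) * L t) ^ m"
          by (simp only: power_mult_distrib)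
        ultimately show ?thesis unfolding L'_def L(3)[OF that] by (simp add: algebra_simps)
      qed
      moreover have "L' 0 = of_nat (Suc n) * K 0"
        using K(1) L(2) by (simp add: L'_def power_0_left algebra_simps)
      ultimately show ?case by blast
    qed
    \<comment> \<open>On the circle of radius \<open>s / 2\<close> one has
      \<open>|t^m L(t)| <= |H n t| + |t| <= 2 e\<close>.\<close>
    define B where "B = 2 * e / (s / 2) ^ m"
    have "norm (of_nat n * K 0) \<le> B" for n
    proof -
      obtain L where L: "L holomorphic_on ball 0 s" "L 0 = of_nat n * K 0"
        "\<And>t. t \<in> ball 0 s \<Longrightarrow> H n t = t + t ^ m * L t" using H[of n] by blast
      have "norm ((deriv ^^ 0) L 0) \<le> fact 0 * B / (s / 2) ^ 0"
      proof (rule Cauchy_inequality)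
        show "L holomorphic_on ball 0 (s / 2)" using L(1) s(1) by (rule_tac holomorphic_on_subset) auto
        show "continuous_on (cball 0 (s / 2)) L"
          using holomorphic_on_imp_continuous_on[OF L(1)] s(1) by (rule_tac continuous_on_subset) auto
        fix t :: complex assume "norm (0 - t) = s / 2"
        then have t: "norm t = s / 2" by simp
        then have tb: "t \<in> ball 0 s" using s(1) by simp
        have "norm (t ^ m * L t) = norm (H n t - t)" using L(3)[OF tb] by simp
        also have "\<dots> \<le> norm (H n t) + norm t" by norm
        also have "\<dots> \<le> 2 * e" using Hlt[of t n] tb s(2) t s(1) by simp
        finally show "norm (L t) \<le> B"
          using s(1) t by (simp add: B_def norm_mult norm_power field_simps)
      qed (use s in auto)
      then show ?thesis using L(2) by simp
    qed
    then have B: "real n * norm (K 0) \<le> B" for n by (simp add: norm_mult)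
    have "norm (K 0) > 0" using K(5)[of 0] K(2) by simp
    then obtain n where "B < real n * norm (K 0)" using reals_Archimedean3 by blast
    then show False using B[of n] by simp
  qed
qed

text \<open>The attracting petals of Leau and Fatou. In the coordinate \<open>v\<close> the second
  iterate is close to the translation by 1, so \<open>Re v\<close> grows by at least 1/2 per step
  and the preimage of a right half-plane is invariant. This preimage is a union of petals, which
  need not be connected.\<close>

lemma parabolic_petal:
  assumes "r > 0" "G holomorphic_on ball 0 r" "G 0 = (0::complex)"
    and \<lambda>: "deriv G 0 = 1 \<or> deriv G 0 = -1"
    and nid: "\<And>s. s > 0 \<Longrightarrow> \<exists>t\<in>ball 0 s. G (G t) \<noteq> t"
  obtains P where "open P" "P \<noteq> {}" "\<And>t. t \<in> P \<Longrightarrow> norm t < r \<and> norm (G t) < r \<and> G (G t) \<in> P"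
    "\<And>t. t \<in> P \<Longrightarrow> t \<noteq> 0 \<and> (\<lambda>n. (G ^^ (2 * n)) t) \<longlonglongrightarrow> 0"
proof -
  obtain m s K where K: "m \<ge> 2" "s > 0" "s \<le> r" "K holomorphic_on ball 0 s"
    "\<And>t. t \<in> ball 0 s \<Longrightarrow> K t \<noteq> 0" "\<And>t. t \<in> ball 0 s \<Longrightarrow> norm (G t) < r"
    "\<And>t. t \<in> ball 0 s \<Longrightarrow> G (G t) = t + t ^ m * K t"
    using parabolic_factor[OF assms] by metis
  define j where "j = m - 1"
  have j: "m = Suc j" "j \<ge> 1" using K(1) by (auto simp: j_def)
  have K0: "K 0 \<noteq> 0" using K(5)[of 0] K(2) by simp
  \<comment> \<open>The approximate Fatou coordinate. The factor \<open>j * K 0\<close> makes the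
    limiting displacement exactly 1.\<close>
  define v where "v = (\<lambda>t. - 1 / (of_nat j * K 0 * t ^ j))"
  have Kc: "K \<midarrow>0\<rightarrow> K 0"
    using holomorphic_on_imp_continuous_on[OF K(4)] K(2)
      continuous_on_interior[of "ball 0 s" K 0] by (simp add: continuous_at)
  \<comment> \<open>With \<open>G (G t) = t (1 + y)\<close> the increment of \<open>v\<close>
    involves \<open>(1 + y)^(-j) - 1\<close>. Caratheodory's form of the derivative writes this as
    \<open>g y * y\<close> with \<open>g\<close> continuous at \<open>0\<close> and
    \<open>g 0 = -j\<close>.\<close>
  have "((\<lambda>y::complex. inverse ((1 + y) ^ j)) has_field_derivative - of_nat j) (at 0)"
    by (auto intro!: derivative_eq_intros)
  then obtain g :: "complex \<Rightarrow> complex" where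
    "\<forall>y. inverse ((1 + y) ^ j) - inverse ((1 + 0) ^ j) = g y * (y - 0)"
    and g: "isCont g 0" "g 0 = - of_nat j"
    unfolding CARAT_DERIV by blast
  then have g1: "inverse ((1 + y) ^ j) - 1 = g y * y" for y by simp
  have y0: "((\<lambda>t. t ^ j * K t) \<longlongrightarrow> 0 ^ j * K 0) (at 0)" by (intro tendsto_intros Kc)
  then have y0: "((\<lambda>t. t ^ j * K t) \<longlongrightarrow> 0) (at 0)" using j(2) by (simp add: power_0_left)
  then have "((\<lambda>t. g (t ^ j * K t)) \<longlongrightarrow> g 0) (at 0)"
    by (rule isCont_tendsto_compose[OF g(1)])
  then have "((\<lambda>t. - 1 / (of_nat j * K 0) * K t * g (t ^ j * K t)) \<longlongrightarrow> - 1 / (of_nat j * K 0) * K 0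
      * g 0) (at 0)"
    by (intro tendsto_intros Kc)
  \<comment> \<open>This expression is the displacement \<open>v (G (G t)) - v t\<close>, as
    \<open>step\<close> verifies.\<close>
  then have lim: "((\<lambda>t. - 1 / (of_nat j * K 0) * K t * g (t ^ j * K t)) \<longlongrightarrow> 1) (at 0)"
    using K0 j(2) g(2) by simp
  have ev1: "\<forall>\<^sub>F t in at 0. dist (- 1 / (of_nat j * K 0) * K t * g (t ^ j * K t)) 1 < 1 / 2"
    by (rule tendstoD[OF lim]) simp
  have ev2: "\<forall>\<^sub>F t in at 0. dist (t ^ j * K t) 0 < 1" by (rule tendstoD[OF y0]) simp
  have "\<forall>\<^sub>F t in at 0. dist (- 1 / (of_nat j * K 0) * K t * g (t ^ j * K t)) 1 < 1 / 2 \<and>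
      dist (t ^ j * K t) 0 < 1"
    using ev1 ev2 by (rule eventually_conj)
  then obtain s1 where s1: "s1 > 0" "\<And>t. t \<noteq> 0 \<Longrightarrow> norm t < s1 \<Longrightarrow>
      norm (- 1 / (of_nat j * K 0) * K t * g (t ^ j * K t) - 1) < 1 / 2 \<and> norm (t ^ j * K t) < 1"
    unfolding eventually_at by (auto simp: dist_norm)
  define s2 where "s2 = min s s1"
  have s2: "s2 > 0" "s2 \<le> s" "s2 \<le> s1" using K(2) s1(1) by (auto simp: s2_def)
  have step: "G (G t) \<noteq> 0 \<and> norm (v (G (G t)) - v t - 1) < 1 / 2" if t: "t \<noteq> 0" "norm t < s2" for t
  proof -
    define y where "y = t ^ j * K t"
    have "norm y < 1" using s1(2)[of t] t s2 by (simp add: y_def)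
    then have y1: "1 + y \<noteq> 0" by (metis add.inverse_unique norm_minus_cancel norm_one order_less_irrefl)
    have GG: "G (G t) = t * (1 + y)" using K(7)[of t] t s2 by (simp add: y_def j(1) algebra_simps)
    have "v (G (G t)) - v t = - 1 / (of_nat j * K 0 * t ^ j) * (inverse ((1 + y) ^ j) - 1)"
      unfolding v_def GG power_mult_distrib using t y1 K0 j(2) by (simp add: field_simps)
    also have "\<dots> = - 1 / (of_nat j * K 0) * K t * g y"
      unfolding g1 using t K0 j(2) by (simp add: y_def)
    finally show ?thesis using s1(2)[of t] t s2 y1 GG by (simp add: y_def)
  qed
  \<comment> \<open>The threshold beyond which \<open>Re (v t) > R\<close> forces
    \<open>norm t < s2\<close>, where the displacement estimate holds.\<close>
  define R where "R = 1 / (real j * norm (K 0) * s2 ^ j)"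
  have R: "R > 0" using j K0 s2 by (simp add: R_def)
  have small: "norm t ^ j < 1 / (real j * norm (K 0) * c)" if "t \<noteq> 0" "Re (v t) > c" "c > 0" for t c
  proof -
    have "c < norm (v t)" using that complex_Re_le_cmod[of "v t"] by linarith
    also have "norm (v t) = 1 / (real j * norm (K 0) * norm t ^ j)"
      by (simp add: v_def norm_divide norm_mult norm_power)
    finally show ?thesis using that K0 j by (simp add: field_simps)
  qed
  have lts2: "norm t < s2" if "t \<noteq> 0" "Re (v t) > R" for t
  proof -
    have "norm t ^ j < s2 ^ j" using small[OF that R] j K0 s2 by (simp add: R_def)
    then show ?thesis using s2(1) power_less_imp_less_base by (metis less_imp_le)
  qed
  define P where "P = {t. t \<noteq> 0 \<and> Re (v t) > R}"
  have Pstep: "G (G t) \<in> P \<and> Re (v (G (G t))) \<ge> Re (v t) + 1 / 2" if "t \<in> P" for t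
  proof -
    have t: "t \<noteq> 0" "Re (v t) > R" using that by (auto simp: P_def)
    have *: "G (G t) \<noteq> 0" "norm (v (G (G t)) - v t - 1) < 1 / 2" using step[OF t(1) lts2[OF t]] by auto
    then have "\<bar>Re (v (G (G t)) - v t - 1)\<bar> < 1 / 2" using abs_Re_le_cmod order.strict_trans1 by blast
    then have "\<bar>Re (v (G (G t))) - Re (v t) - 1\<bar> < 1 / 2"
      by (simp only: minus_complex.simps one_complex.simps)
    then have "Re (v (G (G t))) \<ge> Re (v t) + 1 / 2" by arith
    then show ?thesis using *(1) t by (auto simp: P_def)
  qed
  show thesis
  proof (rule that[of P])
    have "continuous_on (- {0}) (\<lambda>t. Re (v t))"
      unfolding v_def using K0 j by (intro continuous_intros) auto
    then have "open ((\<lambda>t. Re (v t)) -` {R<..} \<inter> - {0})"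
      using continuous_on_open_vimage[of "- {0::complex}" "\<lambda>t. Re (v t)"] by (simp add: open_Compl)
    moreover have "(\<lambda>t. Re (v t)) -` {R<..} \<inter> - {0} = P" by (auto simp: P_def)
    ultimately show "open P" by simp
    \<comment> \<open>A point of \<open>P\<close> is found by solving \<open>v t = R + 1\<close>,
      that is \<open>t ^ j = - 1 / c\<close>, with a complex root.\<close>
    define c where "c = of_nat j * K 0 * complex_of_real (R + 1)"
    have "complex_of_real (R + 1) \<noteq> 0" using R by (metis add_nonneg_pos less_imp_le
        less_numeral_extra(1) less_numeral_extra(3) of_real_eq_0_iff)
    then have c: "c \<noteq> 0" using K0 j(2) by (simp add: c_def del: of_real_add)
    obtain t :: complex where t: "t ^ j = - 1 / c"
      using nth_root_exists[of j "- 1 / c"] j(2) by auto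
    have "t \<noteq> 0"
    proof
      assume "t = 0"
      then have "- 1 / c = 0" using t j(2) by (simp only: power_0_left split: if_splits)
      then show False using c by simp
    qed
    moreover have "v t = - 1 / (of_nat j * K 0 * (- 1 / c))" by (simp only: v_def t)
    then have "v t = of_real (R + 1)" using c unfolding c_def by (simp only: mult_eq_0_iff) (simp
        add: field_simps)
    then have "Re (v t) > R" by simp
    ultimately have "t \<in> P" by (simp add: P_def)
    then show "P \<noteq> {}" by blast
    fix t assume t: "t \<in> P"
    then have ts: "norm t < s2" "t \<noteq> 0" using lts2 by (auto simp: P_def)
    show "norm t < r \<and> norm (G t) < r \<and> G (G t) \<in> P"
      using ts s2 K(3) K(6)[of t] Pstep[OF t] by simp
    have it: "(G ^^ (2 * n)) t \<in> P \<and> Re (v ((G ^^ (2 * n)) t)) > R + real n / 2" for n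
    proof (induction n)
      case 0
      then show ?case using t by (simp add: P_def)
    next
      case (Suc n)
      then show ?case using Pstep[of "(G ^^ (2 * n)) t"] by (auto simp: add_divide_distrib)
    qed
    have bd: "norm ((G ^^ (2 * n)) t) ^ j \<le> 1 / (real j * norm (K 0)) * inverse (real n / 2)" if
        "n > 0" for n
    proof -
      have "norm ((G ^^ (2 * n)) t) ^ j < 1 / (real j * norm (K 0) * (real n / 2))"
        using it[of n] that R by (intro small) (auto simp: P_def)
      also have "\<dots> = 1 / (real j * norm (K 0)) * inverse (real n / 2)"
        by (simp only: divide_inverse inverse_mult_distrib mult.assoc)
      finally show ?thesis by (rule less_imp_le)
    qed
    have "(\<lambda>n. inverse (real n / 2)) \<longlonglongrightarrow> 0" by real_asymp
    then have "(\<lambda>n. 1 / (real j * norm (K 0)) * inverse (real n / 2)) \<longlonglongrightarrow> 0"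
      by (rule tendsto_mult_right_zero)
    then have "(\<lambda>n. norm ((G ^^ (2 * n)) t) ^ j) \<longlonglongrightarrow> 0"
    proof (rule tendsto_sandwich[OF _ _ tendsto_const, rotated 2])
      show "\<forall>\<^sub>F n in sequentially. norm ((G ^^ (2 * n)) t) ^ j
          \<le> 1 / (real j * norm (K 0)) * inverse (real n / 2)"
        by (rule eventually_sequentiallyI[of 1]) (use bd in simp)
    qed simp
    then have "(\<lambda>n. norm ((G ^^ (2 * n)) t)) \<longlonglongrightarrow> 0"
      using j(2) by (simp add: tendsto_null_power)
    then show "t \<noteq> 0 \<and> (\<lambda>n. (G ^^ (2 * n)) t) \<longlonglongrightarrow> 0" using ts(2) by (simp add: tendsto_norm_zero_iff)
  qed
qed

section \<open>Multipliers\<close>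

lemma local_repD:
  assumes "local_rep f z r G"
  shows "r > 0" "G holomorphic_on ball 0 r" "G 0 = 0"
    "norm t < r \<Longrightarrow> f (chart z t) = chart (f z) (G t)"
  using assms by (auto simp: local_rep_def)

lemma chart_in_disc [simp]: "chart z t \<in> disc z e \<longleftrightarrow> norm t < e"
  unfolding disc_def using chart_inj by (auto simp: image_iff)

lemma local_rep_not_eventually:
  assumes g: "rational_map n g" "n \<ge> 1" and s: "s > 0"
  shows "\<exists>t\<in>ball 0 s. g (chart z t) \<noteq> y"
proof (rule ccontr)
  assume "\<not> (\<exists>t\<in>ball 0 s. g (chart z t) \<noteq> y)"
  then have "chart z ` ball 0 s \<subseteq> {x. g x = y}" by blast
  then have "finite (chart z ` ball 0 s)"
    using rational_map_finite_preimage[OF g] by (rule finite_subset)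
  moreover have "inj_on (chart z) (ball 0 s)" by (simp add: inj_on_def chart_inj)
  ultimately have "finite (ball (0::complex) s)" by (rule finite_imageD)
  then show False using s uncountable_ball[of s 0] countable_finite by blast
qed

lemma local_rep_not_fixed:
  assumes g: "rational_map n g" "n \<ge> 2" and s: "s > 0"
  shows "\<exists>t\<in>ball 0 s. g (chart z t) \<noteq> chart z t"
proof (rule ccontr)
  assume "\<not> (\<exists>t\<in>ball 0 s. g (chart z t) \<noteq> chart z t)"
  then have "chart z ` ball 0 s \<subseteq> {x. g x = x}" by blast
  then have "finite (chart z ` ball 0 s)"
    using rational_map_finite_fixed[OF g] by (rule finite_subset)
  moreover have "inj_on (chart z) (ball 0 s)" by (simp add: inj_on_def chart_inj)
  ultimately have "finite (ball (0::complex) s)" by (rule finite_imageD)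
  then show False using s uncountable_ball[of s 0] countable_finite by blast
qed

lemma affine_deriv_local_rep:
  assumes "local_rep g (Some w) r G" "g (Some w) = Some w"
  shows "affine_deriv g w = deriv G 0"
proof -
  note G = local_repD[OF assms(1)]
  have "(G has_field_derivative deriv G 0) (at 0)"
    using G by (intro holomorphic_derivI[OF G(2)]) auto
  then have "(G has_field_derivative deriv G 0) (at (w - w))" by simp
  then have "((\<lambda>u. w + G (u - w)) has_field_derivative deriv G 0) (at w)"
    by (auto intro!: derivative_eq_intros DERIV_chain2[of G _ "\<lambda>u. u - w"])
  then have "((\<lambda>u. the (g (Some u))) has_field_derivative deriv G 0) (at w)"
  proof (rule has_field_derivative_transform_within_open[OF _ open_ball, of _ _ _ _ r])
    fix u assume "u \<in> ball w r"
    then have "norm (u - w) < r" by (simp add: dist_norm norm_minus_commute)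
    from G(4)[OF this] show "w + G (u - w) = the (g (Some u))" using assms(2) by simp
  qed (use G(1) in simp)
  then show ?thesis unfolding affine_deriv_def by (rule DERIV_imp_deriv)
qed

lemma holomorphic_nonconstant_zero_factor:
  assumes "r > 0" "G holomorphic_on ball 0 r" "G 0 = (0::complex)" "\<And>s. s > 0 \<Longrightarrow> \<exists>t\<in>ball 0 s. G t \<noteq> 0"
  obtains m s K where "0 < m" "0 < s" "s \<le> r" "K holomorphic_on ball 0 s"
    "\<And>t. norm t < s \<Longrightarrow> G t = t ^ m * K t" "\<And>t. norm t < s \<Longrightarrow> K t \<noteq> 0"
proof -
  have z0: "0 \<in> ball (0::complex) r" using assms(1) by simp
  have nc: "\<not> G constant_on ball 0 r"
  proof
    assume "G constant_on ball 0 r"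
    then obtain c where c: "\<And>t. t \<in> ball 0 r \<Longrightarrow> G t = c" unfolding constant_on_def by blast
    then have "c = 0" using assms(3) z0 by fastforce
    then show False using assms(4)[OF assms(1)] c by blast
  qed
  obtain K s m where K: "0 < m" "0 < s" "ball 0 s \<subseteq> ball (0::complex) r" "K holomorphic_on ball 0 s"
    and D: "\<And>w. w \<in> ball 0 s \<Longrightarrow> G w = (w - 0) ^ m * K w"
    and Knz: "\<And>w. w \<in> ball 0 s \<Longrightarrow> K w \<noteq> 0"
    using holomorphic_factor_zero_nonconstant[OF assms(2) open_ball connected_ball z0 assms(3) nc]
        by metis
  have "s \<le> r" using K(2,3) by (simp add: ball_subset_ball_iff)
  then show thesis using that[of m s K] K D Knz by simp
qed

text \<open>If \<open>G t = t^m K(t)\<close>, then \<open>g\<close> in the affine coordinate is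
  \<open>u^m / K(1/u)\<close>. For \<open>m = 1\<close> its derivative tends to
  \<open>1 / K 0\<close>, the inverse of \<open>deriv G 0 = K 0\<close>; for \<open>m > 1\<close> it
  tends to infinity, and the convention gives \<open>0 = deriv G 0\<close>.\<close>

lemma multiplier_infinity_local_rep:
  assumes g: "rational_map n g" "n \<ge> 1" "g None = None" and G: "local_rep g None r G"
  shows "(if filterlim (affine_deriv g) at_infinity at_infinity then 0
           else inverse (Lim at_infinity (affine_deriv g))) = deriv G 0"
proof -
  note G' = local_repD[OF G]
  have nz: "\<exists>t\<in>ball 0 s. G t \<noteq> 0" if "s > 0" for s
  proof -
    have "min s r > 0" using that G'(1) by simp
    from local_rep_not_eventually[OF g(1,2) this]
    obtain t where "t \<in> ball 0 (min s r)" "g (chart None t) \<noteq> None" by blast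
    then show ?thesis using G'(4)[of t] g(3) by (intro bexI[of _ t]) auto
  qed
  obtain m s K where K: "0 < m" "0 < s" "s \<le> r" "K holomorphic_on ball 0 s"
    "\<And>t. norm t < s \<Longrightarrow> G t = t ^ m * K t" "\<And>t. norm t < s \<Longrightarrow> K t \<noteq> 0"
    using holomorphic_nonconstant_zero_factor[OF G'(1-3) nz] by metis
  obtain j where j: "m = Suc j" using K(1) by (cases m) auto
  have dK: "(K has_field_derivative deriv K t) (at t)" if "norm t < s" for t
    using that by (intro holomorphic_derivI[OF K(4)]) auto
  have "((\<lambda>t. t ^ m * K t) has_field_derivative (if j = 0 then K 0 else 0)) (at 0)"
    using dK[of 0] K(2) by (auto intro!: derivative_eq_intros simp: j power_0_left)
  then have "(G has_field_derivative (if j = 0 then K 0 else 0)) (at 0)"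
    by (rule has_field_derivative_transform_within_open[OF _ open_ball, of _ _ _ 0 s]) (use K in auto)
  then have dG: "deriv G 0 = (if j = 0 then K 0 else 0)" by (rule DERIV_imp_deriv)
  \<comment> \<open>The derivative of \<open>u^m / K(1/u)\<close> is \<open>u^(m-1)\<close> times
    this function at \<open>1 / u\<close>.\<close>
  define E where "E = (\<lambda>t. (of_nat m * K t + t * deriv K t) / K t ^ 2)"
  have ad: "affine_deriv g u = E (inverse u) * u ^ j" if u: "norm u > 1 / s" for u
  proof -
    have u0: "u \<noteq> 0" using u K(2) by auto
    have iu: "norm (inverse u) < s"
      using less_imp_inverse_less[OF u] K(2) by (simp add: norm_inverse)
    have Kn: "K (inverse u) \<noteq> 0" using K(6)[OF iu] .
    have "(inverse has_field_derivative - (inverse u ^ 2)) (at u)"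
      using DERIV_inverse[OF u0, of UNIV] by (simp add: numeral_2_eq_2)
    from DERIV_chain2[where f = K and g = inverse, OF dK[OF iu] this]
    have "((\<lambda>u. K (inverse u)) has_field_derivative deriv K (inverse u) * - (inverse u ^ 2)) (at u)" .
    moreover have "((\<lambda>u. u ^ m) has_field_derivative of_nat m * u ^ j) (at u)"
      using DERIV_power[OF DERIV_ident, where n = m and x = u and s = UNIV] by (simp add: j)
    ultimately
    have "((\<lambda>u. u ^ m / K (inverse u)) has_field_derivative
        (of_nat m * u ^ j * K (inverse u) - u ^ m * (deriv K (inverse u) * - (inverse u ^ 2))) /
            (K (inverse u) * K (inverse u))) (at u)"
      using Kn by (intro DERIV_divide)
    moreover have "u ^ m * inverse u ^ 2 = u ^ j * (u * inverse u) * inverse u"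
      by (simp only: j power_Suc power2_eq_square mult_ac)
    then have "u ^ m * inverse u ^ 2 = u ^ j * inverse u" using u0 by simp
    then have "u ^ m * (deriv K (inverse u) * - (inverse u ^ 2)) = - (u ^ j * inverse u * deriv K
        (inverse u))"
      by (metis (no_types, opaque_lifting) minus_mult_right mult.assoc mult.commute)
    then have "of_nat m * u ^ j * K (inverse u) - u ^ m * (deriv K (inverse u) * - (inverse u ^ 2)) =
        u ^ j * (of_nat m * K (inverse u) + inverse u * deriv K (inverse u))"
      by (simp add: distrib_left mult_ac)
    ultimately have "((\<lambda>u. u ^ m / K (inverse u)) has_field_derivative E (inverse u) * u ^ j) (at u)"
      unfolding E_def by (simp add: power2_eq_square mult_ac)
    then have "((\<lambda>u. the (g (Some u))) has_field_derivative E (inverse u) * u ^ j) (at u)"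
    proof (rule has_field_derivative_transform_within_open[of _ _ _ "{v. norm v > 1 / s}"])
      show "open {v :: complex. norm v > 1 / s}"
        by (intro open_Collect_less continuous_intros)
      fix v :: complex assume "v \<in> {v. norm v > 1 / s}"
      then have v: "norm v > 1 / s" by simp
      have v0: "v \<noteq> 0" using v K(2) by auto
      have iv: "norm (inverse v) < s"
        using less_imp_inverse_less[OF v] K(2) by (simp add: norm_inverse)
      have Gn: "G (inverse v) \<noteq> 0" using K(5,6)[OF iv] v0 by simp
      have "g (Some v) = chart None (G (inverse v))"
        using G'(4)[of "inverse v"] iv K(3) v0 g(3) by (simp add: divide_inverse)
      then have "the (g (Some v)) = inverse (G (inverse v))"
        using chart_simps(3)[OF Gn] by (simp add: inverse_eq_divide)
      also have "\<dots> = v ^ m / K (inverse v)"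
        unfolding K(5)[OF iv] by (simp add: divide_inverse power_inverse)
      finally show "v ^ m / K (inverse v) = the (g (Some v))" ..
    qed (use u in simp)
    then show ?thesis unfolding affine_deriv_def by (rule DERIV_imp_deriv)
  qed
  have Kc: "K \<midarrow>0\<rightarrow> K 0" using DERIV_isCont[OF dK[of 0]] K(2) by (simp add: isCont_def)
  have "deriv K holomorphic_on ball 0 s" using K(4) by (intro holomorphic_deriv) auto
  then have "isCont (deriv K) 0"
    using holomorphic_on_imp_continuous_on K(2) continuous_on_interior[of "ball 0 s" "deriv K" 0]
        by simp
  then have dKc: "deriv K \<midarrow>0\<rightarrow> deriv K 0" by (simp add: isCont_def)
  have K0: "K 0 \<noteq> 0" using K(6)[of 0] K(2) by simp
  have "E \<midarrow>0\<rightarrow> (of_nat m * K 0 + 0 * deriv K 0) / K 0 ^ 2"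
    unfolding E_def using K0 by (intro tendsto_intros Kc dKc) auto
  then have "E \<midarrow>0\<rightarrow> of_nat m / K 0" using K0 by (simp add: power2_eq_square)
  then have El: "((\<lambda>u. E (inverse u)) \<longlongrightarrow> of_nat m / K 0) at_infinity"
    unfolding lim_at_infinity_0 by (simp add: comp_def)
  have ev: "\<forall>\<^sub>F u in at_infinity. E (inverse u) * u ^ j = affine_deriv g u"
    unfolding eventually_at_infinity by (intro exI[of _ "1 / s + 1"]) (auto intro!: ad[symmetric])
  show ?thesis
  proof (cases "j = 0")
    case True
    have lim: "(affine_deriv g \<longlongrightarrow> 1 / K 0) at_infinity"
      by (rule Lim_transform_eventually[OF _ ev]) (use El True j in simp)
    then have "\<not> filterlim (affine_deriv g) at_infinity at_infinity"
      using not_tendsto_and_filterlim_at_infinity[OF trivial_limit_at_infinity lim] by blast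
    moreover have "Lim at_infinity (affine_deriv g) = 1 / K 0"
      by (rule tendsto_Lim[OF trivial_limit_at_infinity lim])
    ultimately show ?thesis using True dG by simp
  next
    case False
    have "filterlim (\<lambda>u. E (inverse u) * u ^ j) at_infinity at_infinity"
    proof (intro tendsto_mult_filterlim_at_infinity[OF El] filterlim_power_at_infinity filterlim_ident)
      show "of_nat m / K 0 \<noteq> 0" using K0 K(1) by (simp del: of_nat_Suc)
    qed (use False in simp)
    then have "filterlim (affine_deriv g) at_infinity at_infinity"
      by (rule filterlim_mono_eventually[OF _ order_refl order_refl ev])
    then show ?thesis using False dG by simp
  qed
qed

lemma periodicD:
  assumes "periodic_point f z"
  shows "(f ^^ period f z) z = z" "period f z \<ge> 1"
proof -
  obtain k where "k \<ge> 1" "(f ^^ k) z = z" using assms by (auto simp: periodic_point_def)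
  then show "(f ^^ period f z) z = z" "period f z \<ge> 1"
    using least_powerI[of k f z] by (auto simp: Suc_le_eq)
qed

lemma rational_map_iterate:
  assumes "rational_map d f" "d \<ge> 2" "k \<ge> 1"
  shows "rational_map (d ^ k) (f ^^ k)" "d ^ k \<ge> 2"
proof -
  show "rational_map (d ^ k) (f ^^ k)" using rational_map_funpow[OF assms(1)] .
  show "d ^ k \<ge> 2" using assms(2,3) power_increasing[of 1 k d] by simp
qed

lemma multiplier_local_rep:
  assumes f: "rational_map d f" "d \<ge> 2" and z: "periodic_point f z"
    and G: "local_rep (f ^^ period f z) z r G"
  shows "multiplier f z = deriv G 0"
proof -
  note p = periodicD[OF z]
  note g = rational_map_iterate[OF f p(2)]
  show ?thesis
  proof (cases z)
    case None
    have "d ^ period f None \<ge> 1" using g(2) None by simp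
    from multiplier_infinity_local_rep[OF g(1)[unfolded None] this] show ?thesis
      using p(1) G unfolding multiplier_def Let_def None by simp
  next
    case (Some w)
    then show ?thesis using affine_deriv_local_rep[of "f ^^ period f z" w r G] p(1) G
      unfolding multiplier_def by simp
  qed
qed

lemma chart_cnj:
  assumes "z \<in> real_points"
  shows "chart z (cnj t) = map_option cnj (chart z t)"
  using assms by (cases z) (auto simp: chart_def proj_def complex_eq_iff)

text \<open>Real coefficients make the germ commute with conjugation, so its difference quotients
  along the real sequence \<open>1 / (n + 1)\<close> are real, and so is their limit.\<close>

lemma local_rep_real_deriv:
  assumes g: "rational_map n g" "g z = z" and z: "z \<in> real_points" and G: "local_rep g z r G"
  shows "deriv G 0 \<in> \<real>" "\<And>t. norm t < r \<Longrightarrow> G (cnj t) = cnj (G t)"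
proof -
  note G' = local_repD[OF G]
  show c: "G (cnj t) = cnj (G t)" if "norm t < r" for t
  proof -
    have "chart z (G (cnj t)) = g (chart z (cnj t))" using G'(4)[of "cnj t"] that g(2) by simp
    also have "\<dots> = map_option cnj (g (chart z t))"
      by (simp add: chart_cnj[OF z] rational_map_cnj[OF g(1)])
    also have "\<dots> = chart z (cnj (G t))" using G'(4)[of t] that g(2) by (simp add: chart_cnj[OF z])
    finally show ?thesis by (simp add: chart_inj)
  qed
  define x where "x = (\<lambda>n. complex_of_real (inverse (real (Suc n))))"
  have "x \<longlonglongrightarrow> complex_of_real 0"
    unfolding x_def by (rule tendsto_of_real[OF LIMSEQ_inverse_real_of_nat])
  then have x0: "x \<longlonglongrightarrow> 0" by simp
  have "filterlim x (at 0) sequentially"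
  proof -
    have "x n \<noteq> 0" for n unfolding x_def of_real_eq_0_iff by simp
    then show ?thesis unfolding filterlim_at using x0 by simp
  qed
  from filterlim_compose[OF quotient_tendsto_deriv[OF G'(1-3)] this]
  have lim: "(\<lambda>n. G (x n) / x n) \<longlonglongrightarrow> deriv G 0" .
  have "\<forall>\<^sub>F n in sequentially. norm (x n) < r"
    using x0 G'(1) by (simp add: tendsto_iff)
  then have "\<forall>\<^sub>F n in sequentially. G (x n) / x n \<in> \<real>"
  proof eventually_elim
    case (elim n)
    have "cnj (x n) = x n" by (simp add: x_def)
    then have "cnj (G (x n) / x n) = G (x n) / x n" using c[OF elim] by simp
    then show ?case by (simp only: Reals_cnj_iff)
  qed
  then show "deriv G 0 \<in> \<real>"
    by (rule Lim_in_closed_set[OF closed_complex_Reals _ trivial_limit_sequentially lim])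
qed

section \<open>From multipliers to stability, instability and capture\<close>

lemma local_rep_funpow:
  assumes G: "local_rep g z r G" and gz: "g z = z"
    and "\<And>i. i < n \<Longrightarrow> norm ((G ^^ i) t) < r"
  shows "(g ^^ n) (chart z t) = chart z ((G ^^ n) t)"
  using assms(3)
proof (induction n)
  case (Suc n)
  have "(g ^^ n) (chart z t) = chart z ((G ^^ n) t)" using Suc by simp
  then show ?case using local_repD(4)[OF G, of "(G ^^ n) t"] gz Suc(2)[of n] by simp
qed simp

lemma local_attracting_funpow:
  fixes t :: complex and G :: "complex \<Rightarrow> complex"
  assumes "norm t < s" "0 \<le> \<rho>" "\<rho> < 1" "\<And>t. norm t < s \<Longrightarrow> norm (G t) \<le> \<rho> * norm (t :: complex)"
  shows "norm ((G ^^ n) t) \<le> \<rho> ^ n * norm t" "norm ((G ^^ n) t) \<le> norm t"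
proof -
  have le: "\<rho> ^ n * norm t \<le> norm t" for n
    using power_le_one[of \<rho> n] assms by (simp add: mult_left_le_one_le)
  show *: "norm ((G ^^ n) t) \<le> \<rho> ^ n * norm t" for n
  proof (induction n)
    case (Suc n)
    have "norm ((G ^^ Suc n) t) \<le> \<rho> * norm ((G ^^ n) t)"
      using assms(4)[of "(G ^^ n) t"] Suc le[of n] assms(1) by simp
    also have "\<dots> \<le> \<rho> * (\<rho> ^ n * norm t)" using Suc assms(2) by (rule mult_left_mono)
    finally show ?case by simp
  qed simp
  show "norm ((G ^^ n) t) \<le> norm t" using *[of n] le[of n] by linarith
qed

lemma attracting_imp_stable:
  assumes G: "local_rep g z r G" and gz: "g z = z" and "norm (deriv G 0) < 1"
  shows "stable g z"
  unfolding stable_def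
proof (intro allI impI)
  fix e :: real assume e: "e > 0"
  note G' = local_repD[OF G]
  obtain s \<rho> where s: "s > 0" "s \<le> r" "0 \<le> \<rho>" "\<rho> < 1" "\<And>t. norm t < s \<Longrightarrow> norm (G t) \<le> \<rho> * norm t"
    using local_attracting[OF G'(1-3) assms(3)] by metis
  have "(g ^^ n) x \<in> disc z e" if x: "x \<in> disc z (min s e)" for x n
  proof -
    obtain t where t: "x = chart z t" "norm t < s" "norm t < e" using x by (auto simp: disc_def)
    note le = local_attracting_funpow(2)[OF t(2) s(3-5)]
    have "norm ((G ^^ i) t) < r" for i using le[of i] t(2) s(2) by linarith
    then have "(g ^^ n) x = chart z ((G ^^ n) t)" unfolding t(1) by (intro local_rep_funpow[OF G
        gz]) auto
    then show ?thesis using le[of n] t(3) by simp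
  qed
  then show "\<exists>s>0. \<forall>x\<in>disc z s. \<forall>n. (g ^^ n) x \<in> disc z e"
    using s(1) e by (intro exI[of _ "min s e"]) auto
qed

text \<open>The square \<open>g o g\<close> has degree at least 2, hence finitely many fixed points,
  and cannot be the identity on a disc.\<close>

lemma local_rep_nid:
  assumes g: "rational_map n g" "n \<ge> 2" "g z = z" and G: "local_rep g z r G" and s: "s > 0"
  shows "\<exists>t\<in>ball 0 s. G (G t) \<noteq> t"
proof -
  note G' = local_repD[OF G]
  obtain s' where s': "s' > 0" "s' \<le> r" "\<And>t. norm t < s' \<Longrightarrow> norm (G t) < r"
    using local_rep_small[OF G G'(1)] by blast
  have "rational_map (n * n) (g \<circ> g)" "n * n \<ge> 2"
    using rational_map_comp[OF g(1) g(1)] g(2) mult_le_mono[of 2 n 1 n] by auto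
  from local_rep_not_fixed[OF this, of "min s s'" z] obtain t where
    t: "norm t < s" "norm t < s'" "g (g (chart z t)) \<noteq> chart z t" using s s'(1) by auto
  have "g (g (chart z t)) = chart z (G (G t))"
    using G'(4)[of t] G'(4)[of "G t"] s'(2) s'(3)[OF t(2)] t(2) g(3) by simp
  then have "G (G t) \<noteq> t" using t(3) by auto
  then show ?thesis using t(1) by (intro bexI[of _ t]) auto
qed

lemma real_norm_ge_1_cases:
  assumes "x \<in> \<real>" "norm (x :: complex) \<ge> 1"
  shows "x = 1 \<or> x = -1 \<or> norm x > 1"
proof -
  obtain r where r: "x = of_real r" using assms(1) by (rule Reals_cases)
  then have "r = 1 \<or> r = -1 \<or> \<bar>r\<bar> > 1" using assms(2) by auto
  then show ?thesis using r by auto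
qed

text \<open>Reality of the multiplier leaves only 1, -1 and modulus above 1, the cases handled for
  germs.\<close>

lemma not_attracting_imp_unstable:
  assumes g: "rational_map n g" "n \<ge> 2" "g z = z" and z: "z \<in> real_points"
    and G: "local_rep g z r G" and "norm (deriv G 0) \<ge> 1"
  shows "\<not> stable g z"
proof
  assume st: "stable g z"
  note G' = local_repD[OF G]
  have \<lambda>: "deriv G 0 = 1 \<or> deriv G 0 = -1 \<or> norm (deriv G 0) > 1"
    by (rule real_norm_ge_1_cases[OF local_rep_real_deriv(1)[OF g(1,3) z G] assms(6)])
  obtain e where e: "e > 0" "e \<le> r" "\<And>s. s > 0 \<Longrightarrow> \<exists>t n. norm t < s \<and> norm ((G ^^ n) t) \<ge> e"
    using indifferent_or_repelling_unstable[OF G'(1-3) \<lambda> local_rep_nid[OF g G]] by metis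
  obtain s where s: "s > 0" "\<And>x n. x \<in> disc z s \<Longrightarrow> (g ^^ n) x \<in> disc z e"
    using st e(1) unfolding stable_def by meson
  obtain t n where t: "norm t < s" "norm ((G ^^ n) t) \<ge> e" using e(3)[OF s(1)] by blast
  \<comment> \<open>Strong induction: the chart formula for the \<open>n\<close>-th iterate requires
    all earlier points to lie in the domain of \<open>G\<close>.\<close>
  have "norm ((G ^^ n) t) < e" for n
  proof (induction n rule: less_induct)
    case (less n)
    have "(g ^^ n) (chart z t) = chart z ((G ^^ n) t)"
      by (rule local_rep_funpow[OF G g(3)]) (use less e(2) in fastforce)
    moreover have "(g ^^ n) (chart z t) \<in> disc z e" using s(2) t(1) by simp
    ultimately show ?case by simp
  qed
  then show False using t(2) by (meson not_less)
qed

lemma repelling_landing: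
  assumes G: "local_rep g z r G" "g z = z" "norm (deriv G 0) > 1"
    and conv: "sconv (\<lambda>n. (g ^^ n) x) z"
  shows "\<exists>n. (g ^^ n) x = z"
proof -
  note G' = local_repD[OF G(1)]
  have "\<forall>\<^sub>F n in sequentially. (g ^^ n) x \<in> disc z r" using conv G'(1) by (simp add: sconv_def)
  then obtain N where N: "\<And>n. n \<ge> N \<Longrightarrow> (g ^^ n) x \<in> disc z r" by (auto simp: eventually_sequentially)
  have "\<exists>t. (g ^^ (N + n)) x = chart z t \<and> norm t < r" for n
    using N[of "N + n"] by (auto simp: disc_def)
  then obtain t where t: "\<And>n. (g ^^ (N + n)) x = chart z (t n)" "\<And>n. norm (t n) < r" by metis
  have "sconv (\<lambda>n. (g ^^ (N + n)) x) z"
    using sconv_subseq[OF conv, of "\<lambda>n. N + n"] by (simp add: strict_mono_def)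
  then have "t \<longlonglongrightarrow> 0" by (simp add: t(1) sconv_chart_iff)
  moreover have "t (Suc n) = G (t n)" if "norm (t n) < r" for n
  proof -
    have "chart z (t (Suc n)) = (g ^^ (N + Suc n)) x" by (simp only: t(1))
    also have "\<dots> = g ((g ^^ (N + n)) x)" by simp
    also have "\<dots> = chart z (G (t n))" using G'(4)[OF t(2)[of n]] G(2) by (simp only: t(1))
    finally show ?thesis by (simp add: chart_inj)
  qed
  ultimately obtain n where "t n = 0" using local_repelling_landing[OF G'(1-3) G(3)] by blast
  then show ?thesis using t(1)[of n] by (intro exI[of _ "N + n"]) simp
qed

text \<open>A punctured disc in the attracting case, petals in the indifferent case. Even iterates
  appear because petals are constructed for the second iterate; leaving out the centre allows the
  chart at infinity to be inverted.\<close>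

lemma nonrepelling_captures:
  assumes g: "rational_map n g" "n \<ge> 2" "g z = z" and z: "z \<in> real_points"
    and G: "local_rep g z r G" and "norm (deriv G 0) \<le> 1"
  shows "\<exists>P. open P \<and> P \<noteq> {} \<and> (\<forall>u\<in>P. sconv (\<lambda>n. (g ^^ (2 * n)) (Some u)) z)"
proof -
  note G' = local_repD[OF G]
  have "\<exists>T. open T \<and> T \<noteq> {} \<and> 0 \<notin> T \<and> (\<forall>t\<in>T. sconv (\<lambda>n. (g ^^ (2 * n)) (chart z t)) z)"
  proof (cases "norm (deriv G 0) < 1")
    case True
    obtain s \<rho> where s: "s > 0" "s \<le> r" "0 \<le> \<rho>" "\<rho> < 1" "\<And>t. norm t < s \<Longrightarrow> norm (G t) \<le> \<rho> * norm t"
      using local_attracting[OF G'(1-3) True] by metis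
    have "sconv (\<lambda>n. (g ^^ (2 * n)) (chart z t)) z" if t: "norm t < s" for t
    proof -
      have "norm ((G ^^ i) t) < r" for i
        using local_attracting_funpow(2)[OF t s(3-5), of i] t s(2) by linarith
      then have eq: "(g ^^ n) (chart z t) = chart z ((G ^^ n) t)" for n
        by (intro local_rep_funpow[OF G g(3)]) auto
      have "(\<lambda>n. \<rho> ^ n * norm t) \<longlonglongrightarrow> 0"
        using s by (intro tendsto_mult_left_zero LIMSEQ_realpow_zero) auto
      then have "(\<lambda>n. (G ^^ n) t) \<longlonglongrightarrow> 0"
        by (rule Lim_null_comparison[rotated]) (use local_attracting_funpow(1)[OF t s(3-5)] in simp)
      then have "sconv (\<lambda>n. (g ^^ n) (chart z t)) z" by (simp add: eq sconv_chart_iff)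
      then show ?thesis by (rule sconv_subseq) (simp add: strict_mono_def)
    qed
    moreover have "of_real (s / 2) \<in> ball (0 :: complex) s - {0}" using s(1) by auto
    then have "ball (0 :: complex) s - {0} \<noteq> {}" by blast
    ultimately show ?thesis by (intro exI[of _ "ball 0 s - {0}"]) (simp add: open_delete)
  next
    case False
    then have "deriv G 0 = 1 \<or> deriv G 0 = -1"
      using real_norm_ge_1_cases[OF local_rep_real_deriv(1)[OF g(1,3) z G]] assms(6) by linarith
    from parabolic_petal[OF G'(1-3) this local_rep_nid[OF g G]]
    obtain P where P: "open P" "P \<noteq> {}" "\<And>t. t \<in> P \<Longrightarrow> norm t < r \<and> norm (G t) < r \<and> G (G t) \<in> P"
      "\<And>t. t \<in> P \<Longrightarrow> t \<noteq> 0 \<and> (\<lambda>n. (G ^^ (2 * n)) t) \<longlonglongrightarrow> 0" by metis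
    have "(g ^^ (2 * n)) (chart z t) = chart z ((G ^^ (2 * n)) t) \<and> (G ^^ (2 * n)) t \<in> P" if "t \<in>
        P" for t n
    proof (induction n)
      case (Suc n)
      define x where "x = (G ^^ (2 * n)) t"
      have "x \<in> P" using Suc by (simp add: x_def)
      note x = P(3)[OF this]
      have "g (g (chart z x)) = chart z (G (G x))"
        using x G'(4)[of x] G'(4)[of "G x"] g(3) by simp
      then show ?case using Suc x by (simp add: x_def)
    qed (use that in simp)
    then have "sconv (\<lambda>n. (g ^^ (2 * n)) (chart z t)) z" if "t \<in> P" for t
      using P(4)[OF that] that by (simp add: sconv_chart_iff)
    then show ?thesis using P(1,2,4) by (intro exI[of _ P]) auto
  qed
  then obtain T where T: "open T" "T \<noteq> {}" "0 \<notin> T"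
    "\<And>t. t \<in> T \<Longrightarrow> sconv (\<lambda>n. (g ^^ (2 * n)) (chart z t)) z" by blast
  show ?thesis
  proof (cases z)
    case (Some w)
    then show ?thesis using T by (intro exI[of _ "(+) w ` T"]) (auto intro: open_translation)
  next
    case None
    \<comment> \<open>The captured set in the chart at infinity, rewritten in the affine
      coordinate.\<close>
    define P where "P = inverse -` T \<inter> - {0}"
    have "open P" unfolding P_def
      using continuous_on_open_vimage[of "- {0::complex}" inverse] T(1)
      by (auto simp: open_Compl intro!: continuous_intros)
    moreover have "sconv (\<lambda>n. (g ^^ (2 * n)) (Some u)) z" if "u \<in> P" for u
      using T(4)[of "inverse u"] that None by (simp add: P_def divide_inverse)
    moreover obtain t where "t \<in> T" using T(2) by blast
    then have "inverse t \<in> P" using T(3) by (auto simp: P_def)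
    ultimately show ?thesis by blast
  qed
qed

section \<open>Families omitting two values\<close>

text \<open>Schottky's theorem after affine normalisation of the ball and of the omitted values to 0
  and 1. The bound \<open>B\<close> depends on neither the radius nor the centre.\<close>

lemma schottky_ball:
  fixes a b :: complex
  assumes "a \<noteq> b"
  obtains B where "B > 0"
    "\<And>h z0 \<rho> z. \<lbrakk>\<rho> > 0; h holomorphic_on ball z0 \<rho>; \<And>z. z \<in> ball z0 \<rho> \<Longrightarrow> h z \<noteq> a \<and> h z \<noteq> b;
       norm (h z0) \<le> M; norm (z - z0) \<le> \<rho> / 2\<rbrakk> \<Longrightarrow> norm (h z) \<le> B"
proof -
  define r where "r = (\<bar>M\<bar> + norm a) / norm (b - a)"
  define C where "C = exp (pi * exp (pi * (2 + 2 * r + 12 * (2/3) / (1 - 2/3))))"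
  have ba: "norm (b - a) > 0" using assms by simp
  have "norm (h z) \<le> norm a + norm (b - a) * C"
    if \<rho>: "\<rho> > 0" and h: "h holomorphic_on ball z0 \<rho>"
      and ab: "\<And>z. z \<in> ball z0 \<rho> \<Longrightarrow> h z \<noteq> a \<and> h z \<noteq> b"
      and M: "norm (h z0) \<le> M" and z: "norm (z - z0) \<le> \<rho> / 2" for h z0 \<rho> z
  proof -
    \<comment> \<open>The factor 3/4 keeps the image of the closed unit disc inside the open ball,
      and turns the distance \<open>\<rho> / 2\<close> into \<open>2 / 3\<close>, the parameter in
      \<open>C\<close>.\<close>
    define c where "c = complex_of_real (3 / 4 * \<rho>)"
    have nc: "norm c = 3 / 4 * \<rho>" using \<rho> by (simp only: c_def norm_of_real)
    define k where "k = (\<lambda>s. (h (z0 + c * s) - a) / (b - a))"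
    have sub: "(\<lambda>s. z0 + c * s) ` cball 0 1 \<subseteq> ball z0 \<rho>"
    proof (rule image_subsetI)
      fix s :: complex assume "s \<in> cball 0 1"
      then have "norm c * norm s \<le> 3 / 4 * \<rho> * 1" unfolding nc using \<rho> by (intro mult_left_mono) auto
      then show "z0 + c * s \<in> ball z0 \<rho>" using \<rho> by (simp add: dist_norm norm_mult)
    qed
    have "(h \<circ> (\<lambda>s. z0 + c * s)) holomorphic_on cball 0 1"
      by (rule holomorphic_on_compose_gen[OF _ h sub]) (intro holomorphic_intros)
    then have kh: "k holomorphic_on cball 0 1"
      unfolding k_def comp_def using assms by (intro holomorphic_intros) auto
    have k0: "norm (k 0) \<le> r"
    proof -
      have "norm (h z0 - a) \<le> \<bar>M\<bar> + norm a" using M norm_triangle_ineq4[of "h z0" a] by linarith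
      then show ?thesis using ba by (simp add: k_def r_def norm_divide divide_right_mono)
    qed
    have k01: "\<not> (k s = 0 \<or> k s = 1)" if "s \<in> cball 0 1" for s
    proof -
      have "z0 + c * s \<in> ball z0 \<rho>" using sub that by blast
      from ab[OF this] show ?thesis using assms by (auto simp: k_def)
    qed
    define s where "s = (z - z0) / c"
    have c0: "c \<noteq> 0" using nc \<rho> by auto
    have "norm s \<le> 2 / 3" using z \<rho> by (simp add: s_def norm_divide nc field_simps)
    then have "norm (k s) \<le> C" unfolding C_def by (intro Schottky[OF kh k0 k01]) auto
    then have le: "norm (b - a) * norm (k s) \<le> norm (b - a) * C" by (intro mult_left_mono) auto
    have "h z = a + (b - a) * k s" using c0 assms by (simp add: k_def s_def)
    then have "norm (h z) \<le> norm a + norm (b - a) * norm (k s)"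
      using norm_triangle_ineq[of a "(b - a) * k s"] by (simp add: norm_mult)
    then show ?thesis using le by linarith
  qed
  moreover have "norm a + norm (b - a) * C > 0"
    using ba by (intro add_nonneg_pos mult_pos_pos) (auto simp: C_def)
  ultimately show thesis using that by blast
qed

text \<open>Schottky bounds \<open>h\<close> on the half ball, and the Schwarz lemma turns this
  bound into a Lipschitz estimate at the centre, uniform over the family.\<close>

lemma schottky_lipschitz:
  fixes a b :: complex
  assumes "a \<noteq> b"
  obtains L where "L > 0"
    "\<And>h z0 \<rho> z. \<lbrakk>\<rho> > 0; h holomorphic_on ball z0 \<rho>; \<And>z. z \<in> ball z0 \<rho> \<Longrightarrow> h z \<noteq> a \<and> h z \<noteq> b;
       norm (h z0) \<le> M; norm (z - z0) < \<rho> / 2\<rbrakk> \<Longrightarrow> norm (h z - h z0) \<le> L * norm (z - z0) / \<rho>"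
proof -
  obtain B where B: "B > 0"
    "\<And>h z0 \<rho> z. \<lbrakk>\<rho> > 0; h holomorphic_on ball z0 \<rho>; \<And>z. z \<in> ball z0 \<rho> \<Longrightarrow> h z \<noteq> a \<and> h z \<noteq> b;
       norm (h z0) \<le> M; norm (z - z0) \<le> \<rho> / 2\<rbrakk> \<Longrightarrow> norm (h z) \<le> B"
    using schottky_ball[OF assms, of M] by metis
  have "norm (h z - h z0) \<le> 2 * (2 * B + 1) * norm (z - z0) / \<rho>"
    if \<rho>: "\<rho> > 0" and h: "h holomorphic_on ball z0 \<rho>"
      and ab: "\<And>z. z \<in> ball z0 \<rho> \<Longrightarrow> h z \<noteq> a \<and> h z \<noteq> b"
      and M: "norm (h z0) \<le> M" and z: "norm (z - z0) < \<rho> / 2" for h z0 \<rho> z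
  proof -
    define c where "c = complex_of_real (\<rho> / 2)"
    have nc: "norm c = \<rho> / 2" using \<rho> by (simp only: c_def norm_of_real)
    have c0: "c \<noteq> 0" using nc \<rho> by auto
    \<comment> \<open>Differences of two values of modulus at most \<open>B\<close> are strictly
      smaller than \<open>2 * B + 1\<close>, as the Schwarz lemma demands.\<close>
    define A where "A = complex_of_real (2 * B + 1)"
    have nA: "norm A = 2 * B + 1" using B(1) by (simp only: A_def norm_of_real)
    have A0: "A \<noteq> 0" using nA B(1) by auto
    define k where "k = (\<lambda>s. (h (z0 + c * s) - h z0) / A)"
    have in_ball: "norm (c * s) \<le> \<rho> / 2" if "norm s < 1" for s
      using that \<rho> by (simp add: norm_mult nc)
    have sub: "(\<lambda>s. z0 + c * s) ` ball 0 1 \<subseteq> ball z0 \<rho>"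
    proof (rule image_subsetI)
      fix s :: complex assume "s \<in> ball 0 1"
      then show "z0 + c * s \<in> ball z0 \<rho>" using in_ball[of s] \<rho> by (simp add: dist_norm)
    qed
    have "(h \<circ> (\<lambda>s. z0 + c * s)) holomorphic_on ball 0 1"
      by (rule holomorphic_on_compose_gen[OF _ h sub]) (intro holomorphic_intros)
    then have kh: "k holomorphic_on ball 0 1"
      unfolding k_def comp_def using A0 by (intro holomorphic_intros) auto
    have k1: "norm (k s) < 1" if "norm s < 1" for s
    proof -
      have "norm (h (z0 + c * s)) \<le> B" "norm (h z0) \<le> B"
        using in_ball[OF that] \<rho> by (auto intro!: B(2)[OF \<rho> h ab M])
      then have "norm (h (z0 + c * s) - h z0) < norm A"
        unfolding nA using norm_triangle_ineq4[of "h (z0 + c * s)" "h z0"] by linarith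
      then show ?thesis using A0 by (simp add: k_def norm_divide)
    qed
    define s where "s = (z - z0) / c"
    have s: "norm s = 2 * norm (z - z0) / \<rho>" using \<rho> by (simp add: s_def norm_divide nc)
    have "norm s < 1" unfolding s using z \<rho> by simp
    from Schwarz_Lemma(1)[OF kh _ k1 this] have "norm (k s) \<le> norm s" by (simp add: k_def)
    then have "norm (h z - h z0) \<le> norm s * norm A"
      using c0 A0 by (simp add: k_def s_def norm_divide divide_le_eq)
    then show ?thesis unfolding s nA by (simp add: algebra_simps)
  qed
  moreover have "2 * (2 * B + 1) > 0" using B(1) by simp
  ultimately show thesis using that by blast
qed

text \<open>A bound at one point spreads: the points near which the family is uniformly bounded form
  a set that is open and relatively closed in \<open>S\<close>.\<close>

lemma omitting_bounded_on_compact: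
  fixes a b w :: complex
  assumes S: "open S" "connected S" "w \<in> S" and ab: "a \<noteq> b" and K: "compact K" "K \<subseteq> S"
  obtains B where "\<And>h z. \<lbrakk>h holomorphic_on S; \<And>z. z \<in> S \<Longrightarrow> h z \<noteq> a \<and> h z \<noteq> b; norm (h w) \<le> M; z \<in> K\<rbrakk>
     \<Longrightarrow> norm (h z) \<le> B"
proof -
  define Y where "Y = {h. h holomorphic_on S \<and> (\<forall>z\<in>S. h z \<noteq> a \<and> h z \<noteq> b) \<and> norm (h w) \<le> M}"
  define U where "U = {z\<in>S. \<exists>r>0. \<exists>B. ball z r \<subseteq> S \<and> (\<forall>h\<in>Y. \<forall>z'\<in>ball z r. norm (h z') \<le> B)}"
  \<comment> \<open>With \<open>y\<close> within \<open>e / 8\<close> of \<open>x\<close>, the ball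
    of radius \<open>e / 2\<close> about \<open>y\<close> stays in \<open>S\<close>, and its
    concentric half covers the ball of radius \<open>e / 8\<close> about \<open>x\<close>.\<close>
  have near: "\<exists>r>0. \<exists>B. ball x r \<subseteq> S \<and> (\<forall>h\<in>Y. \<forall>z'\<in>ball x r. norm (h z') \<le> B)"
    if e: "e > 0" "ball x e \<subseteq> S" and y: "norm (y - x) < e / 8" and M': "\<And>h. h \<in> Y \<Longrightarrow> norm (h y) \<le>
        M'" for x y e M'
  proof -
    obtain B where B: "B > 0"
      "\<And>h z0 \<rho> z. \<lbrakk>\<rho> > 0; h holomorphic_on ball z0 \<rho>; \<And>z. z \<in> ball z0 \<rho> \<Longrightarrow> h z \<noteq> a \<and> h z \<noteq> b;
         norm (h z0) \<le> M'; norm (z - z0) \<le> \<rho> / 2\<rbrakk> \<Longrightarrow> norm (h z) \<le> B"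
      using schottky_ball[OF ab, of M'] by metis
    have "norm (h z) \<le> B" if h: "h \<in> Y" and z: "z \<in> ball x (e / 8)" for h z
    proof (rule B(2)[of "e / 2" h y])
      have sub: "ball y (e / 2) \<subseteq> S"
      proof
        fix v assume "v \<in> ball y (e / 2)"
        then have "dist x v < e" using y e(1) dist_triangle[of x v y] by (simp add: dist_norm
            norm_minus_commute)
        then show "v \<in> S" using e(2) by auto
      qed
      show "h holomorphic_on ball y (e / 2)" using h sub by (auto simp: Y_def intro:
          holomorphic_on_subset)
      show "h z \<noteq> a \<and> h z \<noteq> b" if "z \<in> ball y (e / 2)" for z using h sub that by (auto simp: Y_def)
      have "dist z y \<le> dist z x + dist y x" by (rule dist_triangle2)
      then show "norm (z - y) \<le> e / 2 / 2" using y z e(1) by (simp add: dist_norm norm_minus_commute)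
    qed (use e M' h in auto)
    moreover have "ball x (e / 8) \<subseteq> ball x e" using e(1) by (intro subset_ball) simp
    then have "ball x (e / 8) \<subseteq> S" using e(2) by blast
    ultimately have "ball x (e / 8) \<subseteq> S \<and> (\<forall>h\<in>Y. \<forall>z'\<in>ball x (e / 8). norm (h z') \<le> B)"
      by blast
    moreover have "e / 8 > 0" using e(1) by simp
    ultimately show ?thesis by blast
  qed
  have "U = S"
  proof (rule GPicard2)
    show "U \<subseteq> S" by (auto simp: U_def)
    show "connected S" by (rule S)
    obtain e where "e > 0" "ball w e \<subseteq> S" using S by (meson openE)
    then have "w \<in> U" unfolding U_def using near[of e w w M] S(3) by (auto simp: Y_def)
    then show "U \<noteq> {}" by blast
    show "open U" unfolding open_contains_ball
    proof
      fix x assume "x \<in> U"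
      then obtain r B where r: "r > 0" "ball x r \<subseteq> S" "\<And>h z. h \<in> Y \<Longrightarrow> z \<in> ball x r \<Longrightarrow> norm (h z) \<le> B"
        unfolding U_def by blast
      have "ball x r \<subseteq> U"
      proof
        fix y assume y: "y \<in> ball x r"
        obtain r' where "r' > 0" "ball y r' \<subseteq> ball x r" using y openE[OF open_ball] by blast
        then show "y \<in> U" unfolding U_def using r y by blast
      qed
      then show "\<exists>e>0. ball x e \<subseteq> U" using r(1) by blast
    qed
    fix x assume x: "x islimpt U" "x \<in> S"
    obtain e where e: "e > 0" "ball x e \<subseteq> S" using x(2) S by (meson openE)
    obtain y where y: "y \<in> U" "dist y x < e / 8" using x(1) e(1) by (meson islimpt_approachable
        zero_less_divide_iff zero_less_numeral)
    obtain r B where "r > 0" "\<And>h z. h \<in> Y \<Longrightarrow> z \<in> ball y r \<Longrightarrow> norm (h z) \<le> B" using y(1) unfolding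
        U_def by blast
    then have "norm (h y) \<le> B" if "h \<in> Y" for h using that by simp
    then show "x \<in> U" unfolding U_def using near[OF e, of y B] y(2) x(2) by (simp add: dist_norm)
  qed
  then have "\<forall>z\<in>K. \<exists>r>0. \<exists>B. \<forall>h\<in>Y. \<forall>z'\<in>ball z r. norm (h z') \<le> B" using K(2) unfolding U_def by blast
  then obtain r B where rB: "\<And>z. z \<in> K \<Longrightarrow> r z > 0" "\<And>z h z'. z \<in> K \<Longrightarrow> h \<in> Y \<Longrightarrow> z' \<in> ball z (r z) \<Longrightarrow>
      norm (h z') \<le> B z"
    by metis
  have "K \<subseteq> (\<Union>z\<in>K. ball z (r z))" using rB(1) by force
  then obtain D where D: "D \<subseteq> K" "finite D" "K \<subseteq> (\<Union>z\<in>D. ball z (r z))"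
    using compactE_image[OF K(1), of K "\<lambda>z. ball z (r z)"] by blast
  have "norm (h z) \<le> Max (insert 0 (B ` D))" if h: "h \<in> Y" and z: "z \<in> K" for h z
  proof -
    obtain v where v: "v \<in> D" "z \<in> ball v (r v)" using D(3) z by blast
    then have "norm (h z) \<le> B v" using rB(2) D(1) h by blast
    also have "\<dots> \<le> Max (insert 0 (B ` D))" using v(1) D(2) by (intro Max_ge) auto
    finally show ?thesis .
  qed
  then show thesis using that unfolding Y_def by blast
qed

section \<open>Finite unions of intervals\<close>

text \<open>Finite unions of intervals, single points included. This class is preserved by
  continuous images directly, while for real sets it also implies semialgebraicity.\<close>

definition tame :: "real set \<Rightarrow> bool" where
  "tame X \<longleftrightarrow> (\<exists>\<C>. finite \<C> \<and> (\<forall>C\<in>\<C>. connected C) \<and> X = \<Union>\<C>)"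

lemma tameI: "finite \<C> \<Longrightarrow> (\<And>C. C \<in> \<C> \<Longrightarrow> connected C) \<Longrightarrow> X = \<Union>\<C> \<Longrightarrow> tame X"
  unfolding tame_def by blast

lemma tameE:
  assumes "tame X"
  obtains \<C> where "finite \<C>" "\<And>C. C \<in> \<C> \<Longrightarrow> connected C" "X = \<Union>\<C>"
  using assms unfolding tame_def by blast

lemma connected_tame: "connected X \<Longrightarrow> tame X"
  by (rule tameI[of "{X}"]) auto

lemma tame_Un: "tame X \<Longrightarrow> tame Y \<Longrightarrow> tame (X \<union> Y)"
proof (elim tameE)
  fix \<C> \<D> assume "finite \<C>" "\<And>C. C \<in> \<C> \<Longrightarrow> connected C" "X = \<Union>\<C>"
    "finite \<D>" "\<And>C. C \<in> \<D> \<Longrightarrow> connected C" "Y = \<Union>\<D>"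
  then show "tame (X \<union> Y)" by (intro tameI[of "\<C> \<union> \<D>"]) auto
qed

lemma tame_empty: "tame {}"
  by (rule connected_tame) simp

lemma tame_UN: "finite I \<Longrightarrow> (\<And>i. i \<in> I \<Longrightarrow> tame (X i)) \<Longrightarrow> tame (\<Union>i\<in>I. X i)"
  by (induction I rule: finite_induct) (auto intro: tame_Un simp: tame_empty)

lemma connected_Int_real:
  fixes A B :: "real set"
  assumes "connected A" "connected B"
  shows "connected (A \<inter> B)"
  using assms unfolding is_interval_connected_1[symmetric] by (rule is_interval_Int)

lemma tame_Compl_finite:
  assumes "finite E"
  shows "tame (- E)"
  using assms
proof (induction E rule: finite_induct)
  case empty
  then show ?case by (intro connected_tame) simp
next
  case (insert e E)
  then obtain \<C> where C: "finite \<C>" "\<And>C. C \<in> \<C> \<Longrightarrow> connected C" "- E = \<Union>\<C>" unfolding tame_def by blast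
  have "- insert e E = (\<Union>C\<in>\<C>. (C \<inter> {..<e}) \<union> (C \<inter> {e<..}))"
  proof -
    have "- insert e E = (- E) \<inter> ({..<e} \<union> {e<..})" by auto
    then show ?thesis unfolding C(3) by auto
  qed
  moreover have "tame (\<Union>C\<in>\<C>. (C \<inter> {..<e}) \<union> (C \<inter> {e<..}))"
    using C(1,2) by (intro tame_UN tame_Un connected_tame connected_Int_real) auto
  ultimately show ?case by simp
qed

text \<open>Removing a finite set that contains the boundary leaves finitely many intervals, each of
  which lies inside \<open>X\<close> or outside it by connectedness.\<close>

lemma tame_finite_boundary:
  assumes E: "finite E" and X: "\<And>x. x \<notin> E \<Longrightarrow> \<exists>e>0. ball x e \<subseteq> X \<or> ball x e \<inter> X = {}"
  shows "tame X"
proof -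
  obtain \<C> where C: "finite \<C>" "\<And>C. C \<in> \<C> \<Longrightarrow> connected C" "- E = \<Union>\<C>"
    using tame_Compl_finite[OF E] unfolding tame_def by blast
  have dich: "C \<subseteq> X \<or> C \<inter> X = {}" if "C \<in> \<C>" for C
  proof -
    have sub: "C \<subseteq> interior X \<union> interior (- X)"
    proof
      fix x assume "x \<in> C"
      then have "x \<notin> E" using C(3) that by blast
      then obtain e where "e > 0" "ball x e \<subseteq> X \<or> ball x e \<subseteq> - X" using X by blast
      then show "x \<in> interior X \<union> interior (- X)"
        by (metis UnCI centre_in_ball interiorI open_ball)
    qed
    have disj: "interior X \<inter> interior (- X) \<inter> C = {}"
      using interior_subset[of X] interior_subset[of "- X"] by blast
    have "interior X \<inter> C = {} \<or> interior (- X) \<inter> C = {}"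
      using connectedD[OF C(2)[OF that] open_interior open_interior disj sub] .
    then show ?thesis using sub interior_subset[of X] interior_subset[of "- X"] by blast
  qed
  have "X = \<Union>({C \<in> \<C>. C \<subseteq> X} \<union> (\<lambda>x. {x}) ` (E \<inter> X))"
  proof
    show "X \<subseteq> \<Union>({C \<in> \<C>. C \<subseteq> X} \<union> (\<lambda>x. {x}) ` (E \<inter> X))"
    proof
      fix x assume x: "x \<in> X"
      show "x \<in> \<Union>({C \<in> \<C>. C \<subseteq> X} \<union> (\<lambda>x. {x}) ` (E \<inter> X))"
      proof (cases "x \<in> E")
        case False
        then obtain C where "C \<in> \<C>" "x \<in> C" using C(3) by blast
        then show ?thesis using dich[of C] x by blast
      qed (use x in blast)
    qed
  qed auto
  then show ?thesis using C E by (intro tameI[of "{C \<in> \<C>. C \<subseteq> X} \<union> (\<lambda>x. {x}) ` (E \<inter> X)"]) auto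
qed

lemma tame_image:
  assumes "tame X" "continuous_on X h"
  shows "tame (h ` X)"
proof -
  obtain \<C> where C: "finite \<C>" "\<And>C. C \<in> \<C> \<Longrightarrow> connected C" "X = \<Union>\<C>" using assms(1) unfolding
      tame_def by blast
  have "connected (h ` C)" if "C \<in> \<C>" for C
    using that C(2,3) by (intro connected_continuous_image continuous_on_subset[OF assms(2)]) auto
  then show ?thesis using C(1) unfolding C(3) by (intro tameI[of "(\<lambda>C. h ` C) ` \<C>"]) auto
qed

lemma tame_Int_connected:
  assumes "tame X" "connected Y"
  shows "tame (X \<inter> Y)"
proof -
  obtain \<C> where C: "finite \<C>" "\<And>C. C \<in> \<C> \<Longrightarrow> connected C" "X = \<Union>\<C>" using assms(1) unfolding
      tame_def by blast
  show ?thesis unfolding C(3)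
    using C(1,2) assms(2) by (intro tameI[of "(\<lambda>C. C \<inter> Y) ` \<C>"]) (auto intro: connected_Int_real)
qed

lemma tame_moebius:
  assumes "tame X"
  shows "tame {x. x \<noteq> r \<and> 1 / (x - r) \<in> X}"
proof -
  \<comment> \<open>The inverse map \<open>r + 1 / y\<close> is continuous only on each side of
    \<open>0\<close>, so the two sides are mapped separately.\<close>
  have "{x. x \<noteq> r \<and> 1 / (x - r) \<in> X} = (\<lambda>y. r + 1 / y) ` (X \<inter> {0<..}) \<union> (\<lambda>y. r + 1 / y) ` (X \<inter> {..<0})"
    (is "?L = ?R")
  proof
    show "?L \<subseteq> ?R"
    proof
      fix x assume x: "x \<in> ?L"
      have "1 / (x - r) > 0 \<or> 1 / (x - r) < 0" using x by (simp add: less_le) linarith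
      moreover have "x = r + 1 / (1 / (x - r))" using x by simp
      ultimately show "x \<in> ?R" using x by (metis (mono_tags, lifting) Int_iff UnCI greaterThan_iff
          image_eqI lessThan_iff mem_Collect_eq)
    qed
  qed auto
  moreover have "tame ?R"
    by (intro tame_Un tame_image tame_Int_connected assms continuous_intros) auto
  ultimately show ?thesis by simp
qed

section \<open>Intervals as semialgebraic sets\<close>

lemma semialgebraic_gt: "semialgebraic {a<..}"
  using positive[of "[:- a, 1:]"] by (simp add: greaterThan_def)

lemma semialgebraic_lt: "semialgebraic {..<a}"
  using positive[of "[:a, - 1:]"] by (simp add: lessThan_def)

lemma semialgebraic_Int: "semialgebraic A \<Longrightarrow> semialgebraic B \<Longrightarrow> semialgebraic (A \<inter> B)"
  using complement[OF union[OF complement[of A] complement[of B]]] by simp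

lemma semialgebraic_ge: "semialgebraic {a..}"
  using complement[OF semialgebraic_lt[of a]] by (simp add: Compl_lessThan)

lemma semialgebraic_le: "semialgebraic {..a}"
  using complement[OF semialgebraic_gt[of a]] by (simp add: Compl_greaterThan)

lemma semialgebraic_UNIV: "semialgebraic UNIV"
  using positive[of "[:1:]"] by simp

lemma semialgebraic_empty: "semialgebraic {}"
  using complement[OF semialgebraic_UNIV] by simp

lemma connected_semialgebraic:
  assumes "connected X"
  shows "semialgebraic X"
proof -
  have "x \<in> X" if "a \<in> X" "b \<in> X" "a \<le> x" "x \<le> b" for a b x
    using assms that by (meson connected_contains_Icc atLeastAtMost_iff subsetD)
  then have "\<exists>a b. X = {} \<or> X = UNIV \<or> X = {..<b} \<or> X = {..b} \<or> X = {a<..} \<or> X = {a..} \<or>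
      X = {a<..<b} \<or> X = {a<..b} \<or> X = {a..<b} \<or> X = {a..b}"
    by (rule interval_cases)
  then show ?thesis
    unfolding greaterThanLessThan_def greaterThanAtMost_def atLeastLessThan_def atLeastAtMost_def
    by (auto intro: semialgebraic_gt semialgebraic_lt semialgebraic_ge semialgebraic_le
        semialgebraic_UNIV semialgebraic_empty semialgebraic_Int)
qed

lemma tame_semialgebraic:
  assumes "tame X"
  shows "semialgebraic X"
proof -
  obtain \<C> where C: "finite \<C>" "\<And>C. C \<in> \<C> \<Longrightarrow> connected C" "X = \<Union>\<C>" using assms unfolding tame_def
      by blast
  have "semialgebraic (\<Union>\<C>)" using C(1,2)
    by (induction \<C> rule: finite_induct) (auto intro: union connected_semialgebraic semialgebraic_empty)
  then show ?thesis using C(3) by simp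
qed

text \<open>The set seen in the chart at infinity is the inversion of the affine one up to a single
  point, so the affine condition suffices. Complements are used because invariance and openness are
  established for the complement of \<open>S\<close>.\<close>

lemma semialgebraic_P1_tame_complement:
  assumes S: "S \<subseteq> real_points" and T: "tame {x. Some (complex_of_real x) \<notin> S}"
  shows "semialgebraic_P1 S"
  unfolding semialgebraic_P1_def
proof (intro conjI S)
  show "semialgebraic {x. Some (complex_of_real x) \<in> S}"
    using complement[OF tame_semialgebraic[OF T]] by (simp add: Compl_eq)
  \<comment> \<open>The coordinate \<open>t = 0\<close> of the point at infinity, which the
    inversion does not reach.\<close>
  define Z where "Z = (if None \<in> S then {} else {0::real})"
  have eq: "{t. (if t = 0 then None else Some (complex_of_real (1 / t))) \<in> S} =
      - ({t. t \<noteq> 0 \<and> 1 / (t - 0) \<in> {x. Some (complex_of_real x) \<notin> S}} \<union> Z)"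
    by (auto simp: Z_def)
  have "tame Z" by (rule connected_tame) (simp add: Z_def)
  then show "semialgebraic {t. (if t = 0 then None else Some (complex_of_real (1 / t))) \<in> S}"
    unfolding eq by (intro complement tame_semialgebraic tame_Un tame_moebius T)
qed

text \<open>For each \<open>C\<close> all but finitely many intervals \<open>B C n\<close> meet one
  of the finitely many intervals in \<open>\<N>\<close> and merge with it; only finitely many pieces
  remain apart.\<close>

lemma tame_eventually_meeting:
  fixes B :: "'a \<Rightarrow> nat \<Rightarrow> real set"
  assumes A: "finite \<A>" "\<And>C n. C \<in> \<A> \<Longrightarrow> connected (B C n)"
    and N: "finite \<N>" "\<And>D. D \<in> \<N> \<Longrightarrow> connected D"
    and meet: "\<And>C. C \<in> \<A> \<Longrightarrow> \<forall>\<^sub>F n in sequentially. \<exists>D\<in>\<N>. B C n \<inter> D \<noteq> {}"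
  shows "tame ((\<Union>C\<in>\<A>. \<Union>n. B C n) \<union> \<Union>\<N>)"
proof -
  have "\<forall>C\<in>\<A>. \<exists>N. \<forall>n\<ge>N. \<exists>D\<in>\<N>. B C n \<inter> D \<noteq> {}" using meet by (simp add: eventually_sequentially)
  then obtain M where M: "\<And>C n. C \<in> \<A> \<Longrightarrow> n \<ge> M C \<Longrightarrow> \<exists>D\<in>\<N>. B C n \<inter> D \<noteq> {}" by metis
  \<comment> \<open>\<open>D\<close> enlarged by every interval of the family that meets it; the
    union is connected because all its members contain \<open>D\<close>.\<close>
  define V where "V = (\<lambda>D. \<Union>(insert D {D \<union> B C n | C n. C \<in> \<A> \<and> B C n \<inter> D \<noteq> {}}))"
  have V: "connected (V D)" if D: "D \<in> \<N>" for D
  proof (cases "D = {}")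
    case False
    show ?thesis unfolding V_def
    proof (rule connected_Union)
      show "connected s" if "s \<in> insert D {D \<union> B C n | C n. C \<in> \<A> \<and> B C n \<inter> D \<noteq> {}}" for s
        using that N(2)[OF D] A(2) by (auto intro!: connected_Un)
      have "D \<subseteq> \<Inter>(insert D {D \<union> B C n | C n. C \<in> \<A> \<and> B C n \<inter> D \<noteq> {}})" by blast
      then show "\<Inter>(insert D {D \<union> B C n | C n. C \<in> \<A> \<and> B C n \<inter> D \<noteq> {}}) \<noteq> {}" using False by blast
    qed
  qed (simp add: V_def)
  have "(\<Union>C\<in>\<A>. \<Union>n. B C n) \<union> \<Union>\<N> = (\<Union>C\<in>\<A>. \<Union>n\<in>{..<M C}. B C n) \<union> (\<Union>D\<in>\<N>. V D)" (is "?L = ?R")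
  proof
    show "?L \<subseteq> ?R"
    proof
      fix x assume "x \<in> ?L"
      then consider C n where "C \<in> \<A>" "x \<in> B C n" | D where "D \<in> \<N>" "x \<in> D" by blast
      then show "x \<in> ?R"
      proof cases
        case 1
        show ?thesis
        proof (cases "n < M C")
          case False
          then obtain D where "D \<in> \<N>" "B C n \<inter> D \<noteq> {}" using M[OF 1(1), of n] by auto
          then have "x \<in> V D" using 1 unfolding V_def by blast
          then show ?thesis using \<open>D \<in> \<N>\<close> by blast
        qed (use 1 in blast)
      next
        case 2
        then have "x \<in> V D" unfolding V_def by blast
        then show ?thesis using 2 by blast
      qed
    qed
    have "V D \<subseteq> ?L" if "D \<in> \<N>" for D using that unfolding V_def by blast
    then show "?R \<subseteq> ?L" by blast
  qed
  moreover have "tame ?R"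
    using A N(1) V by (intro tame_Un tame_UN connected_tame) auto
  ultimately show ?thesis by simp
qed

text \<open>A continuous injective map of an interval is monotone, so it preserves
  betweenness.\<close>

lemma injective_preserves_segment:
  fixes g :: "real \<Rightarrow> real"
  assumes I: "is_interval I" "continuous_on I g" "inj_on g I" and x: "x \<in> I" "z \<in> I" "y \<in>
      closed_segment x z"
  shows "g y \<in> closed_segment (g x) (g z)"
proof -
  have *: "g y \<in> closed_segment (g x) (g z)" if xz: "x \<in> I" "z \<in> I" "x \<le> y" "y \<le> z" for x y z
  proof (cases "x = y \<or> y = z")
    case False
    have sub: "{x..z} \<subseteq> I"
      using I(1) xz(1,2) unfolding is_interval_1 by (meson atLeastAtMost_iff subsetI)
    have "x < y" "y < z" using False xz(3,4) by auto
    from continuous_inj_imp_mono[OF this continuous_on_subset[OF I(2) sub] inj_on_subset[OF I(3) sub]]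
    show ?thesis by (elim disjE) (simp_all add: closed_segment_eq_real_ivl)
  next
    case True
    then show ?thesis by (elim disjE) simp_all
  qed
  show ?thesis
  proof (cases "x \<le> z")
    case True
    then show ?thesis using *[of x z y] x by (auto simp: closed_segment_eq_real_ivl)
  next
    case False
    then have "g y \<in> closed_segment (g z) (g x)" using *[of z x y] x by (auto simp:
        closed_segment_eq_real_ivl)
    then show ?thesis by (simp add: closed_segment_commute)
  qed
qed

text \<open>The points whose whole orbit stays near an injective fixed point form an interval, and its
  interior is invariant because \<open>g\<close> is an open map there.\<close>

lemma injective_fixed_point_invariant:
  fixes g :: "real \<Rightarrow> real"
  assumes \<delta>: "\<delta> > 0" and g: "continuous_on {-\<delta><..<\<delta>} g" "inj_on g {-\<delta><..<\<delta>}" "g 0 = 0"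
  obtains N where "open N" "tame N" "0 \<notin> N" "N \<subseteq> {-\<delta><..<\<delta>}" "g ` N \<subseteq> N"
    "\<forall>t. t \<longlonglongrightarrow> 0 \<longrightarrow> (\<forall>n. \<bar>t n\<bar> < \<delta> \<longrightarrow> t (Suc n) = g (t n)) \<longrightarrow>
       (\<forall>\<^sub>F n in sequentially. t n = 0 \<or> t n \<in> N)"
proof -
  define I where "I = {-\<delta><..<\<delta>}"
  have I: "is_interval I" "open I" "0 \<in> I" using \<delta> by (auto simp: I_def is_interval_oo)
  define M where "M = {t. \<forall>n. (g ^^ n) t \<in> I}"
  have MI: "M \<subseteq> I"
  proof
    fix t assume "t \<in> M"
    then have "(g ^^ 0) t \<in> I" unfolding M_def by blast
    then show "t \<in> I" by simp
  qed
  have gM: "g t \<in> M" if "t \<in> M" for t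
  proof -
    have "(g ^^ n) (g t) \<in> I" for n
    proof -
      have "(g ^^ Suc n) t \<in> I" using that unfolding M_def by blast
      then show ?thesis by (simp add: funpow_swap1)
    qed
    then show ?thesis by (simp add: M_def)
  qed
  have "(g ^^ n) 0 = 0" for n by (induction n) (auto simp: g(3))
  then have M0: "0 \<in> M" using I(3) by (simp add: M_def)
  have Mseg: "y \<in> M" if xz: "x \<in> M" "z \<in> M" and y: "y \<in> closed_segment x z" for x y z
  proof -
    have inI: "y' \<in> I" if "x' \<in> I" "z' \<in> I" "y' \<in> closed_segment x' z'" for x' y' z'
      using that I(1) unfolding is_interval_convex_1 convex_contains_segment by blast
    have "(g ^^ n) y \<in> closed_segment ((g ^^ n) x) ((g ^^ n) z)" for n
    proof (induction n)
      case (Suc n)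
      have "(g ^^ n) x \<in> I" "(g ^^ n) z \<in> I" using xz by (auto simp: M_def)
      then show ?case using injective_preserves_segment[OF I(1)] g Suc by (simp add: I_def)
    qed (use y in simp)
    then show ?thesis using xz inI unfolding M_def by blast
  qed
  then have "convex M" unfolding convex_contains_segment by blast
  then have "convex (interior M)" by (rule convex_interior)
  then have ci: "connected (interior M)" by (rule convex_connected)
  \<comment> \<open>The fixed point is removed because in the chart at infinity \<open>0\<close> has
    no affine counterpart.\<close>
  define N where "N = interior M - {0}"
  have "N = (interior M \<inter> {..<0}) \<union> (interior M \<inter> {0<..})" by (auto simp: N_def)
  then have tN: "tame N" using ci by (simp add: tame_Un connected_tame connected_Int_real)
  have gi: "g ` interior M \<subseteq> interior M"
  proof (rule interior_maximal)
    show "g ` interior M \<subseteq> M" using gM interior_subset by blast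
    show "open (g ` interior M)"
      by (rule injective_into_1d_imp_open_map_UNIV[OF open_interior g(1,2)])
         (use MI interior_subset[of M] in \<open>unfold I_def, blast\<close>)
  qed
  have gN: "g ` N \<subseteq> N"
  proof
    fix y assume "y \<in> g ` N"
    then obtain t where t: "t \<in> interior M" "t \<noteq> 0" "y = g t" by (auto simp: N_def)
    have "t \<in> I" using t(1) interior_subset MI by blast
    then have "g t \<noteq> 0" using inj_onD[OF g(2), of t 0] g(3) t(2) I(3) by (auto simp: I_def)
    then show "y \<in> N" using gi t by (auto simp: N_def)
  qed
  show thesis
  proof (rule that[of N])
    show "open N" by (simp add: N_def open_delete)
    show "N \<subseteq> {-\<delta><..<\<delta>}" using MI interior_subset[of M] by (auto simp: N_def I_def)
    show "\<forall>t. t \<longlonglongrightarrow> 0 \<longrightarrow> (\<forall>n. \<bar>t n\<bar> < \<delta> \<longrightarrow> t (Suc n) = g (t n)) \<longrightarrow>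
       (\<forall>\<^sub>F n in sequentially. t n = 0 \<or> t n \<in> N)"
    proof (intro allI impI)
      fix t :: "nat \<Rightarrow> real"
      assume t: "t \<longlonglongrightarrow> 0" and "\<forall>n. \<bar>t n\<bar> < \<delta> \<longrightarrow> t (Suc n) = g (t n)"
      then have step: "\<And>n. \<bar>t n\<bar> < \<delta> \<Longrightarrow> t (Suc n) = g (t n)" by blast
      have "\<forall>\<^sub>F n in sequentially. \<bar>t n\<bar> < \<delta>" using t \<delta> by (simp add: tendsto_iff)
      then obtain n0 where n0: "\<And>n. n \<ge> n0 \<Longrightarrow> \<bar>t n\<bar> < \<delta>" by (auto simp: eventually_sequentially)
      have it: "(g ^^ k) (t n) = t (n + k)" if "n \<ge> n0" for n k
      proof (induction k)
        case (Suc k)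
        then show ?case using step[of "n + k"] n0[of "n + k"] that by simp
      qed simp
      have tM: "t n \<in> M" if n: "n \<ge> n0" for n
      proof -
        have "(g ^^ k) (t n) \<in> I" for k
          using n0[of "n + k"] n by (simp add: it[OF n] I_def abs_less_iff)
        then show ?thesis by (simp add: M_def)
      qed
      \<comment> \<open>On a given side of \<open>0\<close>, either \<open>M\<close> contains some
        \<open>m\<close>, and then all points between \<open>0\<close> and \<open>m\<close> are
        interior to \<open>M\<close>; or \<open>M\<close> has no points there, and the tail of the
        orbit, which lies in \<open>M\<close>, never visits that side.\<close>
      have side: "\<forall>\<^sub>F n in sequentially. s * t n > 0 \<longrightarrow> t n \<in> N" if s: "s = 1 \<or> s = -1" for s :: real
      proof (cases "\<exists>m\<in>M. s * m > 0")
        case True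
        then obtain m where m: "m \<in> M" "s * m > 0" by blast
        have "\<forall>\<^sub>F n in sequentially. \<bar>t n\<bar> < \<bar>m\<bar>" using t m(2) by (intro order_tendstoD(2)[OF
            tendsto_rabs_zero]) auto
        then show ?thesis
        proof (rule eventually_mono, intro impI)
          fix n assume n: "\<bar>t n\<bar> < \<bar>m\<bar>" "s * t n > 0"
          define J where "J = {v. s * v > 0 \<and> \<bar>v\<bar> < \<bar>m\<bar>}"
          have "open J" unfolding J_def by (intro open_Collect_conj open_Collect_less continuous_intros)
          moreover have "J \<subseteq> M"
          proof
            fix v assume "v \<in> J"
            then have "v \<in> closed_segment 0 m" using s m(2) by (auto simp: J_def
                closed_segment_eq_real_ivl)
            then show "v \<in> M" by (rule Mseg[OF M0 m(1)])
          qed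
          moreover have "t n \<in> J" using n by (simp add: J_def)
          ultimately have "t n \<in> interior M" by (meson interior_maximal subsetD)
          then show "t n \<in> N" using n(2) by (auto simp: N_def)
        qed
      next
        case False
        then show ?thesis using tM by (auto simp: eventually_sequentially)
      qed
      show "\<forall>\<^sub>F n in sequentially. t n = 0 \<or> t n \<in> N"
        using side[of 1, simplified] side[of "-1", simplified]
      proof eventually_elim
        case (elim n)
        then show ?case by (cases "t n" "0 :: real" rule: linorder_cases) auto
      qed
    qed
  qed (use tN gN in \<open>auto simp: N_def\<close>)
qed

section \<open>Normalisation: an unstable fixed point at infinity\<close>

lemma finite_uniform_pos:
  fixes P :: "'a \<Rightarrow> real \<Rightarrow> bool"
  assumes "finite E" "\<And>c. c \<in> E \<Longrightarrow> \<exists>s>0. P c s"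
    and mono: "\<And>c s s'. P c s \<Longrightarrow> 0 < s' \<Longrightarrow> s' \<le> s \<Longrightarrow> P c s'"
  shows "\<exists>s>0. \<forall>c\<in>E. P c s"
  using assms(1,2)
proof (induction E rule: finite_induct)
  case empty
  then show ?case by (intro exI[of _ 1]) simp
next
  case (insert x E)
  then obtain s where s: "s > 0" "\<forall>c\<in>E. P c s" by auto
  obtain s' where s': "s' > 0" "P x s'" using insert.prems[of x] by auto
  have "P x (min s s')" using mono[OF s'(2), of "min s s'"] s s' by simp
  moreover have "P c (min s s')" if "c \<in> E" for c
    using mono[of c s "min s s'"] s s'(1) that by simp
  ultimately show ?case using s(1) s'(1) by (intro exI[of _ "min s s'"]) simp
qed

text \<open>Near a fixed point one step moves only a little, so an orbit close to a finite set of
  fixed points cannot jump from one to another.\<close>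

lemma orbit_converges:
  assumes f: "rational_map n f" and E: "finite E" "\<And>c. c \<in> E \<Longrightarrow> f c = c"
    and x: "\<And>n. x (Suc n) = f (x n)"
    and ev: "\<And>e. e > 0 \<Longrightarrow> \<forall>\<^sub>F n in sequentially. \<exists>c\<in>E. x n \<in> disc c e"
  obtains c where "c \<in> E" "sconv x c"
proof -
  define D where "D = {(c, c'). c \<in> E \<and> c' \<in> E \<and> c \<noteq> c'}"
  have "finite D" by (rule finite_subset[of _ "E \<times> E"]) (use E(1) in \<open>auto simp: D_def\<close>)
  then have "\<exists>e>0. \<forall>cc\<in>D. disc (fst cc) e \<inter> disc (snd cc) e = {}"
  proof (rule finite_uniform_pos)
    fix cc assume "cc \<in> D"
    then have "fst cc \<noteq> snd cc" by (auto simp: D_def)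
    then show "\<exists>s>0. disc (fst cc) s \<inter> disc (snd cc) s = {}" by (rule disc_separate) blast
  next
    fix cc and s s' :: real assume "disc (fst cc) s \<inter> disc (snd cc) s = {}" "s' \<le> s"
    then show "disc (fst cc) s' \<inter> disc (snd cc) s' = {}"
      using disc_mono[of s' s "fst cc"] disc_mono[of s' s "snd cc"] by blast
  qed
  then obtain e0 where e0: "e0 > 0" "\<And>c c'. c \<in> E \<Longrightarrow> c' \<in> E \<Longrightarrow> c \<noteq> c' \<Longrightarrow> disc c e0 \<inter> disc c' e0 = {}"
    by (auto simp: D_def)
  have *: "\<exists>c\<in>E. \<forall>\<^sub>F n in sequentially. x n \<in> disc c e" if e: "e > 0" "e \<le> e0" for e
  proof -
    have "\<exists>s>0. \<forall>c\<in>E. f ` disc c s \<subseteq> disc c e"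
    proof (rule finite_uniform_pos[OF E(1)])
      fix c assume "c \<in> E"
      then show "\<exists>s>0. f ` disc c s \<subseteq> disc c e"
        using rational_map_continuous[OF f e(1), of c] E(2) by metis
    next
      fix c and s s' :: real assume "f ` disc c s \<subseteq> disc c e" "s' \<le> s"
      then show "f ` disc c s' \<subseteq> disc c e" using disc_mono[of s' s c] by blast
    qed
    then obtain s0 where s0: "s0 > 0" "\<And>c. c \<in> E \<Longrightarrow> f ` disc c s0 \<subseteq> disc c e" by auto
    \<comment> \<open>From the \<open>s\<close>-disc of \<open>c\<close> the orbit stays in its
      \<open>e\<close>-disc for one step. It must again be \<open>s\<close>-close to some point of
      \<open>E\<close>, and the separation \<open>e0\<close> forces that point to be
      \<open>c\<close>.\<close>
    define s where "s = min s0 e"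
    have s: "s > 0" "s \<le> e" "\<And>c. c \<in> E \<Longrightarrow> f ` disc c s \<subseteq> disc c e"
    proof -
      show "s > 0" "s \<le> e" using s0 e by (auto simp: s_def)
      show "f ` disc c s \<subseteq> disc c e" if "c \<in> E" for c
        using s0(2)[OF that] disc_mono[of s s0 c] by (auto simp: s_def)
    qed
    obtain N where N: "\<And>n. n \<ge> N \<Longrightarrow> \<exists>c\<in>E. x n \<in> disc c s"
      using ev[OF s(1)] by (auto simp: eventually_sequentially)
    obtain c where c: "c \<in> E" "x N \<in> disc c s" using N by blast
    have "x (N + k) \<in> disc c s" for k
    proof (induction k)
      case (Suc k)
      have 1: "x (N + Suc k) \<in> disc c e" using s(3)[OF c(1)] Suc x[of "N + k"] by auto
      obtain c' where c': "c' \<in> E" "x (N + Suc k) \<in> disc c' s" using N[of "N + Suc k"] by auto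
      have "x (N + Suc k) \<in> disc c e0" "x (N + Suc k) \<in> disc c' e0"
        using 1 c'(2) disc_mono[of e e0 c] disc_mono[of s e0 c'] e s(2) by auto
      then have "c = c'" using e0(2)[OF c(1) c'(1)] by blast
      then show ?case using c' by simp
    qed (use c in simp)
    then have "x n \<in> disc c s" if "n \<ge> N" for n using that by (metis le_add_diff_inverse)
    then have "x n \<in> disc c e" if "n \<ge> N" for n using that disc_mono[OF s(2)] by blast
    then show ?thesis using c(1) by (auto simp: eventually_sequentially)
  qed
  obtain c where c: "c \<in> E" "\<forall>\<^sub>F n in sequentially. x n \<in> disc c e0" using *[of e0] e0(1) by auto
  have "sconv x c" unfolding sconv_def
  proof (intro allI impI)
    fix e :: real assume e: "e > 0"
    define e' where "e' = min e e0"
    have e': "e' > 0" "e' \<le> e0" "e' \<le> e" using e e0(1) by (auto simp: e'_def)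
    obtain c' where c': "c' \<in> E" "\<forall>\<^sub>F n in sequentially. x n \<in> disc c' e'" using *[OF e'(1,2)] by blast
    have "\<forall>\<^sub>F n in sequentially. x n \<in> disc c e0 \<and> x n \<in> disc c' e0"
      using c(2) c'(2) by eventually_elim (use disc_mono[OF e'(2)] in blast)
    then have "\<exists>n. x n \<in> disc c e0 \<and> x n \<in> disc c' e0"
      using eventually_happens trivial_limit_sequentially by blast
    then have "c = c'" using e0(2)[OF c(1) c'(1)] by blast
    then show "\<forall>\<^sub>F n in sequentially. x n \<in> disc c e"
      using c'(2) by (elim eventually_mono) (use disc_mono[OF e'(3)] in blast)
  qed
  then show thesis using that c(1) by blast
qed

lemma sconv_cnj:
  assumes "sconv X z"
  shows "sconv (\<lambda>n. map_option cnj (X n)) (map_option cnj z)"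
proof -
  have "map_option cnj x \<in> disc (map_option cnj z) e" if "x \<in> disc z e" for x e
  proof (cases x; cases z)
    fix u w assume "x = Some u" "z = Some w"
    then show ?thesis using that by (simp flip: complex_cnj_diff)
  qed (use that in auto)
  then show ?thesis using assms unfolding sconv_def by (auto elim!: eventually_mono)
qed

lemma frequently_strict_mono:
  assumes "\<not> (\<forall>\<^sub>F n in sequentially. P n)"
  obtains k :: "nat \<Rightarrow> nat" where "strict_mono k" "\<And>j. \<not> P (k j)"
proof -
  have "infinite {n. \<not> P n}"
    using assms by (simp flip: cofinite_eq_sequentially add: eventually_cofinite)
  from infinite_enumerate[OF this] show thesis using that by auto
qed

text \<open>The condition \<open>cq\<close> says that infinity is fixed. Instability is assumed in
  place of a bound on the multiplier, since it is the property that the conjugation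
  delivers.\<close>

locale normalized =
  fixes d :: nat and p q :: "real poly" and f :: "sphere \<Rightarrow> sphere"
  assumes nd: "nondeg d p q" and f_def: "f = ratfun_map d p q" and d2: "d \<ge> 2"
    and cq: "coeff q d = 0" and unstable: "\<not> stable f None"
begin

abbreviation P :: "complex poly" where "P \<equiv> map_poly complex_of_real p"
abbreviation Q :: "complex poly" where "Q \<equiv> map_poly complex_of_real q"

lemma rat: "rational_map d f"
  using nd f_def by (auto simp: rational_map_def)

lemma rat_funpow: "rational_map (d ^ k) (f ^^ k)"
  by (rule rational_map_funpow[OF rat])

lemma f_None: "f None = None" and funpow_None: "(f ^^ n) None = None"
proof -
  show *: "f None = None" using cq by (simp add: f_def ratfun_map_def)
  show "(f ^^ n) None = None" by (induction n) (auto simp: *)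
qed

lemma cp: "coeff p d \<noteq> 0"
  using nondegD(5)[OF nd] cq by simp

lemma PQ: "\<not> (poly P z = 0 \<and> poly Q z = 0)"
  by (rule nondegD(4)[OF nd])

lemma f_eq_None: "f (Some z) = None \<longleftrightarrow> poly Q z = 0"
  by (simp add: f_def ratfun_map_Some[OF nd] proj_def)

lemma f_eq_Some: "f (Some z) = Some y \<longleftrightarrow> poly (P - smult y Q) z = 0"
  using PQ[of z] by (auto simp: f_def ratfun_map_Some[OF nd] proj_def field_simps)

lemma f_Some: "poly Q z \<noteq> 0 \<Longrightarrow> f (Some z) = Some (poly P z / poly Q z)"
  by (simp add: f_def ratfun_map_Some[OF nd] proj_def)

lemma degree_P_Q: "degree (P - smult y Q) = d"
proof (rule antisym)
  show "degree (P - smult y Q) \<le> d"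
    using nondegD(1,2)[OF nd] degree_map_poly[of complex_of_real p] degree_map_poly[of
        complex_of_real q]
    by (intro degree_diff_le order_trans[OF degree_smult_le]) auto
  show "d \<le> degree (P - smult y Q)"
    by (rule le_degree) (simp add: coeff_map_poly cq cp)
qed

lemma preimage_exists: "\<exists>z. f (Some z) = Some y"
  unfolding f_eq_Some using degree_P_Q[of y] d2 by (intro alg_closed_imp_poly_has_root) simp

lemma deriv_at_infinity_nonzero:
  assumes "local_rep f None r G"
  shows "deriv G 0 \<noteq> 0"
  using attracting_imp_stable[OF assms f_None] unstable by auto

text \<open>A constant \<open>Q\<close> would make \<open>f\<close> a polynomial of degree at least
  2, with infinity superattracting and hence stable.\<close>

lemma degree_Q: "degree Q \<noteq> 0"
proof
  assume "degree Q = 0"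
  then have dq: "degree q = 0" using degree_map_poly[of complex_of_real q] by simp
  obtain r G where G: "local_rep f None r G" by (rule rational_map_local_rep[OF rat])
  note G' = local_repD[OF G]
  define h where "h = homog d p 1"
  have h0: "h 0 \<noteq> 0" using cp by (simp add: h_def homog_0)
  have hq: "homog d q 1 t = of_real (coeff q 0) * t ^ d" for t
  proof -
    have "homog d q 1 t = (\<Sum>i\<le>d. if i = 0 then of_real (coeff q 0) * t ^ d else 0)"
      unfolding homog_def using dq by (intro sum.cong) (auto simp: coeff_eq_0)
    then show ?thesis by simp
  qed
  have hc: "continuous (at 0) h"
    unfolding h_def homog_def by (intro continuous_intros)
  then have "\<exists>e>0. \<forall>t. dist 0 t < e \<longrightarrow> h t \<noteq> 0" using continuous_at_avoid[of 0 h 0] h0 by blast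
  then obtain e where e: "e > 0" "\<And>t. norm t < e \<Longrightarrow> h t \<noteq> 0" by auto
  have Geq: "G t = of_real (coeff q 0) * t ^ d / h t" if t: "norm t < min r e" for t
  proof -
    have "chart None (G t) = f (proj 1 t)" using G'(4)[of t] t f_None by (simp add: chart_None)
    also have "\<dots> = proj (h t) (of_real (coeff q 0) * t ^ d)"
      unfolding f_def by (subst ratfun_map_proj[OF nd]) (auto simp: h_def hq)
    also have "\<dots> = chart None (of_real (coeff q 0) * t ^ d / h t)"
      using e(2)[of t] t by (simp add: chart_None proj_def)
    finally show ?thesis by (simp add: chart_inj)
  qed
  have "d = Suc (Suc (d - 2))" using d2 by simp
  then obtain j where j: "d = Suc (Suc j)" by blast
  have "((\<lambda>t. of_real (coeff q 0) * t ^ Suc j / h t) \<longlongrightarrow> of_real (coeff q 0) * 0 ^ Suc j / h 0) (at 0)"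
    using hc h0 by (intro tendsto_intros) (auto simp: continuous_at)
  then have "((\<lambda>t. of_real (coeff q 0) * t ^ Suc j / h t) \<longlongrightarrow> 0) (at 0)" by simp
  moreover have "\<forall>\<^sub>F t in at 0. of_real (coeff q 0) * t ^ Suc j / h t = G t / t"
    unfolding eventually_at using e(1) G'(1)
    by (intro exI[of _ "min r e"]) (auto simp: Geq j)
  ultimately have "((\<lambda>t. G t / t) \<longlongrightarrow> 0) (at 0)" by (rule Lim_transform_eventually)
  from tendsto_unique[OF _ this quotient_tendsto_deriv[OF G'(1-3)]] have "deriv G 0 = 0" by simp
  then show False using deriv_at_infinity_nonzero[OF G] by simp
qed

text \<open>Hitting \<open>a\<close> or \<open>b\<close> means reaching infinity one or two steps
  later, so maps that avoid infinity under all iterates avoid two finite values as well.\<close>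

definition a :: complex where "a = (SOME a. f (Some a) = None)"
definition b :: complex where "b = (SOME b. f (Some b) = Some a)"

lemma f_a: "f (Some a) = None" and f_b: "f (Some b) = Some a" and a_neq_b: "a \<noteq> b"
proof -
  have "\<exists>a. f (Some a) = None"
    unfolding f_eq_None using degree_Q by (intro alg_closed_imp_poly_has_root) simp
  then show a: "f (Some a) = None" unfolding a_def by (rule someI_ex)
  show b: "f (Some b) = Some a" unfolding b_def by (rule someI_ex[OF preimage_exists])
  show "a \<noteq> b" using a b by auto
qed

text \<open>The Wronskian, the numerator of the derivative of \<open>P / Q\<close>; away from poles
  its zeros are the finite critical points.\<close>

definition W :: "complex poly" where "W = pderiv P * Q - P * pderiv Q"

text \<open>At the pole \<open>a\<close> the product \<open>P * pderiv Q\<close> vanishes to one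
  order less than \<open>Q\<close>, while \<open>pderiv P * Q\<close> vanishes at least to the order
  of \<open>Q\<close>.\<close>

lemma W_nonzero: "W \<noteq> 0"
proof
  assume "W = 0"
  then have eq: "pderiv P * Q = P * pderiv Q" by (simp add: W_def)
  have Qa: "poly Q a = 0" using f_a f_eq_None by simp
  then have Pa: "poly P a \<noteq> 0" using PQ by blast
  have P0: "P \<noteq> 0" using Pa by auto
  have Q0: "Q \<noteq> 0" using degree_Q by auto
  have Q': "pderiv Q \<noteq> 0" using degree_Q by (simp add: pderiv_eq_0_iff)
  then have "P * pderiv Q \<noteq> 0" using P0 by simp
  have 1: "order a Q = Suc (order a (pderiv Q))" by (rule order_pderiv[OF Q0 Qa])
  have "order a P = 0" using Pa order_root by blast
  then have 2: "order a (P * pderiv Q) = order a (pderiv Q)"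
    using order_mult[OF \<open>P * pderiv Q \<noteq> 0\<close>, of a] by simp
  have "order a (pderiv P * Q) = order a (pderiv P) + order a Q"
    using \<open>P * pderiv Q \<noteq> 0\<close> by (intro order_mult) (simp add: eq)
  then show False using 1 2 eq by simp
qed

text \<open>The finite critical values; outside this set all preimages are simple and have local
  inverse branches.\<close>

definition E :: "complex set" where "E = {y. \<exists>z. poly W z = 0 \<and> f (Some z) = Some y}"

lemma finite_E: "finite E"
proof -
  have "E \<subseteq> (\<lambda>z. the (f (Some z))) ` {z. poly W z = 0}"
  proof
    fix y assume "y \<in> E"
    then obtain z where "poly W z = 0" "f (Some z) = Some y" by (auto simp: E_def)
    then show "y \<in> (\<lambda>z. the (f (Some z))) ` {z. poly W z = 0}" by (intro image_eqI[of _ _ z]) auto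
  qed
  then show ?thesis using poly_roots_finite[OF W_nonzero] finite_surj by blast
qed

lemma W_at_preimage:
  assumes "f (Some z) = Some y"
  shows "poly W z = poly (pderiv (P - smult y Q)) z * poly Q z"
  using assms unfolding f_eq_Some W_def
  by (simp add: pderiv_diff pderiv_smult algebra_simps)

text \<open>The equation \<open>P = y Q\<close> has degree \<open>d >= 2\<close>, and a double root
  would be a zero of \<open>W\<close>.\<close>

lemma two_preimages:
  assumes "y \<notin> E"
  obtains \<alpha> \<beta> where "\<alpha> \<noteq> \<beta>" "f (Some \<alpha>) = Some y" "f (Some \<beta>) = Some y" "poly W \<alpha> \<noteq> 0" "poly W \<beta> \<noteq> 0"
proof -
  obtain \<alpha> where \<alpha>: "f (Some \<alpha>) = Some y" using preimage_exists by blast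
  let ?R = "P - smult y Q"
  have "poly ?R \<alpha> = 0" using \<alpha> by (simp only: f_eq_Some)
  then obtain S where S: "?R = [:- \<alpha>, 1:] * S" unfolding poly_eq_0_iff_dvd by (elim dvdE)
  have R0: "?R \<noteq> 0" using degree_P_Q[of y] d2 by auto
  then have "degree ?R = 1 + degree S" unfolding S by (subst degree_mult_eq) auto
  then have "degree S > 0" using degree_P_Q[of y] d2 by simp
  then obtain \<beta> where \<beta>: "poly S \<beta> = 0" using alg_closed_imp_poly_has_root by blast
  have f\<beta>: "f (Some \<beta>) = Some y" unfolding f_eq_Some S by (simp add: \<beta>)
  have W: "poly W \<alpha> \<noteq> 0" "poly W \<beta> \<noteq> 0" using assms \<alpha> f\<beta> by (auto simp: E_def)
  have "\<alpha> \<noteq> \<beta>"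
  proof
    assume "\<alpha> = \<beta>"
    have "pderiv [:- \<alpha>, 1:] = 1" by (simp add: pderiv_pCons)
    then have "pderiv ?R = [:- \<alpha>, 1:] * pderiv S + S" unfolding S by (simp only: pderiv_mult
        mult_1_right)
    then have "poly (pderiv ?R) \<alpha> = poly [:- \<alpha>, 1:] \<alpha> * poly (pderiv S) \<alpha> + poly S \<alpha>"
      by (simp only: poly_add poly_mult)
    moreover have "poly [:- \<alpha>, 1:] \<alpha> = 0" by simp
    ultimately have "poly (pderiv ?R) \<alpha> = poly S \<alpha>" by (simp only: mult_zero_left add_0)
    then have "poly (pderiv ?R) \<alpha> = 0" using \<beta> \<open>\<alpha> = \<beta>\<close> by simp
    then show False using W_at_preimage[OF \<alpha>] W(1) by simp
  qed
  then show thesis using that \<alpha> f\<beta> W by blast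
qed

lemma nonreal_preimage:
  assumes "f (Some z) = Some y" "Im y \<noteq> 0"
  shows "Im z \<noteq> 0"
  using rational_map_real[OF rat, of "Some z"] assms by auto

lemma noninjective_nonreal:
  obtains z1 z2 y where "Im z1 \<noteq> 0" "Im z2 \<noteq> 0" "Im y \<noteq> 0" "z1 \<noteq> z2" "f (Some z1) = Some y" "f
      (Some z2) = Some y"
proof -
  have "uncountable (ball \<i> 1)" by (rule uncountable_ball) simp
  then have "\<not> ball \<i> 1 \<subseteq> E" using finite_E countable_finite countable_subset by blast
  then obtain y where y: "y \<in> ball \<i> 1" "y \<notin> E" by blast
  have "\<bar>Im (\<i> - y)\<bar> < 1" using y(1) abs_Im_le_cmod[of "\<i> - y"] by (simp add: dist_norm)
  then have "Im y \<noteq> 0" by auto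
  then show thesis using two_preimages[OF y(2)] nonreal_preimage that by metis
qed

lemma locally_injective:
  assumes "f (Some \<alpha>0) = Some u" "poly W \<alpha>0 \<noteq> 0"
  obtains F r where "r > 0" "F holomorphic_on ball \<alpha>0 r" "inj_on F (ball \<alpha>0 r)"
    "\<And>z. z \<in> ball \<alpha>0 r \<Longrightarrow> f (Some z) = Some (F z)"
proof -
  define F where "F = (\<lambda>z. poly P z / poly Q z)"
  define O' where "O' = {z. poly Q z \<noteq> 0}"
  have O': "open O'" unfolding O'_def by (intro open_Collect_neq continuous_intros)
  have Fh: "F holomorphic_on O'" unfolding F_def O'_def by (intro holomorphic_intros) auto
  have fF: "f (Some z) = Some (F z)" if "z \<in> O'" for z using that by (simp add: O'_def F_def f_Some)
  have \<alpha>O: "\<alpha>0 \<in> O'" using assms(1) f_eq_None[of \<alpha>0] by (auto simp: O'_def)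
  have Qn: "poly Q \<alpha>0 \<noteq> 0" using \<alpha>O by (simp add: O'_def)
  have "(F has_field_derivative (poly (pderiv P) \<alpha>0 * poly Q \<alpha>0 - poly P \<alpha>0 * poly (pderiv Q) \<alpha>0)
      / (poly Q \<alpha>0 * poly Q \<alpha>0)) (at \<alpha>0)"
    unfolding F_def by (rule DERIV_divide[OF poly_DERIV poly_DERIV Qn])
  then have "deriv F \<alpha>0 = poly W \<alpha>0 / (poly Q \<alpha>0 * poly Q \<alpha>0)"
    by (simp add: DERIV_imp_deriv W_def)
  then have "deriv F \<alpha>0 \<noteq> 0" using assms(2) Qn by simp
  then obtain r where r: "r > 0" "ball \<alpha>0 r \<subseteq> O'" "inj_on F (ball \<alpha>0 r)"
    by (rule has_complex_derivative_locally_injective[OF Fh \<alpha>O O'])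
  show thesis
    by (rule that[OF r(1) holomorphic_on_subset[OF Fh r(2)] r(3)]) (use fF r(2) in blast)
qed

lemma inverse_branch:
  assumes "f (Some \<alpha>0) = Some u" "poly W \<alpha>0 \<noteq> 0"
  obtains \<rho> \<alpha> where "\<rho> > 0" "\<alpha> holomorphic_on ball u \<rho>" "\<alpha> u = \<alpha>0"
    "\<And>z. z \<in> ball u \<rho> \<Longrightarrow> f (Some (\<alpha> z)) = Some z"
proof -
  obtain F r where r: "r > 0" and Fb: "F holomorphic_on ball \<alpha>0 r" and inj: "inj_on F (ball \<alpha>0 r)"
    and fF: "\<And>z. z \<in> ball \<alpha>0 r \<Longrightarrow> f (Some z) = Some (F z)"
    by (rule locally_injective[OF assms]) (rule that)
  have Fu: "F \<alpha>0 = u" using fF[of \<alpha>0] r assms(1) by simp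
  obtain g where g: "g holomorphic_on F ` ball \<alpha>0 r" "\<And>z. z \<in> ball \<alpha>0 r \<Longrightarrow> g (F z) = z"
    using holomorphic_has_inverse[OF Fb open_ball inj] by metis
  have "open (F ` ball \<alpha>0 r)" by (rule open_mapping_thm3[OF Fb open_ball inj])
  moreover have "u \<in> F ` ball \<alpha>0 r" using Fu r by (intro image_eqI[of _ _ \<alpha>0]) auto
  ultimately obtain \<rho> where \<rho>: "\<rho> > 0" "ball u \<rho> \<subseteq> F ` ball \<alpha>0 r" by (meson openE)
  show thesis
  proof (rule that[OF \<rho>(1)])
    show "g holomorphic_on ball u \<rho>" using g(1) \<rho>(2) by (rule holomorphic_on_subset)
    show "g u = \<alpha>0" using g(2)[of \<alpha>0] r Fu by simp
    fix z assume "z \<in> ball u \<rho>"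
    then obtain s where s: "s \<in> ball \<alpha>0 r" "z = F s" using \<rho>(2) by blast
    then show "f (Some (g z)) = Some z" using g(2) fF by auto
  qed
qed

end

section \<open>Normal families of iterates off the real line\<close>

context normalized
begin

lemma iterate_holomorphic:
  assumes "\<And>z. z \<in> O' \<Longrightarrow> (f ^^ n) (Some z) \<noteq> None"
  shows "(\<lambda>z. the ((f ^^ n) (Some z))) holomorphic_on O'"
  by (rule rational_map_holomorphic[OF rat_funpow assms])

lemma backward_funpow:
  assumes S: "f -` S \<subseteq> S" and "(f ^^ n) z \<in> S"
  shows "z \<in> S"
  using assms(2)
proof (induction n arbitrary: z)
  case (Suc n)
  then have "(f ^^ n) (f z) \<in> S" by (simp add: funpow_swap1)
  then have "f z \<in> S" by (rule Suc.IH)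
  then show ?case using S by auto
qed simp

text \<open>On a disc disjoint from \<open>S\<close> all iterates avoid \<open>S\<close>, which
  contains infinity, \<open>a\<close> and \<open>b\<close>. The iterates of \<open>f ^^ k\<close>
  share the value \<open>x\<close> at the centre, so the Schottky estimate gives one Lipschitz
  constant for all of them.\<close>

lemma stable_outside_backward_invariant:
  assumes S: "None \<in> S" "f -` S \<subseteq> S" and closed: "\<And>z. z \<notin> S \<Longrightarrow> \<exists>e>0. disc z e \<inter> S = {}"
    and z: "(f ^^ k) z = z" "z \<notin> S"
  shows "stable (f ^^ k) z"
proof -
  obtain x where x: "z = Some x" using S(1) z(2) by (cases z) auto
  obtain e where e: "e > 0" "disc z e \<inter> S = {}" using closed[OF z(2)] by blast
  have "Some a \<in> f -` S" using f_a S(1) by simp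
  then have aS: "Some a \<in> S" using S(2) by blast
  have "Some b \<in> f -` S" using f_b aS by simp
  then have ab: "Some a \<in> S" "Some b \<in> S" using S(2) aS by blast+
  define h where "h = (\<lambda>n u. the (((f ^^ k) ^^ n) (Some u)))"
  have fS: "((f ^^ k) ^^ n) (Some u) \<notin> S" if "u \<in> ball x e" for n u
  proof
    assume "((f ^^ k) ^^ n) (Some u) \<in> S"
    then have "Some u \<in> S" by (rule_tac backward_funpow[OF S(2), of "k * n"]) (simp add: funpow_mult)
    moreover have "Some u \<in> disc z e" using that by (simp add: x dist_norm norm_minus_commute)
    ultimately show False using e(2) by blast
  qed
  have hS: "((f ^^ k) ^^ n) (Some u) = Some (h n u)" if "u \<in> ball x e" for n u
    using fS[OF that, of n] S(1) unfolding h_def by (cases "((f ^^ k) ^^ n) (Some u)") auto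
  have hh: "h n holomorphic_on ball x e" for n
    unfolding h_def funpow_mult
    by (rule iterate_holomorphic) (use hS in \<open>simp add: funpow_mult\<close>)
  have hab: "h n u \<noteq> a \<and> h n u \<noteq> b" if "u \<in> ball x e" for n u
    using fS[OF that, of n] ab unfolding hS[OF that] by auto
  have "((f ^^ k) ^^ n) z = z" for n using z(1) by (induction n) auto
  then have hx: "h n x = x" for n by (simp add: h_def x)
  obtain L where L: "L > 0" "\<And>h z0 \<rho> z. \<lbrakk>\<rho> > 0; h holomorphic_on ball z0 \<rho>;
       \<And>z. z \<in> ball z0 \<rho> \<Longrightarrow> h z \<noteq> a \<and> h z \<noteq> b; norm (h z0) \<le> norm x; norm (z - z0) < \<rho> / 2\<rbrakk>
       \<Longrightarrow> norm (h z - h z0) \<le> L * norm (z - z0) / \<rho>"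
    using schottky_lipschitz[OF a_neq_b, of "norm x"] by metis
  show ?thesis unfolding stable_def
  proof (intro allI impI)
    fix e' :: real assume e': "e' > 0"
    define s where "s = min (e / 2) (e' * e / L)"
    have "s > 0" using e(1) e' L(1) by (simp add: s_def)
    moreover have "s \<le> e / 2" "s \<le> e' * e / L" unfolding s_def by (rule min.cobounded1, rule
        min.cobounded2)
    ultimately have s: "s > 0" "s \<le> e / 2" "s \<le> e' * e / L" by blast+
    have "((f ^^ k) ^^ n) y \<in> disc z e'" if y: "y \<in> disc z s" for y n
    proof -
      obtain u where u: "y = Some u" using y x by (cases y) auto
      have us: "norm (u - x) < s" using y by (simp add: u x)
      then have ub: "u \<in> ball x e" using s(2) e(1) by (simp add: dist_norm norm_minus_commute)
      have "norm (h n u - h n x) \<le> L * norm (u - x) / e"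
        by (rule L(2)[OF e(1) hh hab]) (use hx us s(2) in auto)
      also have "\<dots> < L * (e' * e / L) / e"
        using us s(3) L(1) e(1) by (intro divide_strict_right_mono mult_strict_left_mono) auto
      also have "\<dots> = e'" using L(1) e(1) by simp
      finally show ?thesis unfolding u hS[OF ub] by (simp add: x hx)
    qed
    then show "\<exists>s>0. \<forall>x\<in>disc z s. \<forall>n. ((f ^^ k) ^^ n) x \<in> disc z e'" using s(1) by blast
  qed
qed

end

section \<open>Iterates that never take nonreal points to infinity\<close>

locale omitting = normalized +
  assumes NU: "Im z \<noteq> 0 \<Longrightarrow> (f ^^ n) (Some z) \<noteq> None"
begin

definition U :: "complex set" where "U = {z. Im z \<noteq> 0}"

definition fi :: "nat \<Rightarrow> complex \<Rightarrow> complex" where "fi n z = the ((f ^^ n) (Some z))"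

lemma U_iff [simp]: "z \<in> U \<longleftrightarrow> Im z \<noteq> 0" by (simp add: U_def)

lemma open_U: "open U"
  unfolding U_def by (intro open_Collect_neq continuous_intros)

lemma fi: "z \<in> U \<Longrightarrow> (f ^^ n) (Some z) = Some (fi n z)"
  using NU[of z n] by (simp add: fi_def)

lemma fi_holomorphic: "fi n holomorphic_on U"
  using iterate_holomorphic[of U n] NU unfolding fi_def[abs_def] by simp

lemma fi_0 [simp]: "fi 0 z = z" by (simp add: fi_def)

lemma fi_add: "z \<in> U \<Longrightarrow> (f ^^ m) (Some (fi n z)) = Some (fi (m + n) z)"
  by (simp flip: fi add: funpow_add)

lemma fi_fi: "z \<in> U \<Longrightarrow> fi n z \<in> U \<Longrightarrow> fi m (fi n z) = fi (m + n) z"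
  using fi_add[of z m n] fi[of "fi n z" m] by simp

lemma fi_omits: "z \<in> U \<Longrightarrow> fi n z \<noteq> a \<and> fi n z \<noteq> b"
  using fi_add[of z 1 n] fi_add[of z 2 n] f_a f_b by (auto simp: numeral_2_eq_2)

lemma fi_cnj: "z \<in> U \<Longrightarrow> fi n (cnj z) = cnj (fi n z)"
  using rational_map_cnj[OF rat_funpow, of n "Some z"] fi[of z n] fi[of "cnj z" n] by simp

lemma convex_half: "convex {z. 0 < c * Im z}"
proof -
  have eq: "{z. 0 < c * Im z} = {z. inner (of_real c * \<i>) z > 0}" by (simp add: inner_complex_def)
  show ?thesis unfolding eq by (rule convex_halfspace_gt)
qed

lemma open_half: "open {z. 0 < c * Im z}"
  by (intro open_Collect_less continuous_intros)

text \<open>\<open>U\<close> has two components, but conjugation preserves the modulus of the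
  iterates, so a bound at one point controls both half-planes: \<open>K\<close> is folded into the
  upper one.\<close>

lemma bounded_on_compact:
  assumes u: "u \<in> U" and M: "\<And>j. norm (fi (k j) u) \<le> M" and K: "compact K" "K \<subseteq> U"
  obtains B where "\<And>j z. z \<in> K \<Longrightarrow> norm (fi (k j) z) \<le> B"
proof -
  define up where "up = (\<lambda>z. if Im z > 0 then z else cnj z)"
  define K' where "K' = (K \<union> cnj ` K) \<inter> {z. 0 \<le> Im z}"
  have "compact (cnj ` K)" using K(1) by (intro compact_continuous_image continuous_intros)
  moreover have "closed {z. 0 \<le> Im z}" by (intro closed_Collect_le continuous_intros)
  ultimately have K': "compact K'" unfolding K'_def using K(1) by (intro compact_Int_closed compact_Un)
  have sub: "K' \<subseteq> {z. 0 < 1 * Im z}" using K(2) by (force simp: K'_def)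
  have "connected {z. 0 < 1 * Im z}" by (rule convex_connected[OF convex_half])
  moreover have "up u \<in> {z. 0 < 1 * Im z}" using u by (auto simp: up_def)
  ultimately obtain B where B: "\<And>h z. \<lbrakk>h holomorphic_on {z. 0 < 1 * Im z};
      \<And>z. z \<in> {z. 0 < 1 * Im z} \<Longrightarrow> h z \<noteq> a \<and> h z \<noteq> b; norm (h (up u)) \<le> M; z \<in> K'\<rbrakk> \<Longrightarrow> norm (h z) \<le> B"
    using omitting_bounded_on_compact[OF open_half _ _ a_neq_b K' sub, of "up u" M] by metis
  have up: "norm (fi n (up z)) = norm (fi n z)" if "z \<in> U" for n z
    using that fi_cnj[OF that, of n] by (auto simp: up_def)
  have "norm (fi (k j) z) \<le> B" if z: "z \<in> K" for j z
  proof -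
    have zU: "z \<in> U" using z K(2) by blast
    have "up z \<in> K'" using z zU by (auto simp: up_def K'_def)
    then have "norm (fi (k j) (up z)) \<le> B"
      using M[of j] fi_omits up[OF u] fi_holomorphic[of "k j"]
      by (intro B) (auto intro: holomorphic_on_subset)
    then show ?thesis using up[OF zU] by simp
  qed
  then show thesis using that by blast
qed

lemma normal_subsequence:
  assumes u: "u \<in> U" and M: "\<And>j. norm (fi (k j) u) \<le> M"
  obtains h r where "h holomorphic_on U" "strict_mono (r :: nat \<Rightarrow> nat)"
    "\<And>z. z \<in> U \<Longrightarrow> (\<lambda>j. fi (k (r j)) z) \<longlonglongrightarrow> h z"
    "\<And>K. compact K \<Longrightarrow> K \<subseteq> U \<Longrightarrow> uniform_limit K (\<lambda>j. fi (k (r j))) h sequentially"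
proof -
  have bd: "\<exists>B. \<forall>h\<in>range (\<lambda>j. fi (k j)). \<forall>z\<in>K. norm (h z) \<le> B"
    if K: "compact K" "K \<subseteq> U" for K
  proof -
    obtain B where "\<And>j z. z \<in> K \<Longrightarrow> norm (fi (k j) z) \<le> B"
      using bounded_on_compact[OF u M K] by metis
    then show ?thesis by (intro exI[of _ B]) simp
  qed
  have hol: "h holomorphic_on U" if "h \<in> range (\<lambda>j. fi (k j))" for h
    using that fi_holomorphic by auto
  obtain g r where g: "g holomorphic_on U" "strict_mono (r :: nat \<Rightarrow> nat)"
    "\<And>z. z \<in> U \<Longrightarrow> (\<lambda>n. fi (k (r n)) z) \<longlonglongrightarrow> g z"
    "\<And>K. compact K \<Longrightarrow> K \<subseteq> U \<Longrightarrow> uniform_limit K ((\<lambda>j. fi (k j)) \<circ> r) g sequentially"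
    using Montel[OF open_U hol bd order_refl] by metis
  show thesis by (rule that[OF g(1-3)]) (use g(4) in \<open>simp_all add: comp_def\<close>)
qed

lemma limit_cnj:
  assumes "\<And>z. z \<in> U \<Longrightarrow> (\<lambda>j. fi (k j) z) \<longlonglongrightarrow> h z" "z \<in> U"
  shows "h (cnj z) = cnj (h z)"
proof -
  have "(\<lambda>j. cnj (fi (k j) z)) \<longlonglongrightarrow> cnj (h z)" using assms by (intro tendsto_cnj)
  then have "(\<lambda>j. fi (k j) (cnj z)) \<longlonglongrightarrow> cnj (h z)" by (simp add: fi_cnj[OF assms(2)])
  moreover have "(\<lambda>j. fi (k j) (cnj z)) \<longlonglongrightarrow> h (cnj z)" using assms by simp
  ultimately show ?thesis using LIMSEQ_unique by blast
qed

text \<open>The identity theorem and conjugation symmetry extend \<open>G z = z\<close> to all of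
  \<open>U\<close>. Two nonreal points with the same image have equal iterates from then on, hence
  equal limits.\<close>

lemma no_identity_limit:
  assumes r: "\<And>j. m j \<ge> 1" and G: "\<And>z. z \<in> U \<Longrightarrow> (\<lambda>j. fi (m j) z) \<longlonglongrightarrow> G z" "G holomorphic_on U"
    and V: "open V" "V \<noteq> {}" "V \<subseteq> U" "\<And>z. z \<in> V \<Longrightarrow> G z = z"
  shows False
proof -
  obtain v where v: "v \<in> V" using V(2) by blast
  then have Imv: "Im v \<noteq> 0" using V(3) by auto
  define Hv where "Hv = {z. 0 < Im v * Im z}"
  have sub: "Hv \<subseteq> U" by (auto simp: Hv_def)
  have Hv: "open Hv" "connected Hv" unfolding Hv_def by (rule open_half, rule convex_connected[OF
      convex_half])
  have G1: "G z = z" if "z \<in> Hv" for z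
  proof (rule analytic_continuation_open[of "V \<inter> Hv" Hv G "\<lambda>z. z"])
    show "V \<inter> Hv \<noteq> {}" using v Imv by (auto simp: Hv_def zero_less_mult_iff)
    show "G holomorphic_on Hv" using G(2) sub by (rule holomorphic_on_subset)
  qed (use V Hv that in \<open>auto intro!: holomorphic_intros\<close>)
  have G2: "G z = z" if "z \<in> U" for z
  proof (cases "z \<in> Hv")
    case False
    then have "Im v * Im z < 0" using that Imv by (auto simp: Hv_def not_less le_less)
    then have "cnj z \<in> Hv" by (simp add: Hv_def)
    then have "G (cnj z) = cnj z" by (rule G1)
    then show ?thesis using limit_cnj[OF G(1) that] by simp
  qed (rule G1)
  obtain z1 z2 y where z: "Im z1 \<noteq> 0" "Im z2 \<noteq> 0" "z1 \<noteq> z2" "f (Some z1) = Some y" "f (Some z2) =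
      Some y"
    by (rule noninjective_nonreal)
  have "fi (m j) z1 = fi (m j) z2" for j
  proof -
    obtain n where n: "m j = Suc n" using r[of j] by (cases "m j") auto
    have "(f ^^ m j) (Some z1) = (f ^^ m j) (Some z2)" unfolding n funpow_Suc_right comp_def using
        z by simp
    then show ?thesis by (simp add: fi_def)
  qed
  then have "G z1 = G z2" using G(1)[of z1] G(1)[of z2] z LIMSEQ_unique by auto
  then show False using G2 z by simp
qed

text \<open>A nonconstant limit is open, hence takes a nonreal value \<open>y\<close>. Iterating for
  the difference of two successive exponents \<open>k j\<close> moves points near \<open>y\<close>
  by less and less, so the identity becomes a limit there.\<close>

lemma limit_constant:
  assumes k: "strict_mono (k :: nat \<Rightarrow> nat)" and h: "h holomorphic_on U"
    and lim: "\<And>z. z \<in> U \<Longrightarrow> (\<lambda>j. fi (k j) z) \<longlonglongrightarrow> h z"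
  shows "\<exists>c. \<forall>z. Im z > 0 \<longrightarrow> h z = c"
proof (rule ccontr)
  assume nc: "\<nexists>c. \<forall>z. Im z > 0 \<longrightarrow> h z = c"
  define H where "H = {z. 0 < 1 * Im z}"
  have H: "open H" "connected H" "H \<subseteq> U" unfolding H_def
    by (rule open_half, rule convex_connected[OF convex_half], auto)
  have hH: "h holomorphic_on H" using h H(3) by (rule holomorphic_on_subset)
  have nch: "\<not> h constant_on H" using nc unfolding constant_on_def H_def by auto
  have oh: "open (h ` V)" if "open V" "V \<subseteq> H" for V
    using open_mapping_thm[OF hH H(1,2) that nch] .
  have "\<i> \<in> H" by (simp add: H_def)
  then have "h \<i> \<in> h ` H" by blast
  then obtain e0 where e0: "e0 > 0" "ball (h \<i>) e0 \<subseteq> h ` H" using oh[OF H(1)] by (meson order_refl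
      openE)
  have "\<exists>y\<in>ball (h \<i>) e0. Im y \<noteq> 0"
  proof (cases "Im (h \<i>) = 0")
    case True
    then show ?thesis using e0(1)
      by (intro bexI[of _ "h \<i> + of_real (e0 / 2) * \<i>"]) (auto simp: dist_norm norm_mult)
  qed (use e0(1) in auto)
  then obtain w where w: "w \<in> H" "Im (h w) \<noteq> 0" using e0(2) by blast
  define y where "y = h w"
  have yU: "y \<in> U" using w by (simp add: y_def)
  obtain e where e: "e > 0" "ball y e \<subseteq> U" using open_U yU by (meson openE)
  have wU: "w \<in> U" using w H by blast
  have limw: "(\<lambda>j. fi (k j) w) \<longlonglongrightarrow> y" using lim[OF wU] by (simp add: y_def)
  \<comment> \<open>The waiting time between consecutive visits of the orbit of \<open>w\<close>
    near \<open>y\<close>.\<close>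
  define m where "m = (\<lambda>j. k (Suc j) - k j)"
  have m: "m j \<ge> 1" "k (Suc j) = m j + k j" for j
    using strict_monoD[OF k, of j "Suc j"] by (auto simp: m_def)
  obtain B where B: "B > 0"
    "\<And>h z0 \<rho> z. \<lbrakk>\<rho> > 0; h holomorphic_on ball z0 \<rho>; \<And>z. z \<in> ball z0 \<rho> \<Longrightarrow> h z \<noteq> a \<and> h z \<noteq> b;
       norm (h z0) \<le> norm y + 1; norm (z - z0) \<le> \<rho> / 2\<rbrakk> \<Longrightarrow> norm (h z) \<le> B"
    using schottky_ball[OF a_neq_b, of "norm y + 1"] by metis
  have "\<forall>\<^sub>F j in sequentially. dist (fi (k j) w) y < min 1 (e / 4)"
    using limw e(1) by (intro tendstoD) auto
  then obtain N where N: "\<And>j. j \<ge> N \<Longrightarrow> dist (fi (k j) w) y < min 1 (e / 4)"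
    by (auto simp: eventually_sequentially)
  \<comment> \<open>The bound is obtained at the nearby orbit point \<open>v\<close>, whose image
    under \<open>fi (m (N + j))\<close> is the next visit and lies within 1 of \<open>y\<close>;
    Schottky on a ball about \<open>v\<close> transfers it to \<open>y\<close>.\<close>
  have bd: "norm (fi (m (N + j)) y) \<le> B" for j
  proof -
    define v where "v = fi (k (N + j)) w"
    have v: "norm (v - y) < e / 4" using N[of "N + j"] by (simp add: v_def dist_norm)
    have sub: "ball v (e / 2) \<subseteq> U"
    proof
      fix x assume "x \<in> ball v (e / 2)"
      then have "dist y x < e" using v dist_triangle[of y x v] e(1) by (simp add: dist_norm
          norm_minus_commute)
      then show "x \<in> U" using e(2) by auto
    qed
    have vU: "v \<in> U" using sub e(1) by (meson centre_in_ball half_gt_zero subsetD)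
    have "fi (m (N + j)) v = fi (k (Suc (N + j))) w"
      using fi_fi[OF wU, of "k (N + j)" "m (N + j)"] vU by (simp add: v_def m(2))
    then have "dist (fi (m (N + j)) v) y < 1" using N[of "Suc (N + j)"] by simp
    then have "norm (fi (m (N + j)) v) \<le> norm y + 1"
      using norm_triangle_sub[of "fi (m (N + j)) v" y] by (simp add: dist_norm)
    then show ?thesis
      using v e(1) sub fi_omits
      by (intro B(2)[of "e / 2" _ v]) (auto simp: norm_minus_commute intro:
          holomorphic_on_subset[OF fi_holomorphic])
  qed
  obtain G r where G: "G holomorphic_on U" "strict_mono (r :: nat \<Rightarrow> nat)"
    "\<And>z. z \<in> U \<Longrightarrow> (\<lambda>j. fi (m (N + r j)) z) \<longlonglongrightarrow> G z"
    "\<And>K. compact K \<Longrightarrow> K \<subseteq> U \<Longrightarrow> uniform_limit K (\<lambda>j. fi (m (N + r j))) G sequentially"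
  proof (rule normal_subsequence[of y "\<lambda>j. m (N + j)" B])
    fix G and r :: "nat \<Rightarrow> nat"
    assume "G holomorphic_on U" "strict_mono r"
      "\<And>z. z \<in> U \<Longrightarrow> (\<lambda>j. fi (m (N + r j)) z) \<longlonglongrightarrow> G z"
      "\<And>K. compact K \<Longrightarrow> K \<subseteq> U \<Longrightarrow> uniform_limit K (\<lambda>j. fi (m (N + r j))) G sequentially"
    then show thesis by (rule that)
  qed (use yU bd in auto)
  \<comment> \<open>Values of \<open>h\<close> close to \<open>y\<close>, each of them the limit of
    an orbit along the times \<open>k j\<close>.\<close>
  define V where "V = h ` (H \<inter> h -` ball y (e / 2))"
  have "open (H \<inter> h -` ball y (e / 2))"
    using continuous_open_preimage[OF holomorphic_on_imp_continuous_on[OF hH] H(1) open_ball] .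
  then have oV: "open V" unfolding V_def by (intro oh) auto
  have yV: "y \<in> V" unfolding V_def using w(1) e(1) by (auto simp: y_def)
  have VU: "V \<subseteq> U" unfolding V_def using e by (auto simp: subset_iff)
  have "G x = x" if xV: "x \<in> V" for x
  proof -
    obtain w' where w': "w' \<in> H" "x = h w'" "dist y x < e / 2" using xV by (auto simp: V_def)
    have w'U: "w' \<in> U" using w'(1) H by blast
    define x' where "x' = (\<lambda>j. fi (k (N + r j)) w')"
    have sm: "strict_mono (\<lambda>j. N + r j)" "strict_mono (\<lambda>j. Suc (N + r j))"
      using G(2) by (auto simp: strict_mono_def)
    have x': "x' \<longlonglongrightarrow> x"
      using LIMSEQ_subseq_LIMSEQ[OF lim[OF w'U] sm(1)] by (simp add: x'_def w'(2) comp_def)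
    have x'': "(\<lambda>j. fi (k (Suc (N + r j))) w') \<longlonglongrightarrow> x"
      using LIMSEQ_subseq_LIMSEQ[OF lim[OF w'U] sm(2)] by (simp add: w'(2) comp_def)
    have cb: "cball x (e / 4) \<subseteq> U"
    proof
      fix v assume "v \<in> cball x (e / 4)"
      then have "dist y v < e" using w'(3) dist_triangle[of y v x] e(1) by simp
      then show "v \<in> U" using e(2) by auto
    qed
    have ul: "uniform_limit (cball x (e / 4)) (\<lambda>j. fi (m (N + r j))) G sequentially"
      by (rule G(4)[OF compact_cball cb])
    have ev: "\<forall>\<^sub>F j in sequentially. x' j \<in> cball x (e / 4)"
      using tendstoD[OF x', of "e / 4"] e(1) by (auto simp: dist_commute elim: eventually_mono)
    have xU: "x \<in> U" using cb e(1) by (meson centre_in_cball less_eq_real_def subsetD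
        zero_less_divide_iff zero_less_numeral)
    have "isCont G x"
      using holomorphic_on_imp_continuous_on[OF G(1)] open_U xU
      by (simp add: continuous_on_eq_continuous_at)
    then have "(\<lambda>j. G (x' j)) \<longlonglongrightarrow> G x" using x' by (rule isCont_tendsto_compose)
    \<comment> \<open>The argument \<open>x' j\<close> moves with \<open>j\<close>, so uniform
      convergence near \<open>x\<close> is required here.\<close>
    moreover have "(\<lambda>j. dist (fi (m (N + r j)) (x' j)) (G (x' j))) \<longlonglongrightarrow> 0"
    proof (rule tendstoI)
      fix \<epsilon> :: real assume "\<epsilon> > 0"
      then have "\<forall>\<^sub>F j in sequentially. \<forall>v\<in>cball x (e / 4). dist (fi (m (N + r j)) v) (G v) < \<epsilon>"
        by (rule uniform_limitD[OF ul])
      with ev show "\<forall>\<^sub>F j in sequentially. dist (dist (fi (m (N + r j)) (x' j)) (G (x' j))) 0 < \<epsilon>"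
        by eventually_elim auto
    qed
    then have "(\<lambda>j. fi (m (N + r j)) (x' j) - G (x' j)) \<longlonglongrightarrow> 0"
      by (simp add: dist_norm tendsto_norm_zero_iff)
    ultimately have "(\<lambda>j. G (x' j) + (fi (m (N + r j)) (x' j) - G (x' j))) \<longlonglongrightarrow> G x + 0"
      by (rule tendsto_add)
    then have "(\<lambda>j. fi (m (N + r j)) (x' j)) \<longlonglongrightarrow> G x" by simp
    moreover have "\<forall>\<^sub>F j in sequentially. fi (m (N + r j)) (x' j) = fi (k (Suc (N + r j))) w'"
      using ev
    proof eventually_elim
      case (elim j)
      then have "x' j \<in> U" using cb by blast
      then show ?case using fi_fi[OF w'U, of "k (N + r j)" "m (N + r j)"] by (simp add: x'_def m(2))
    qed
    ultimately have "(\<lambda>j. fi (k (Suc (N + r j))) w') \<longlonglongrightarrow> G x" by (rule Lim_transform_eventually)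
    then show ?thesis using x'' LIMSEQ_unique by blast
  qed
  then show False using no_identity_limit[of "\<lambda>j. m (N + r j)" G V] m(1) G oV yV VU by blast
qed

text \<open>The limit is one constant on the upper half-plane and its conjugate on the lower. Since
  \<open>f\<close> commutes with its iterates, it sends such a constant to itself or to its
  conjugate; the constant has period at most 2, hence is real and fixed.\<close>

lemma limit_point_fixed:
  assumes real: "only_real_periodic_points f" and w: "w \<in> U" and k: "strict_mono (k :: nat \<Rightarrow> nat)"
    and lim: "(\<lambda>j. fi (k j) w) \<longlonglongrightarrow> c"
  shows "f (Some c) = Some c \<and> Im c = 0 \<and>
    (\<exists>r. strict_mono (r :: nat \<Rightarrow> nat) \<and> (\<forall>z\<in>U. (\<lambda>j. fi (k (r j)) z) \<longlonglongrightarrow> c))"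
proof -
  have "Bseq (\<lambda>j. fi (k j) w)" using lim convergentI convergent_imp_Bseq by blast
  then obtain M where M: "\<And>j. norm (fi (k j) w) \<le> M" unfolding Bseq_def by blast
  obtain h r where h: "h holomorphic_on U" "strict_mono (r :: nat \<Rightarrow> nat)"
    "\<And>z. z \<in> U \<Longrightarrow> (\<lambda>j. fi (k (r j)) z) \<longlonglongrightarrow> h z"
  proof (rule normal_subsequence[of w k M])
    fix h and r :: "nat \<Rightarrow> nat"
    assume "h holomorphic_on U" "strict_mono r" "\<And>z. z \<in> U \<Longrightarrow> (\<lambda>j. fi (k (r j)) z) \<longlonglongrightarrow> h z"
    then show thesis by (rule that)
  qed (use w M in auto)
  have kr: "strict_mono (\<lambda>j. k (r j))" using strict_mono_o[OF k h(2)] by (simp add: comp_def)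
  obtain c' where c': "\<And>z. Im z > 0 \<Longrightarrow> h z = c'" using limit_constant[OF kr h(1,3)] by blast
  have hc: "h z = c' \<or> h z = cnj c'" if "z \<in> U" for z
  proof (cases "Im z > 0")
    case False
    then have "h (cnj z) = c'" using that by (intro c') auto
    then have "cnj (h z) = c'" using limit_cnj[OF h(3) that] by simp
    then show ?thesis by auto
  qed (use c' in simp)
  \<comment> \<open>A step of \<open>f\<close> that stays nonreal: the limit \<open>h\<close> is
    available at both ends.\<close>
  obtain z1 y0 where z1: "z1 \<in> U" "y0 \<in> U" "f (Some z1) = Some y0"
    using noninjective_nonreal by (metis U_iff)
  have "sconv (\<lambda>j. f (Some (fi (k (r j)) z1))) (f (Some (h z1)))"
    by (rule sconv_map[OF rat]) (use h(3)[OF z1(1)] in \<open>simp add: sconv_Some_iff\<close>)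
  moreover have "f (Some (fi n z1)) = Some (fi n y0)" for n
  proof -
    have "f (Some (fi n z1)) = f ((f ^^ n) (Some z1))" by (simp add: fi[OF z1(1)])
    also have "\<dots> = (f ^^ n) (f (Some z1))" by (simp add: funpow_swap1)
    finally show ?thesis by (simp add: z1(3) fi[OF z1(2)])
  qed
  moreover have "sconv (\<lambda>j. Some (fi (k (r j)) y0)) (Some (h y0))"
    using h(3)[OF z1(2)] by (simp add: sconv_Some_iff)
  ultimately have eq: "f (Some (h z1)) = Some (h y0)" using sconv_unique by simp
  define v where "v = h z1"
  have "h y0 = v \<or> h y0 = cnj v" using hc[OF z1(1)] hc[OF z1(2)] by (auto simp: v_def)
  then have fv: "f (Some v) = Some v \<or> f (Some v) = Some (cnj v)" using eq by (auto simp: v_def)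
  moreover have "f (Some (cnj v)) = map_option cnj (f (Some v))"
    using rational_map_cnj[OF rat, of "Some v"] by simp
  ultimately have "(f ^^ 2) (Some v) = Some v" by (auto simp: numeral_2_eq_2)
  then have "Some v \<in> real_points"
    using real unfolding only_real_periodic_points_def by (metis one_le_numeral)
  then have Imv: "Im v = 0" by simp
  then have cv: "cnj v = v" by (simp add: complex_eq_iff)
  then have "c' = v" using hc[OF z1(1)] by (metis complex_cnj_cnj v_def)
  then have hv: "h z = v" if "z \<in> U" for z using hc[OF that] cv by auto
  have "(\<lambda>j. fi (k (r j)) w) \<longlonglongrightarrow> c" using LIMSEQ_subseq_LIMSEQ[OF lim h(2)] by (simp add: comp_def)
  then have "c = v" using h(3)[OF w] hv[OF w] LIMSEQ_unique by auto
  then show ?thesis using fv Imv cv h(2,3) hv by auto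
qed

text \<open>The orbit of the imaginary unit can accumulate only at infinity or at finite fixed
  points, so it converges; normality then makes every nonreal orbit follow it.\<close>

lemma orbits_converge:
  assumes real: "only_real_periodic_points f"
  obtains c where "f c = c" "c \<in> real_points" "\<And>w. w \<in> U \<Longrightarrow> sconv (\<lambda>n. (f ^^ n) (Some w)) c"
proof -
  have iU: "\<i> \<in> U" by simp
  define E' where "E' = {z. f z = z}"
  have finE: "finite E'" unfolding E'_def by (rule rational_map_finite_fixed[OF rat d2])
  have NE: "None \<in> E'" using f_None by (simp add: E'_def)
  have ev: "\<forall>\<^sub>F n in sequentially. \<exists>c\<in>E'. (f ^^ n) (Some \<i>) \<in> disc c e" if e: "e > 0" for e
  proof (rule ccontr)
    assume "\<not> (\<forall>\<^sub>F n in sequentially. \<exists>c\<in>E'. (f ^^ n) (Some \<i>) \<in> disc c e)"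
    then obtain k where k: "strict_mono (k :: nat \<Rightarrow> nat)" "\<And>j. \<not> (\<exists>c\<in>E'. (f ^^ k j) (Some \<i>) \<in>
        disc c e)"
      by (rule frequently_strict_mono) blast
    have out: "Some (fi (k j) \<i>) \<notin> disc c e" if "c \<in> E'" for j c
      using k(2)[of j] that fi[OF iU, of "k j"] by auto
    have "norm (fi (k j) \<i>) \<le> 1 / e" for j
      using out[OF NE, of j] e by (simp add: field_simps)
    then have "bounded (range (\<lambda>j. fi (k j) \<i>))" unfolding bounded_iff by blast
    then obtain l s where s: "strict_mono (s :: nat \<Rightarrow> nat)" "(\<lambda>j. fi (k (s j)) \<i>) \<longlonglongrightarrow> l"
      using bounded_imp_convergent_subsequence[of "\<lambda>j. fi (k j) \<i>"] by (auto simp: comp_def)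
    have "strict_mono (\<lambda>j. k (s j))" using strict_mono_o[OF k(1) s(1)] by (simp add: comp_def)
    from limit_point_fixed[OF real iU this s(2)] have lE: "Some l \<in> E'" by (simp add: E'_def)
    have "\<forall>\<^sub>F j in sequentially. dist (fi (k (s j)) \<i>) l < e" using s(2) e by (rule tendstoD)
    then have "\<exists>j. dist (fi (k (s j)) \<i>) l < e"
      using eventually_happens trivial_limit_sequentially by blast
    then show False using out[OF lE] by (auto simp: dist_norm)
  qed
  obtain c where c: "c \<in> E'" "sconv (\<lambda>n. (f ^^ n) (Some \<i>)) c"
  proof (rule orbit_converges[OF rat finE, of "\<lambda>n. (f ^^ n) (Some \<i>)"])
    show "f c = c" if "c \<in> E'" for c using that by (simp add: E'_def)
  qed (use ev in \<open>auto intro: that\<close>)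
  have fc: "f c = c" using c(1) by (simp add: E'_def)
  have "(f ^^ 1) c = c" using fc by simp
  then have cr: "c \<in> real_points" using real unfolding only_real_periodic_points_def by blast
  \<comment> \<open>For \<open>c\<close> infinite, a bounded subsequence at \<open>w\<close> would
    be bounded at the imaginary unit too. For \<open>c\<close> finite, every subsequence has a
    further one converging to \<open>c\<close> on all of \<open>U\<close>.\<close>
  have "sconv (\<lambda>n. (f ^^ n) (Some w)) c" if w: "w \<in> U" for w
  proof (cases c)
    case None
    show ?thesis unfolding sconv_def None
    proof (intro allI impI, rule ccontr)
      fix e :: real assume e: "e > 0" and "\<not> (\<forall>\<^sub>F n in sequentially. (f ^^ n) (Some w) \<in> disc None e)"
      then obtain k where k: "strict_mono (k :: nat \<Rightarrow> nat)" "\<And>j. (f ^^ k j) (Some w) \<notin> disc None e"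
        using frequently_strict_mono by blast
      have "norm (fi (k j) w) \<le> 1 / e" for j
        using k(2)[of j] fi[OF w, of "k j"] e by (simp add: field_simps)
      then obtain B where B: "\<And>j z. z \<in> {\<i>} \<Longrightarrow> norm (fi (k j) z) \<le> B"
        using bounded_on_compact[OF w, of k "1 / e" "{\<i>}"] by auto
      define e1 where "e1 = 1 / (\<bar>B\<bar> + 1)"
      have e1: "e1 > 0" by (simp add: e1_def add_nonneg_pos)
      have "\<forall>\<^sub>F j in sequentially. (f ^^ k j) (Some \<i>) \<in> disc None e1"
        using sconv_subseq[OF c(2) k(1)] e1 None by (simp add: sconv_def)
      then have "\<exists>j. (f ^^ k j) (Some \<i>) \<in> disc None e1"
        using eventually_happens trivial_limit_sequentially by blast
      then obtain j where "1 < e1 * norm (fi (k j) \<i>)" by (auto simp: fi[OF iU])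
      then have "\<bar>B\<bar> + 1 < norm (fi (k j) \<i>)" by (simp add: e1_def field_simps)
      then show False using B[of \<i> j] by simp
    qed
  next
    case (Some x)
    have "(\<lambda>n. fi n w) \<longlonglongrightarrow> x"
    proof (rule tendstoI, rule ccontr)
      fix e :: real assume e: "e > 0" and "\<not> (\<forall>\<^sub>F n in sequentially. dist (fi n w) x < e)"
      then obtain k where k: "strict_mono (k :: nat \<Rightarrow> nat)" "\<And>j. \<not> dist (fi (k j) w) x < e"
        using frequently_strict_mono by blast
      have "(\<lambda>n. fi n \<i>) \<longlonglongrightarrow> x" using c(2) by (simp add: Some fi[OF iU] sconv_Some_iff)
      then have "(\<lambda>j. fi (k j) \<i>) \<longlonglongrightarrow> x" using LIMSEQ_subseq_LIMSEQ[OF _ k(1)] by (force simp: comp_def)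
      then obtain r where "strict_mono (r :: nat \<Rightarrow> nat)" "(\<lambda>j. fi (k (r j)) w) \<longlonglongrightarrow> x"
        using limit_point_fixed[OF real iU k(1)] w by blast
      then have "\<forall>\<^sub>F j in sequentially. dist (fi (k (r j)) w) x < e" using e by (intro tendstoD)
      then show False using k(2) by simp
    qed
    then show ?thesis by (simp add: Some fi[OF w] sconv_Some_iff)
  qed
  then show thesis using that fc cr by blast
qed

text \<open>Only countably many points ever land on \<open>c\<close>. Such an orbit is what later
  excludes a repelling \<open>c\<close>, which can attract only orbits that land on it.\<close>

lemma nonlanding_orbit:
  obtains w where "w \<in> U" "\<And>n. (f ^^ n) (Some w) \<noteq> c"
proof -
  have "finite {w. (f ^^ n) (Some w) = c}" for n
  proof -
    have "d ^ n \<ge> 1" using d2 by simp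
    from rational_map_finite_preimage[OF rat_funpow this, of c]
    have "finite (Some -` {z. (f ^^ n) z = c})" by (rule finite_vimageI) simp
    then show ?thesis by (simp add: vimage_def)
  qed
  then have cnt: "countable (\<Union>n. {w. (f ^^ n) (Some w) = c})"
    by (intro countable_UN) (auto intro: countable_finite)
  have "ball \<i> 1 \<subseteq> U"
  proof
    fix x assume "x \<in> ball \<i> 1"
    then have "\<bar>Im (\<i> - x)\<bar> < 1" using abs_Im_le_cmod[of "\<i> - x"] by (simp add: dist_norm)
    then show "x \<in> U" by auto
  qed
  moreover have "uncountable (ball \<i> 1)" by (rule uncountable_ball) simp
  ultimately have "uncountable U" using countable_subset by blast
  then have "\<not> U \<subseteq> (\<Union>n. {w. (f ^^ n) (Some w) = c})" using cnt countable_subset by blast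
  then show thesis using that by blast
qed

text \<open>At a nonreal periodic point \<open>w\<close>, a sequence of iterates fixing
  \<open>w\<close> has a limit \<open>h\<close> with \<open>h w = w\<close>. On the captured open
  set \<open>h\<close> equals the real point \<open>z1\<close>, so the identity theorem gives
  \<open>h w = z1\<close>.\<close>

lemma only_real_if_captured:
  assumes z1: "z1 \<in> real_points" and m: "m \<ge> 1"
    and P0: "open P0" "P0 \<noteq> {}" "\<And>u. u \<in> P0 \<Longrightarrow> sconv (\<lambda>n. (f ^^ (m * n)) (Some u)) z1"
  shows "only_real_periodic_points f"
  unfolding only_real_periodic_points_def
proof (intro allI impI, rule ccontr)
  fix k z assume k: "1 \<le> k" "(f ^^ k) z = z" and "z \<notin> real_points"
  then obtain w where w: "z = Some w" "w \<in> U" by (cases z) auto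
  have "(f ^^ (k * n)) (Some w) = Some w" for n
    using k(2) w(1) by (induction n) (auto simp: funpow_add)
  \<comment> \<open>Exponents are multiples of \<open>k\<close>, to return to \<open>w\<close>, and
    of \<open>m\<close>, to follow the captured orbits.\<close>
  then have fw: "fi (m * (k * n)) w = w" for n
    by (metis fi_def mult.left_commute option.sel)
  obtain h r where h: "h holomorphic_on U" "strict_mono (r :: nat \<Rightarrow> nat)"
    "\<And>z. z \<in> U \<Longrightarrow> (\<lambda>j. fi (m * (k * r j)) z) \<longlonglongrightarrow> h z"
  proof (rule normal_subsequence[of w "\<lambda>j. m * (k * j)" "norm w"])
    fix h and r :: "nat \<Rightarrow> nat"
    assume "h holomorphic_on U" "strict_mono r"
      "\<And>z. z \<in> U \<Longrightarrow> (\<lambda>j. fi (m * (k * r j)) z) \<longlonglongrightarrow> h z"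
    then show thesis by (rule that)
  qed (use w(2) fw in auto)
  have "(\<lambda>j. w) \<longlonglongrightarrow> h w" using h(3)[OF w(2)] by (simp only: fw)
  from LIMSEQ_unique[OF this tendsto_const] have hw: "h w = w" .
  define Hw where "Hw = {z. 0 < Im w * Im z}"
  have Hw: "open Hw" "connected Hw" "Hw \<subseteq> U" unfolding Hw_def
    by (rule open_half, rule convex_connected[OF convex_half], auto)
  \<comment> \<open>The captured set may lie in the other half-plane; reflection provides a part on
    the side of \<open>w\<close>.\<close>
  define P' where "P' = Hw \<inter> (P0 \<union> cnj -` P0)"
  have "open (cnj -` P0)" using P0(1) by (intro open_vimage continuous_intros)
  then have oP': "open P'" unfolding P'_def using P0(1) Hw(1) by blast
  have "\<exists>u\<in>P0. Im u \<noteq> 0"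
  proof -
    obtain u e where u: "u \<in> P0" "e > 0" "ball u e \<subseteq> P0" using P0(1,2) by (meson ex_in_conv openE)
    show ?thesis
    proof (cases "Im u = 0")
      case True
      have "u + of_real (e / 2) * \<i> \<in> ball u e" using u(2) by (simp add: dist_norm norm_mult)
      then show ?thesis using u True by (intro bexI[of _ "u + of_real (e / 2) * \<i>"]) auto
    qed (use u in blast)
  qed
  then obtain u where u: "u \<in> P0" "Im u \<noteq> 0" by blast
  have neP': "P' \<noteq> {}"
  proof (cases "Im w * Im u > 0")
    case True
    then have "u \<in> P'" using u by (simp add: P'_def Hw_def)
    then show ?thesis by blast
  next
    case False
    then have "Im w * Im u < 0" using u(2) w(2) by (auto simp: not_less le_less)
    then have "cnj u \<in> P'" using u by (simp add: P'_def Hw_def)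
    then show ?thesis by blast
  qed
  have conv: "sconv (\<lambda>n. (f ^^ (m * n)) (Some v)) z1" if "v \<in> P'" for v
  proof (cases "v \<in> P0")
    case False
    then have "cnj v \<in> P0" using that by (simp add: P'_def)
    from sconv_cnj[OF P0(3)[OF this]]
    have "sconv (\<lambda>n. map_option cnj ((f ^^ (m * n)) (Some (cnj v)))) z1"
      using z1 by (simp add: real_points_iff)
    then show ?thesis using rational_map_cnj[OF rat_funpow, of _ "Some (cnj v)"] by simp
  qed (rule P0(3))
  have z1h: "z1 = Some (h v)" if v: "v \<in> P'" for v
  proof -
    have vU: "v \<in> U" using v Hw(3) by (auto simp: P'_def)
    have "strict_mono (\<lambda>j. k * r j)" using h(2) k(1) by (simp add: strict_mono_def)
    from sconv_subseq[OF conv[OF v] this]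
    have "sconv (\<lambda>j. Some (fi (m * (k * r j)) v)) z1" by (simp add: fi[OF vU])
    moreover have "sconv (\<lambda>j. Some (fi (m * (k * r j)) v)) (Some (h v))"
      using h(3)[OF vU] by (simp add: sconv_Some_iff)
    ultimately show ?thesis using sconv_unique by blast
  qed
  obtain v where "v \<in> P'" using neP' by blast
  then obtain c where c: "z1 = Some c" using z1h by blast
  have "h w = c"
  proof (rule analytic_continuation_open[OF oP' Hw(1) neP' Hw(2), of h "\<lambda>_. c"])
    show "h holomorphic_on Hw" using h(1) Hw(3) by (rule holomorphic_on_subset)
    show "w \<in> Hw" using w(2) by (auto simp: Hw_def zero_less_mult_iff)
  qed (use z1h c in \<open>auto simp: P'_def\<close>)
  then show False using hw w(2) z1 c by simp
qed

end

section \<open>Index formula and prepoles\<close>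

text \<open>Lagrange interpolation of \<open>T\<close> at the simple roots of \<open>R\<close>; the
  sum is read off by comparing coefficients of degree \<open>n\<close>. Equivalently, the residues
  of \<open>T / R\<close> are summed.\<close>

lemma sum_residues_rsquarefree:
  fixes R T :: "complex poly"
  assumes R: "rsquarefree R" "degree R = Suc n" and T: "degree T \<le> n"
  shows "(\<Sum>w | poly R w = 0. poly T w / poly (pderiv R) w) = coeff T n / lead_coeff R"
    and "card {w. poly R w = 0} = Suc n"
proof -
  define A where "A = {w. poly R w = 0}"
  have R0: "R \<noteq> 0" using R(2) by auto
  have fin: "finite A" unfolding A_def by (rule poly_roots_finite[OF R0])
  have "degree (\<Prod>z\<in>A. [:-z, 1:]) = (\<Sum>z\<in>A. degree [:-z, 1:])"
    by (intro degree_prod_eq_sum_degree) auto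
  moreover have "degree (smult (lead_coeff R) (\<Prod>z\<in>A. [:-z, 1:])) = Suc n"
    using complex_poly_decompose_rsquarefree[OF R(1)] R(2) by (simp add: A_def)
  ultimately have card: "card A = Suc n" using R0 by simp
  then show "card {w. poly R w = 0} = Suc n" by (simp add: A_def)
  have "\<exists>S. R = [:-w, 1:] * S" if "w \<in> A" for w
  proof -
    have "[:-w, 1:] dvd R" using that unfolding A_def by (simp only: mem_Collect_eq poly_eq_0_iff_dvd)
    then show ?thesis by (elim dvdE) blast
  qed
  then obtain S where S: "\<And>w. w \<in> A \<Longrightarrow> R = [:-w, 1:] * S w" by metis
  have pR: "poly (pderiv R) w = poly (S w) w" if w: "w \<in> A" for w
  proof -
    have "pderiv [:- w, 1:] = 1" by (simp add: pderiv_pCons)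
    then have "pderiv R = [:- w, 1:] * pderiv (S w) + S w"
      by (subst S[OF w]) (simp only: pderiv_mult mult_1_right)
    then have "poly (pderiv R) w = poly [:- w, 1:] w * poly (pderiv (S w)) w + poly (S w) w"
      by (simp only: poly_add poly_mult)
    moreover have "poly [:- w, 1:] w = 0" by simp
    ultimately show ?thesis by (simp only: mult_zero_left add_0)
  qed
  have nz: "poly (pderiv R) w \<noteq> 0" if "w \<in> A" for w
    using R(1) that unfolding rsquarefree_roots A_def by blast
  have Sv: "poly (S w) v = 0" if "w \<in> A" "v \<in> A" "v \<noteq> w" for v w
  proof -
    have "poly ([:-w, 1:] * S w) v = 0" using S[OF that(1)] that(2) by (simp add: A_def)
    then show ?thesis using that(3) by simp
  qed
  have dS: "degree (S w) = n" if w: "w \<in> A" for w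
  proof -
    have "S w \<noteq> 0" using S[OF w] R0 by auto
    then have "degree ([:-w, 1:] * S w) = 1 + degree (S w)" by (subst degree_mult_eq) auto
    then show ?thesis using S[OF w] R(2) by simp
  qed
  have cS: "coeff (S w) n = lead_coeff R" if w: "w \<in> A" for w
  proof -
    have "coeff R (Suc n) = coeff ([:-w, 1:] * S w) (Suc n)" using S[OF w] by simp
    also have "\<dots> = coeff (S w) n" using dS[OF w] by (simp add: coeff_eq_0)
    finally show ?thesis using R(2) by simp
  qed
  \<comment> \<open>The interpolant, with \<open>S w\<close> the cofactor \<open>R / (X - w)\<close>
    and \<open>poly (pderiv R) w\<close> its value at \<open>w\<close>.\<close>
  define L where "L = (\<Sum>w\<in>A. smult (poly T w / poly (pderiv R) w) (S w))"
  have "T = L"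
  proof (rule poly_eqI_degree[where A = A])
    fix v assume v: "v \<in> A"
    have "poly L v = (\<Sum>w\<in>A. if w = v then poly T v else 0)"
      unfolding L_def poly_sum
    proof (rule sum.cong)
      fix w assume w: "w \<in> A"
      show "poly (smult (poly T w / poly (pderiv R) w) (S w)) v = (if w = v then poly T v else 0)"
        using Sv[OF w v] pR[OF w] nz[OF w] by (cases "w = v") simp_all
    qed simp
    then show "poly T v = poly L v" using v fin by simp
  next
    show "degree T < card A" using T card by simp
    have "degree L \<le> n" unfolding L_def
      using fin dS by (intro degree_sum_le order_trans[OF degree_smult_le]) auto
    then show "degree L < card A" using card by simp
  qed
  then have "coeff T n = coeff L n" by (rule arg_cong)
  also have "\<dots> = (\<Sum>w\<in>A. poly T w / poly (pderiv R) w * coeff (S w) n)"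
    by (simp add: L_def coeff_sum)
  also have "\<dots> = (\<Sum>w\<in>A. poly T w / poly (pderiv R) w) * lead_coeff R"
    using cS by (simp add: sum_distrib_right)
  finally show "(\<Sum>w | poly R w = 0. poly T w / poly (pderiv R) w) = coeff T n / lead_coeff R"
    using R0 by (simp add: A_def)
qed

text \<open>With \<open>\<mu> = 1 - l\<close> the hypothesis reads
  \<open>|\<mu>|^2 < 2 Re \<mu>\<close>, and \<open>Re (1 / \<mu>)\<close> is
  \<open>Re \<mu> / |\<mu>|^2\<close>.\<close>

lemma Re_inverse_gt_half:
  assumes "norm l < 1"
  shows "Re (1 / (1 - l)) > 1 / 2"
proof -
  define \<mu> where "\<mu> = 1 - l"
  have "norm (1 - \<mu>) < 1" using assms by (simp add: \<mu>_def)
  then have "(norm (1 - \<mu>))\<^sup>2 < 1" by (simp add: power_less_one_iff abs_square_less_1)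
  then have "(1 - Re \<mu>)\<^sup>2 + (Im \<mu>)\<^sup>2 < 1" by (simp add: cmod_power2)
  then have lt: "(Re \<mu>)\<^sup>2 + (Im \<mu>)\<^sup>2 < 2 * Re \<mu>" by (simp add: power2_eq_square algebra_simps)
  have "\<mu> \<noteq> 0" using assms by (auto simp: \<mu>_def)
  then have "(Re \<mu>)\<^sup>2 + (Im \<mu>)\<^sup>2 > 0" by (simp add: complex_neq_0)
  then have "Re (1 / \<mu>) > 1 / 2" using lt by (simp add: Re_divide field_simps)
  then show ?thesis by (simp add: \<mu>_def)
qed

text \<open>The holomorphic index formula \<open>\<Sum> 1 / (1 - \<lambda>) = 1\<close> cannot hold if all
  \<open>d + 1 \<ge> 3\<close> terms have real part greater than \<open>1 / 2\<close>.\<close>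

lemma not_all_fixed_points_attracting:
  assumes nd: "nondeg d p q" and f: "f = ratfun_map d p q" and d: "d \<ge> 2" and inf: "f None \<noteq> None"
    and attr: "\<And>w r G. f (Some w) = Some w \<Longrightarrow> local_rep f (Some w) r G \<Longrightarrow> norm (deriv G 0) < 1"
  shows False
proof -
  define P Q where "P = map_poly complex_of_real p" and "Q = map_poly complex_of_real q"
  have f_Some: "f (Some z) = proj (poly P z) (poly Q z)" for z
    unfolding f P_def Q_def by (rule ratfun_map_Some[OF nd])
  have qd: "coeff q d \<noteq> 0" using inf by (auto simp: f ratfun_map_def split: if_splits)
  have dPQ: "degree P \<le> d" "degree Q \<le> d"
    using nondegD(1,2)[OF nd] by (simp_all add: P_def Q_def degree_map_poly)
  have PQ: "\<not> (poly P z = 0 \<and> poly Q z = 0)" for z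
    unfolding P_def Q_def by (rule nondegD(4)[OF nd])
  \<comment> \<open>Its roots are the fixed points, and its degree is \<open>d + 1\<close> because
    infinity is not fixed.\<close>
  define R where "R = pCons 0 Q - P"
  have cR: "coeff R (Suc d) = of_real (coeff q d)"
    using dPQ(1) by (simp add: R_def coeff_eq_0 Q_def coeff_map_poly)
  have dR: "degree R = Suc d"
  proof (rule antisym)
    show "degree R \<le> Suc d" unfolding R_def using dPQ by (intro degree_diff_le order_trans[OF
        degree_pCons_le]) auto
    show "Suc d \<le> degree R" by (rule le_degree) (simp add: cR qd)
  qed
  have fixed: "poly Q w \<noteq> 0 \<and> f (Some w) = Some w \<and> poly P w = w * poly Q w" if "poly R w = 0" for w
  proof -
    have eq: "poly P w = w * poly Q w" using that by (simp add: R_def)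
    then have "poly Q w \<noteq> 0" using PQ[of w] by auto
    then show ?thesis using eq by (simp add: f_Some proj_def)
  qed
  \<comment> \<open>This relation turns the residue \<open>Q / R'\<close> at a fixed point into
    \<open>1 / (1 - l)\<close> and shows that all fixed points are simple.\<close>
  have mult: "\<exists>l. norm l < 1 \<and> poly (pderiv R) w = poly Q w * (1 - l)" if w: "poly R w = 0" for w
  proof -
    note fw = fixed[OF w]
    have rat: "rational_map d f" using nd f by (auto simp: rational_map_def)
    obtain r G where G: "local_rep f (Some w) r G" by (rule rational_map_local_rep[OF rat])
    define l where "l = deriv G 0"
    have "affine_deriv f w = l" unfolding l_def using affine_deriv_local_rep[OF G] fw by simp
    have "((\<lambda>z. poly P z / poly Q z) has_field_derivative
      (poly (pderiv P) w * poly Q w - poly P w * poly (pderiv Q) w) / (poly Q w * poly Q w)) (at w)"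
      using fw by (intro DERIV_divide poly_DERIV) auto
    then have "((\<lambda>u. the (f (Some u))) has_field_derivative
      (poly (pderiv P) w * poly Q w - poly P w * poly (pderiv Q) w) / (poly Q w * poly Q w)) (at w)"
    proof (rule has_field_derivative_transform_within_open)
      show "open {z. poly Q z \<noteq> 0}" by (intro open_Collect_neq continuous_intros)
    qed (use fw in \<open>auto simp: f_Some proj_def\<close>)
    then have "affine_deriv f w = (poly (pderiv P) w * poly Q w - poly P w * poly (pderiv Q) w) /
        (poly Q w * poly Q w)"
      unfolding affine_deriv_def by (rule DERIV_imp_deriv)
    then have "l * (poly Q w * poly Q w) = poly (pderiv P) w * poly Q w - w * poly Q w * poly
        (pderiv Q) w"
      using fw \<open>affine_deriv f w = l\<close> by simp
    then have "poly Q w * (l * poly Q w) = poly Q w * (poly (pderiv P) w - w * poly (pderiv Q) w)"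
      by (simp add: algebra_simps)
    then have "l * poly Q w = poly (pderiv P) w - w * poly (pderiv Q) w" using fw by simp
    then have "poly (pderiv R) w = poly Q w * (1 - l)"
      by (simp add: R_def pderiv_diff pderiv_pCons algebra_simps)
    moreover have "norm l < 1" unfolding l_def using attr[OF _ G] fw by simp
    ultimately show ?thesis by blast
  qed
  have "rsquarefree R"
    unfolding rsquarefree_roots
  proof (intro allI notI)
    fix w assume w: "poly R w = 0 \<and> poly (pderiv R) w = 0"
    then obtain l where "norm l < 1" "poly Q w * (1 - l) = 0" using mult[of w] by metis
    then show False using fixed[of w] w by auto
  qed
  note res = sum_residues_rsquarefree[OF this dR dPQ(2)]
  have "Re (poly Q w / poly (pderiv R) w) > 1 / 2" if w: "poly R w = 0" for w
  proof -
    obtain l where l: "norm l < 1" "poly (pderiv R) w = poly Q w * (1 - l)" using mult[OF w] by blast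
    have "poly Q w / poly (pderiv R) w = 1 / (1 - l)" using l(2) fixed[OF w] by simp
    then show ?thesis using Re_inverse_gt_half[OF l(1)] by simp
  qed
  then have "(\<Sum>w | poly R w = 0. Re (poly Q w / poly (pderiv R) w)) \<ge> (\<Sum>w | poly R w = 0. 1 / 2)"
    by (intro sum_mono) (auto intro: less_imp_le)
  moreover have "(\<Sum>w | poly R w = 0. poly Q w / poly (pderiv R) w) = 1"
    unfolding res(1) using cR dR qd by (simp add: Q_def coeff_map_poly)
  then have "Re (\<Sum>w | poly R w = 0. poly Q w / poly (pderiv R) w) = 1" by simp
  ultimately have "real (Suc d) * (1 / 2) \<le> 1" using res(2) by (simp add: Re_sum)
  then show False using d by simp
qed

section \<open>Nonreal points that would land on infinity\<close>

context normalized
begin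

text \<open>A backward orbit of a nonreal point stays nonreal and never repeats, since a repetition
  would be a nonreal periodic point; so it leaves the finite set of critical values.\<close>

lemma infinite_backward_orbit:
  assumes real: "only_real_periodic_points f" and u: "Im u \<noteq> 0"
  obtains k v where "(f ^^ k) (Some v) = Some u" "Im v \<noteq> 0" "v \<notin> E"
proof -
  obtain g where g: "\<And>y. f (Some (g y)) = Some y" using preimage_exists by metis
  define y where "y = (\<lambda>k. (g ^^ k) u)"
  have step: "(f ^^ m) (Some (y (m + i))) = Some (y i)" for m i
  proof (induction m)
    case (Suc m)
    have "(f ^^ Suc m) (Some (y (Suc m + i))) = (f ^^ m) (f (Some (g (y (m + i)))))"
      by (simp add: y_def funpow_swap1)
    then show ?case using g Suc by simp
  qed simp
  have Imy: "Im (y k) \<noteq> 0" for k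
  proof (induction k)
    case (Suc k)
    then show ?case using nonreal_preimage[of "g (y k)" "y k"] g by (simp add: y_def)
  qed (use u in \<open>simp add: y_def\<close>)
  have neq: "y (m + i) \<noteq> y i" if "m \<ge> 1" for m i
  proof
    assume "y (m + i) = y i"
    then have "(f ^^ m) (Some (y i)) = Some (y i)" using step[of m i] by simp
    then have "Some (y i) \<in> real_points" using real that unfolding only_real_periodic_points_def
        by blast
    then show False using Imy[of i] by simp
  qed
  have "inj y"
  proof (rule linorder_injI)
    fix i j :: nat assume "i < j"
    then have "y j \<noteq> y i" using neq[of "j - i" i] by simp
    then show "y i \<noteq> y j" by (rule not_sym)
  qed
  then have "infinite (range y)" using finite_imageD by blast
  then have "\<not> range y \<subseteq> E" using finite_E finite_subset by blast
  then obtain k where "y k \<notin> E" by blast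
  moreover have "(f ^^ k) (Some (y k)) = Some u" using step[of k 0] by (simp add: y_def)
  ultimately show thesis using that Imy by blast
qed

text \<open>Cross ratios of \<open>f\<^sup>k(z)\<close> with \<open>z\<close> and two local inverse branches at \<open>z\<close> omit
  \<open>0\<close>, \<open>1\<close> and infinity, so \<open>f\<^sup>k\<close> is equicontinuous at points that land on infinity.\<close>

lemma equicontinuous_at_prepole:
  assumes real: "only_real_periodic_points f" and u: "Im u \<noteq> 0" "u \<notin> E"
    and land: "(f ^^ n) (Some u) = None" and n: "n \<ge> 1" and e: "e > 0"
  obtains s where "s > 0" "\<And>k z. k \<ge> n \<Longrightarrow> norm (z - u) < s \<Longrightarrow> (f ^^ k) (Some z) \<in> disc None e"
proof -
  have nonper: "(f ^^ k) (Some z) \<noteq> Some z" if "Im z \<noteq> 0" "k \<ge> 1" for k z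
    using real that unfolding only_real_periodic_points_def by (metis Some_in_real_points)
  obtain \<alpha>0 \<beta>0 where ab0: "\<alpha>0 \<noteq> \<beta>0" "f (Some \<alpha>0) = Some u" "f (Some \<beta>0) = Some u"
    "poly W \<alpha>0 \<noteq> 0" "poly W \<beta>0 \<noteq> 0" by (rule two_preimages[OF u(2)])
  obtain \<rho>1 \<alpha> where \<alpha>: "\<rho>1 > 0" "\<alpha> holomorphic_on ball u \<rho>1" "\<alpha> u = \<alpha>0"
    "\<And>z. z \<in> ball u \<rho>1 \<Longrightarrow> f (Some (\<alpha> z)) = Some z" by (rule inverse_branch[OF ab0(2,4)]) (rule that)
  obtain \<rho>2 \<beta> where \<beta>: "\<rho>2 > 0" "\<beta> holomorphic_on ball u \<rho>2" "\<beta> u = \<beta>0"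
    "\<And>z. z \<in> ball u \<rho>2 \<Longrightarrow> f (Some (\<beta> z)) = Some z" by (rule inverse_branch[OF ab0(3,5)]) (rule that)
  have \<alpha>c: "isCont \<alpha> u" and \<beta>c: "isCont \<beta> u"
    using holomorphic_on_imp_continuous_on[OF \<alpha>(2)] holomorphic_on_imp_continuous_on[OF \<beta>(2)] \<alpha>(1) \<beta>(1)
    by (simp_all add: continuous_on_eq_continuous_at)
  have "isCont (\<lambda>z. \<alpha> z - \<beta> z) u" using \<alpha>c \<beta>c by (intro continuous_intros)
  moreover have "\<alpha> u - \<beta> u \<noteq> 0" using ab0(1) \<alpha>(3) \<beta>(3) by simp
  ultimately obtain \<rho>3 where \<rho>3: "\<rho>3 > 0" "\<And>z. dist u z < \<rho>3 \<Longrightarrow> \<alpha> z - \<beta> z \<noteq> 0"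
    using continuous_at_avoid[of u "\<lambda>z. \<alpha> z - \<beta> z" 0] by blast
  \<comment> \<open>The radius keeps both inverse branches defined and distinct, and the bound
    \<open>\<bar>Im u\<bar>\<close> keeps the ball off the real line.\<close>
  define \<rho> where "\<rho> = min (min \<rho>1 \<rho>2) (min \<rho>3 \<bar>Im u\<bar>)"
  have \<rho>: "\<rho> > 0" "\<rho> \<le> \<rho>1" "\<rho> \<le> \<rho>2" "\<rho> \<le> \<rho>3" "\<rho> \<le> \<bar>Im u\<bar>"
    using \<alpha>(1) \<beta>(1) \<rho>3(1) u(1) unfolding \<rho>_def by linarith+
  have ImD: "Im z \<noteq> 0" if "z \<in> ball u \<rho>" for z
  proof -
    have "\<bar>Im (u - z)\<bar> < \<bar>Im u\<bar>" using that \<rho>(5) abs_Im_le_cmod[of "u - z"] by (simp add: dist_norm)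
    then show ?thesis by auto
  qed
  have D: "f (Some (\<alpha> z)) = Some z" "f (Some (\<beta> z)) = Some z" "\<alpha> z \<noteq> \<beta> z" if "z \<in> ball u \<rho>" for z
    using \<alpha>(4)[of z] \<beta>(4)[of z] \<rho>3(2)[of z] that \<rho> by auto
  have Dz: "\<alpha> z \<noteq> z" "\<beta> z \<noteq> z" if "z \<in> ball u \<rho>" for z
    using D[OF that] nonper[OF ImD[OF that], of 1] by auto
  \<comment> \<open>Numerators and denominators of the iterates allow expressions in
    \<open>f ^^ k\<close> to be formed also at its poles.\<close>
  have "\<exists>pq. nondeg (d ^ k) (fst pq) (snd pq) \<and> f ^^ k = ratfun_map (d ^ k) (fst pq) (snd pq)" for k
    using rat_funpow[of k] unfolding rational_map_def by auto
  then obtain pq where pq: "\<And>k. nondeg (d ^ k) (fst (pq k)) (snd (pq k))"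
    "\<And>k. f ^^ k = ratfun_map (d ^ k) (fst (pq k)) (snd (pq k))" by metis
  define Pk Qk where "Pk = (\<lambda>k. map_poly complex_of_real (fst (pq k)))"
    and "Qk = (\<lambda>k. map_poly complex_of_real (snd (pq k)))"
  have fk: "(f ^^ k) (Some z) = proj (poly (Pk k) z) (poly (Qk k) z)" for k z
    unfolding pq(2)[of k] Pk_def Qk_def by (rule ratfun_map_Some[OF pq(1)])
  have PQk: "\<not> (poly (Pk k) z = 0 \<and> poly (Qk k) z = 0)" for k z
    unfolding Pk_def Qk_def by (rule nondegD(4)[OF pq(1)])
  have omit: "poly (Pk k) z - y * poly (Qk k) z \<noteq> 0" if "(f ^^ k) (Some z) \<noteq> Some y" for k z y
    using that PQk[of k z] unfolding fk proj_def by (auto simp: field_simps split: if_splits)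
  \<comment> \<open>If \<open>f ^^ k\<close> took \<open>z\<close> to a preimage of
    \<open>z\<close>, one more step would return to \<open>z\<close>; each coincidence makes
    \<open>z\<close> a nonreal periodic point.\<close>
  have om: "poly (Pk k) z - z * poly (Qk k) z \<noteq> 0" "poly (Pk k) z - \<alpha> z * poly (Qk k) z \<noteq> 0"
    "poly (Pk k) z - \<beta> z * poly (Qk k) z \<noteq> 0" if z: "z \<in> ball u \<rho>" and k: "k \<ge> 1" for k z
  proof -
    have ny: "(f ^^ k) (Some z) \<noteq> Some y" if y: "f (Some y) = Some z" for y
    proof
      assume "(f ^^ k) (Some z) = Some y"
      then have "(f ^^ Suc k) (Some z) = Some z" using y by simp
      then show False using nonper[OF ImD[OF z], of "Suc k"] by simp
    qed
    show "poly (Pk k) z - \<alpha> z * poly (Qk k) z \<noteq> 0" by (rule omit[OF ny[OF D(1)[OF z]]])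
    show "poly (Pk k) z - \<beta> z * poly (Qk k) z \<noteq> 0" by (rule omit[OF ny[OF D(2)[OF z]]])
    show "poly (Pk k) z - z * poly (Qk k) z \<noteq> 0" by (rule omit[OF nonper[OF ImD[OF z] k]])
  qed
  \<comment> \<open>\<open>h k z\<close> is the cross ratio that is 0, infinity or 1 when
    \<open>f^k(z)\<close> equals \<open>z\<close>, \<open>\<alpha> z\<close> or
    \<open>\<beta> z\<close>, respectively; \<open>c z\<close> is its value when
    \<open>f^k(z)\<close> is infinity.\<close>
  define c where "c = (\<lambda>z. (\<beta> z - \<alpha> z) / (\<beta> z - z))"
  define h where "h = (\<lambda>k z. (poly (Pk k) z - z * poly (Qk k) z) / (poly (Pk k) z - \<alpha> z * poly (Qk
      k) z) * c z)"
  have hol: "\<alpha> holomorphic_on ball u \<rho>" "\<beta> holomorphic_on ball u \<rho>"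
    using \<alpha>(2) \<beta>(2) \<rho>(2,3) by (auto intro: holomorphic_on_subset subset_ball)
  have cz: "c z \<noteq> 0" if "z \<in> ball u \<rho>" for z using D(3)[OF that] Dz[OF that] by (simp add: c_def)
  have hh: "h k holomorphic_on ball u \<rho>" if "k \<ge> 1" for k
    unfolding h_def c_def using hol om(2)[OF _ that] Dz by (intro holomorphic_intros) auto
  have h01: "h k z \<noteq> 0 \<and> h k z \<noteq> 1" if z: "z \<in> ball u \<rho>" and k: "k \<ge> 1" for k z
  proof
    show "h k z \<noteq> 0" using om(1,2)[OF z k] cz[OF z] by (simp add: h_def)
    show "h k z \<noteq> 1"
    proof
      assume h1: "h k z = 1"
      define P Q where "P = poly (Pk k) z" and "Q = poly (Qk k) z"
      have "(P - z * Q) * (\<beta> z - \<alpha> z) = (P - \<alpha> z * Q) * (\<beta> z - z)"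
        using h1 om(2)[OF z k] Dz(2)[OF z] by (simp add: h_def c_def P_def Q_def field_simps)
      then have "(P - \<beta> z * Q) * (z - \<alpha> z) = 0" by (simp add: algebra_simps)
      then show False using om(3)[OF z k] Dz(1)[OF z] by (simp add: P_def Q_def)
    qed
  qed
  have ub: "u \<in> ball u \<rho>" using \<rho>(1) by simp
  \<comment> \<open>From time \<open>n\<close> on the orbit of \<open>u\<close> sits at infinity, so
    the whole family has the same value at the centre; this is the bound that Schottky
    requires.\<close>
  have hu: "h k u = c u" if k: "k \<ge> n" for k
  proof -
    have "(f ^^ k) (Some u) = (f ^^ (k - n)) ((f ^^ n) (Some u))"
      using k by (simp flip: funpow_add[unfolded comp_def, THEN fun_cong] add: funpow_add)
    then have "(f ^^ k) (Some u) = None" by (simp add: land funpow_None)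
    then have "poly (Qk k) u = 0" by (simp add: fk proj_def split: if_splits)
    moreover from this have "poly (Pk k) u \<noteq> 0" using PQk[of k u] by auto
    ultimately show ?thesis by (simp add: h_def)
  qed
  obtain L where L: "L > 0" "\<And>h z0 \<rho> z. \<lbrakk>\<rho> > 0; h holomorphic_on ball z0 \<rho>;
       \<And>z. z \<in> ball z0 \<rho> \<Longrightarrow> h z \<noteq> 0 \<and> h z \<noteq> 1; norm (h z0) \<le> norm (c u); norm (z - z0) < \<rho> / 2\<rbrakk>
       \<Longrightarrow> norm (h z - h z0) \<le> L * norm (z - z0) / \<rho>"
    using schottky_lipschitz[OF zero_neq_one, of "norm (c u)"] by metis
  \<comment> \<open>An upper bound for \<open>norm w * (1 + e * norm (\<alpha> z))\<close>, with
    \<open>w\<close> as below. It is independent of \<open>k\<close>, continuous at \<open>u\<close>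
    and zero there.\<close>
  define \<Phi> where "\<Phi> = (\<lambda>z. (L * norm (z - u) / \<rho> + norm (c z - c u)) / (norm (c z) * norm (\<alpha> z -
      z)) * (1 + e * norm (\<alpha> z)))"
  have cc: "isCont c u" unfolding c_def using \<alpha>c \<beta>c Dz(2)[OF ub] by (intro continuous_intros) auto
  have "isCont \<Phi> u"
    unfolding \<Phi>_def using \<alpha>c cc cz[OF ub] Dz(1)[OF ub] \<rho>(1) by (intro continuous_intros) auto
  moreover have "\<Phi> u = 0" by (simp add: \<Phi>_def)
  ultimately have "\<exists>s>0. \<forall>z. dist z u < s \<longrightarrow> dist (\<Phi> z) 0 < e"
    using e unfolding continuous_at_eps_delta by metis
  then obtain s0 where s0: "s0 > 0" "\<And>z. dist z u < s0 \<Longrightarrow> \<bar>\<Phi> z\<bar> < e" by auto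
  define s where "s = min s0 (\<rho> / 2)"
  show thesis
  proof (rule that[of s])
    show "s > 0" using s0(1) \<rho>(1) by (simp add: s_def)
    fix k z assume k: "k \<ge> n" and "norm (z - u) < s"
    then have z: "norm (z - u) < s0" "norm (z - u) < \<rho> / 2" by (simp_all add: s_def)
    then have zb: "z \<in> ball u \<rho>" using \<rho>(1) by (simp add: dist_norm norm_minus_commute)
    have k1: "k \<ge> 1" using k n by simp
    define P Q where "P = poly (Pk k) z" and "Q = poly (Qk k) z"
    \<comment> \<open>This is \<open>1 / (f^k(z) - \<alpha> z)\<close> extended over poles: it is
      small exactly when \<open>f^k(z)\<close> is close to infinity.\<close>
    define w where "w = Q / (P - \<alpha> z * Q)"
    note o = om[OF zb k1, folded P_def Q_def]
    have "h k z - c z = c z * (\<alpha> z - z) * w"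
      using o(2) by (simp add: h_def w_def P_def[symmetric] Q_def[symmetric] field_simps)
    then have "norm (c z) * norm (\<alpha> z - z) * norm w = norm (h k z - c z)" by (simp add: norm_mult)
    also have "\<dots> \<le> norm (h k z - h k u) + norm (c z - c u)"
      using norm_triangle_ineq4[of "h k z - h k u" "c z - c u"] by (simp add: hu[OF k])
    also have "norm (h k z - h k u) \<le> L * norm (z - u) / \<rho>"
      by (rule L(2)[OF \<rho>(1) hh[OF k1] h01[OF _ k1]]) (use hu[OF k] z(2) in auto)
    finally have "norm (c z) * norm (\<alpha> z - z) * norm w \<le> L * norm (z - u) / \<rho> + norm (c z - c u)"
        by simp
    moreover have pos: "norm (c z) * norm (\<alpha> z - z) > 0" using cz[OF zb] Dz(1)[OF zb] by simp
    ultimately have wle: "norm w \<le> (L * norm (z - u) / \<rho> + norm (c z - c u)) / (norm (c z) * norm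
        (\<alpha> z - z))"
      by (simp add: pos_le_divide_eq mult.commute)
    have "norm w * (1 + e * norm (\<alpha> z)) \<le> \<Phi> z"
      unfolding \<Phi>_def using wle e by (intro mult_right_mono) (auto intro: add_nonneg_nonneg)
    also have "\<Phi> z < e" using s0(2)[of z] z(1) by (simp add: dist_norm)
    finally have we: "norm w * (1 + e * norm (\<alpha> z)) < e" .
    show "(f ^^ k) (Some z) \<in> disc None e"
    proof (cases "Q = 0")
      case True
      then show ?thesis using e by (simp add: fk proj_def Q_def[symmetric])
    next
      case False
      have w0: "w \<noteq> 0" using False o(2) by (simp add: w_def)
      have "P / Q = (1 + \<alpha> z * w) / w"
        using False o(2) by (simp add: w_def field_simps)
      then have nPQ: "norm (P / Q) = norm (1 + \<alpha> z * w) / norm w" by (simp only: norm_divide)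
      have "1 \<le> norm (1 + \<alpha> z * w) + norm (\<alpha> z) * norm w"
        using norm_triangle_ineq4[of "1 + \<alpha> z * w" "\<alpha> z * w"] by (simp add: norm_mult)
      then have "e * 1 \<le> e * (norm (1 + \<alpha> z * w) + norm (\<alpha> z) * norm w)"
        using e by (intro mult_left_mono) auto
      then have "norm w < e * norm (1 + \<alpha> z * w)" using we by (simp add: algebra_simps)
      then have "1 < e * norm (P / Q)" unfolding nPQ using w0 by (simp add: field_simps)
      then show ?thesis using False by (simp add: fk proj_def P_def[symmetric] Q_def[symmetric])
    qed
  qed
qed

text \<open>Equicontinuity at a point landing on infinity, pushed forward by the open map
  \<open>f ^^ N\<close>, would make infinity stable. The point is first replaced by a backward
  iterate that is not a critical value.\<close>

lemma nonreal_never_infinite: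
  assumes real: "only_real_periodic_points f" and u: "Im u \<noteq> 0"
  shows "(f ^^ n) (Some u) \<noteq> None"
proof
  assume land: "(f ^^ n) (Some u) = None"
  obtain k v where v: "(f ^^ k) (Some v) = Some u" "Im v \<noteq> 0" "v \<notin> E"
    by (rule infinite_backward_orbit[OF real u])
  define N where "N = n + k"
  have lv: "(f ^^ N) (Some v) = None" using land v(1) by (simp add: N_def funpow_add)
  have N: "N \<ge> 1" using lv by (cases N) auto
  obtain r G where G: "local_rep (f ^^ N) (Some v) r G" by (rule rational_map_local_rep[OF rat_funpow])
  note G' = local_repD[OF G]
  have dN: "d ^ N \<ge> 1" using d2 by simp
  have "stable f None" unfolding stable_def
  proof (intro allI impI)
    fix e :: real assume e: "e > 0"
    obtain s where s: "s > 0" "\<And>k z. k \<ge> N \<Longrightarrow> norm (z - v) < s \<Longrightarrow> (f ^^ k) (Some z) \<in> disc None e"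
      by (rule equicontinuous_at_prepole[OF real v(2,3) lv N e]) blast
    define s' where "s' = min s r"
    have s': "s' > 0" "s' \<le> s" "s' \<le> r" using s(1) G'(1) by (auto simp: s'_def)
    have Gh: "G holomorphic_on ball 0 s'" using G'(2) s'(3) by (auto intro: holomorphic_on_subset)
    have nc: "\<not> G constant_on ball 0 s'"
    proof
      assume "G constant_on ball 0 s'"
      then obtain c where c: "\<And>t. t \<in> ball 0 s' \<Longrightarrow> G t = c" unfolding constant_on_def by blast
      have "c = 0" using c[of 0] G'(3) s'(1) by simp
      obtain t where t: "t \<in> ball 0 s'" "(f ^^ N) (chart (Some v) t) \<noteq> None"
        using local_rep_not_eventually[OF rat_funpow dN s'(1)] by blast
      then show False using G'(4)[of t] c[OF t(1)] \<open>c = 0\<close> lv s'(3) by simp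
    qed
    \<comment> \<open>By openness every point near infinity is the image of a point near
      \<open>v\<close>, so its orbit is a tail of an orbit already controlled.\<close>
    have "open (G ` ball 0 s')" by (rule open_mapping_thm[OF Gh open_ball connected_ball open_ball
        order_refl nc])
    moreover have "0 \<in> G ` ball 0 s'" using G'(3) s'(1) by (intro image_eqI[of _ _ 0]) auto
    ultimately obtain s2 where s2: "s2 > 0" "ball 0 s2 \<subseteq> G ` ball 0 s'" by (meson openE)
    have "(f ^^ j) x \<in> disc None e" if x: "x \<in> disc None s2" for x j
    proof -
      obtain t0 where t0: "x = chart None t0" "t0 \<in> ball 0 s2" using x by (auto simp: disc_def)
      then obtain t where t: "t \<in> ball 0 s'" "t0 = G t" using s2(2) by blast
      have "x = (f ^^ N) (Some (v + t))" using G'(4)[of t] t s'(3) lv t0(1) by simp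
      then have "(f ^^ j) x = (f ^^ (j + N)) (Some (v + t))" by (simp add: funpow_add)
      then show ?thesis using s(2)[of "j + N" "v + t"] t(1) s'(2) by simp
    qed
    then show "\<exists>s>0. \<forall>x\<in>disc None s. \<forall>n. (f ^^ n) x \<in> disc None e" using s2(1) by blast
  qed
  then show False using unstable by blast
qed

end

section \<open>The backward invariant set\<close>

context omitting
begin

lemma open_fi_image:
  assumes "open V" "V \<subseteq> U"
  shows "open (fi n ` V)"
proof (rule open_mapping_thm2[OF fi_holomorphic open_U assms])
  fix X assume X: "open X" "X \<subseteq> U" "X \<noteq> {}"
  show "\<not> fi n constant_on X"
  proof
    assume "fi n constant_on X"
    then obtain c where c: "\<And>z. z \<in> X \<Longrightarrow> fi n z = c" unfolding constant_on_def by blast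
    have "d ^ n \<ge> 1" using d2 by simp
    from rational_map_finite_preimage[OF rat_funpow this, of "Some c"]
    have "finite (Some -` {z. (f ^^ n) z = Some c})" by (rule finite_vimageI) simp
    moreover have "X \<subseteq> Some -` {z. (f ^^ n) z = Some c}"
    proof
      fix z assume "z \<in> X"
      then show "z \<in> Some -` {z. (f ^^ n) z = Some c}" using fi[of z n] X(2) c by auto
    qed
    ultimately have "countable X" using finite_subset countable_finite by blast
    moreover obtain x r where "r > 0" "ball x r \<subseteq> X" using X(1,3) by (meson ex_in_conv openE)
    then have "uncountable (ball x r)" "ball x r \<subseteq> X" using uncountable_ball by auto
    ultimately show False using countable_subset by blast
  qed
qed

definition hit :: "real set" where
  "hit = {x. \<exists>u. Im u \<noteq> 0 \<and> f (Some u) = Some (complex_of_real x)}"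

text \<open>The least set of real points that must leave \<open>S\<close> once all nonreal points
  do, given backward invariance.\<close>

definition reach :: "real set" where
  "reach = {x. \<exists>n u. Im u \<noteq> 0 \<and> (f ^^ n) (Some u) = Some (complex_of_real x)}"

lemma open_fi_image_real: "open {x. complex_of_real x \<in> fi n ` U}"
proof -
  have "open (complex_of_real -` (fi n ` U))"
    by (intro open_vimage open_fi_image open_U order_refl continuous_intros)
  then show ?thesis by (simp add: vimage_def)
qed

lemma in_fi_image_iff:
  "complex_of_real x \<in> fi n ` U \<longleftrightarrow> (\<exists>u. Im u \<noteq> 0 \<and> (f ^^ n) (Some u) = Some (complex_of_real x))"
proof
  assume "complex_of_real x \<in> fi n ` U"
  then obtain u where "u \<in> U" "complex_of_real x = fi n u" by blast
  then show "\<exists>u. Im u \<noteq> 0 \<and> (f ^^ n) (Some u) = Some (complex_of_real x)"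
    using fi[of u n] by (intro exI[of _ u]) simp
next
  assume "\<exists>u. Im u \<noteq> 0 \<and> (f ^^ n) (Some u) = Some (complex_of_real x)"
  then obtain u where u: "Im u \<noteq> 0" "(f ^^ n) (Some u) = Some (complex_of_real x)" by blast
  then have "complex_of_real x = fi n u" by (simp add: fi_def)
  then show "complex_of_real x \<in> fi n ` U" using u(1) by (intro image_eqI[of _ _ u]) simp_all
qed

lemma open_hit: "open hit"
  using open_fi_image_real[of 1] unfolding in_fi_image_iff hit_def by simp

lemma open_reach: "open reach"
proof -
  have "reach = (\<Union>n. {x. complex_of_real x \<in> fi n ` U})"
    unfolding in_fi_image_iff reach_def by blast
  then show ?thesis using open_fi_image_real by (simp add: open_UN)
qed

text \<open>The boundary of \<open>hit\<close> consists of critical values. If hits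
  \<open>y n\<close> tend to \<open>x\<close> outside \<open>hit\<close>, their nonreal preimages
  accumulate at a real preimage \<open>l\<close> of \<open>x\<close>; there \<open>f\<close>
  identifies conjugate points, so it is not injective near \<open>l\<close>.\<close>

lemma tame_hit: "tame hit"
proof (rule tame_finite_boundary)
  have "finite (complex_of_real -` E)" by (rule finite_vimageI[OF finite_E inj_of_real])
  then show "finite {x. complex_of_real x \<in> E}" by (simp add: vimage_def)
  fix x :: real assume "x \<notin> {x. complex_of_real x \<in> E}"
  then have xE: "complex_of_real x \<notin> E" by simp
  show "\<exists>e>0. ball x e \<subseteq> hit \<or> ball x e \<inter> hit = {}"
  proof (cases "x \<in> hit")
    case True
    then show ?thesis using open_hit by (meson openE)
  next
    case False
    show ?thesis
    proof (rule ccontr)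
      assume neg: "\<not> ?thesis"
      have "\<exists>y. y \<in> hit \<and> dist x y < inverse (real (Suc n))" for n
      proof -
        have "\<not> ball x (inverse (real (Suc n))) \<inter> hit = {}" using neg by (metis
            inverse_positive_iff_positive of_nat_0_less_iff zero_less_Suc)
        then show ?thesis by auto
      qed
      then obtain y where y: "\<And>n. y n \<in> hit" "\<And>n. dist x (y n) < inverse (real (Suc n))" by metis
      then have "\<forall>n. \<exists>u. Im u \<noteq> 0 \<and> f (Some u) = Some (complex_of_real (y n))" unfolding hit_def
          by blast
      then obtain u where u: "\<And>n. Im (u n) \<noteq> 0" "\<And>n. f (Some (u n)) = Some (complex_of_real (y
          n))" by metis
      have yx: "y \<longlonglongrightarrow> x"
      proof (rule metric_LIMSEQ_I)
        fix e :: real assume "e > 0"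
        then obtain N where N: "inverse (real (Suc N)) < e" using reals_Archimedean by blast
        have "dist (y n) x < e" if "n \<ge> N" for n
        proof -
          have "inverse (real (Suc n)) \<le> inverse (real (Suc N))" using that by (intro
              le_imp_inverse_le) auto
          moreover have "dist (y n) x < inverse (real (Suc n))" using y(2)[of n] by (simp only:
              dist_commute)
          ultimately show ?thesis using N by linarith
        qed
        then show "\<exists>no. \<forall>n\<ge>no. dist (y n) x < e" by blast
      qed
      \<comment> \<open>All \<open>y n\<close> have modulus below \<open>\<bar>x\<bar> + 1\<close>,
        while points close to infinity are sent beyond this bound; so the preimages stay
        bounded.\<close>
      define e where "e = 1 / (\<bar>x\<bar> + 1)"
      have e: "e > 0" by (simp add: e_def add_nonneg_pos)
      obtain s where s: "s > 0" "f ` disc None s \<subseteq> disc (f None) e" by (rule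
          rational_map_continuous[OF rat e])
      have "norm (u n) \<le> 1 / s" for n
      proof (rule ccontr)
        assume "\<not> norm (u n) \<le> 1 / s"
        then have "Some (u n) \<in> disc None s" using s(1) by (simp add: field_simps)
        then have "f (Some (u n)) \<in> disc None e" using s(2) f_None by auto
        then have "1 < e * \<bar>y n\<bar>" by (simp add: u(2))
        then have "\<bar>x\<bar> + 1 < \<bar>y n\<bar>" by (simp add: e_def field_simps)
        moreover have "inverse (real (Suc n)) \<le> 1" by (simp add: field_simps)
        ultimately show False using y(2)[of n] by (simp add: dist_real_def abs_if split: if_splits)
      qed
      then have "bounded (range u)" unfolding bounded_iff by blast
      then obtain l r where r: "strict_mono (r :: nat \<Rightarrow> nat)" "(\<lambda>n. u (r n)) \<longlonglongrightarrow> l"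
        using bounded_imp_convergent_subsequence[of u] by (auto simp: comp_def)
      have "sconv (\<lambda>n. f (Some (u (r n)))) (f (Some l))"
        by (rule sconv_map[OF rat]) (use r(2) in \<open>simp add: sconv_Some_iff\<close>)
      moreover have "(\<lambda>n. complex_of_real (y (r n))) \<longlonglongrightarrow> complex_of_real x"
        using LIMSEQ_subseq_LIMSEQ[OF yx r(1)] by (intro tendsto_of_real) (simp add: comp_def)
      then have "sconv (\<lambda>n. f (Some (u (r n)))) (Some (complex_of_real x))" by (simp add: u(2)
          sconv_Some_iff)
      ultimately have fl: "f (Some l) = Some (complex_of_real x)" by (rule sconv_unique)
      have Iml: "Im l = 0" using False fl by (auto simp: hit_def)
      have "poly W l \<noteq> 0" using xE fl by (auto simp: E_def)
      then obtain F \<rho> where F: "\<rho> > 0" "inj_on F (ball l \<rho>)" "\<And>z. z \<in> ball l \<rho> \<Longrightarrow> f (Some z) = Some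
          (F z)"
        using locally_injective[OF fl] by metis
      have "\<forall>\<^sub>F n in sequentially. dist (u (r n)) l < \<rho>" using r(2) F(1) by (rule tendstoD)
      then have "\<exists>n. dist (u (r n)) l < \<rho>" using eventually_happens trivial_limit_sequentially by blast
      then obtain n where n: "dist (u (r n)) l < \<rho>" by blast
      define v where "v = u (r n)"
      have cl: "cnj l = l" using Iml by (simp add: complex_eq_iff)
      have "norm (cnj v - l) = norm (v - l)" by (metis cl complex_cnj_diff complex_mod_cnj)
      then have vb: "v \<in> ball l \<rho>" "cnj v \<in> ball l \<rho>"
        using n by (simp_all add: v_def dist_norm norm_minus_commute)
      have "f (Some (cnj v)) = map_option cnj (f (Some v))"
        using rational_map_cnj[OF rat, of "Some v"] by simp
      also have "\<dots> = f (Some v)" by (simp add: v_def u(2))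
      finally have "F (cnj v) = F v" using F(3) vb by simp
      then have "cnj v = v" using F(2) vb by (auto dest: inj_onD)
      then have "Im v = 0" by (simp add: complex_eq_iff)
      then show False using u(1) by (simp add: v_def)
    qed
  qed
qed

text \<open>Meaningful only where \<open>f\<close> is finite; by \<open>reach_step\<close> this
  includes \<open>reach\<close>.\<close>

definition fr :: "real \<Rightarrow> real" where "fr x = Re (the (f (Some (complex_of_real x))))"

lemma fr: "f (Some (complex_of_real x)) \<noteq> None \<Longrightarrow> f (Some (complex_of_real x)) = Some
    (complex_of_real (fr x))"
  using rational_map_real[OF rat, of "Some (complex_of_real x)"]
  by (cases "f (Some (complex_of_real x))") (auto simp: fr_def complex_eq_iff)

lemma reach_step:
  assumes "x \<in> reach"
  shows "f (Some (complex_of_real x)) = Some (complex_of_real (fr x))" "fr x \<in> reach"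
proof -
  obtain n u where u: "Im u \<noteq> 0" "(f ^^ n) (Some u) = Some (complex_of_real x)"
    using assms unfolding reach_def by blast
  have eq: "(f ^^ Suc n) (Some u) = f (Some (complex_of_real x))" using u(2) by simp
  then have "f (Some (complex_of_real x)) \<noteq> None" using NU[OF u(1), of "Suc n"] by simp
  then show 1: "f (Some (complex_of_real x)) = Some (complex_of_real (fr x))" by (rule fr)
  have "(f ^^ Suc n) (Some u) = Some (complex_of_real (fr x))" unfolding eq by (rule 1)
  then show "fr x \<in> reach" unfolding reach_def using u(1) by blast
qed

lemma hit_subset_reach: "hit \<subseteq> reach"
proof
  fix x assume "x \<in> hit"
  then obtain u where "Im u \<noteq> 0" "(f ^^ 1) (Some u) = Some (complex_of_real x)" by (auto simp: hit_def)
  then show "x \<in> reach" unfolding reach_def by blast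
qed

lemma reach_funpow:
  assumes "x \<in> reach"
  shows "(fr ^^ n) x \<in> reach" "(f ^^ n) (Some (complex_of_real x)) = Some (complex_of_real ((fr ^^
      n) x))"
proof -
  have "(fr ^^ n) x \<in> reach \<and> (f ^^ n) (Some (complex_of_real x)) = Some (complex_of_real ((fr ^^
      n) x))"
    using assms by (induction n) (auto simp: reach_step)
  then show "(fr ^^ n) x \<in> reach" "(f ^^ n) (Some (complex_of_real x)) = Some (complex_of_real
      ((fr ^^ n) x))"
    by auto
qed

text \<open>A nonreal orbit enters the real line through \<open>hit\<close> and is real from then
  on, so the orbit is split at its last nonreal point.\<close>

lemma reach_eq: "reach = (\<Union>n. (fr ^^ n) ` hit)"
proof
  have *: "\<exists>k. \<exists>y\<in>hit. x = (fr ^^ k) y" if "Im u \<noteq> 0" "(f ^^ n) (Some u) = Some (complex_of_real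
      x)" for n u x
    using that
  proof (induction n arbitrary: x)
    case 0
    then show ?case by auto
  next
    case (Suc n)
    define v where "v = fi n u"
    have v: "(f ^^ n) (Some u) = Some v" using fi[of u n] Suc.prems(1) by (simp add: v_def)
    then have fv: "f (Some v) = Some (complex_of_real x)" using Suc.prems(2) by simp
    show ?case
    proof (cases "Im v = 0")
      case False
      then have "x \<in> hit" using fv by (auto simp: hit_def)
      then show ?thesis by (intro exI[of _ 0] bexI[of _ x]) auto
    next
      case True
      then have vr: "v = complex_of_real (Re v)" by (simp add: complex_eq_iff)
      obtain k y where y: "y \<in> hit" "Re v = (fr ^^ k) y" using Suc.IH[OF Suc.prems(1), of "Re v"]
          v vr by metis
      have "fr (Re v) = x" using fv vr by (simp add: fr_def)
      then show ?thesis using y by (intro exI[of _ "Suc k"] bexI[of _ y]) auto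
    qed
  qed
  show "reach \<subseteq> (\<Union>n. (fr ^^ n) ` hit)"
  proof
    fix x assume "x \<in> reach"
    then obtain n u where "Im u \<noteq> 0" "(f ^^ n) (Some u) = Some (complex_of_real x)"
      unfolding reach_def by blast
    from *[OF this] obtain k y where "y \<in> hit" "x = (fr ^^ k) y" by blast
    then show "x \<in> (\<Union>n. (fr ^^ n) ` hit)" by blast
  qed
  show "(\<Union>n. (fr ^^ n) ` hit) \<subseteq> reach"
  proof
    fix x assume "x \<in> (\<Union>n. (fr ^^ n) ` hit)"
    then obtain k y where "y \<in> hit" "x = (fr ^^ k) y" by blast
    then show "x \<in> reach" using reach_funpow(1)[of y k] hit_subset_reach by auto
  qed
qed

lemma continuous_on_fr: "continuous_on reach fr"
proof -
  have "(\<lambda>z. the (f (Some z))) holomorphic_on {z. f (Some z) \<noteq> None}"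
    by (rule rational_map_holomorphic[OF rat]) simp
  then have "continuous_on {z. f (Some z) \<noteq> None} (\<lambda>z. the (f (Some z)))"
    by (rule holomorphic_on_imp_continuous_on)
  moreover have "complex_of_real ` reach \<subseteq> {z. f (Some z) \<noteq> None}" using reach_step(1) by auto
  ultimately have "continuous_on reach (\<lambda>x. the (f (Some (complex_of_real x))))"
    by (intro continuous_on_compose2[OF _ continuous_on_of_real[OF continuous_on_id]])
  then show ?thesis unfolding fr_def[abs_def] by (intro continuous_intros)
qed

lemma continuous_on_fr_funpow: "continuous_on reach (fr ^^ n)"
proof (induction n)
  case (Suc n)
  have "(fr ^^ n) ` reach \<subseteq> reach" using reach_funpow(1) by blast
  then have "continuous_on reach (fr \<circ> (fr ^^ n))"
    by (intro continuous_on_compose Suc continuous_on_subset[OF continuous_on_fr])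
  then show ?case by (simp add: comp_def)
qed (simp add: continuous_on_id id_def)

text \<open>\<open>N\<close> need not surround \<open>c\<close>: an indifferent point may attract
  from one side only, and an orbit may land on \<open>c\<close>. It has to catch the remaining real
  orbits that converge to \<open>c\<close>.\<close>

lemma real_neighbourhood_of_fixed_point:
  assumes c: "f c = c" "c \<in> real_points"
  obtains N where "open N" "tame N"
    "\<And>x. x \<in> N \<Longrightarrow> f (Some (complex_of_real x)) = Some (complex_of_real (fr x)) \<and> fr x \<in> N"
    "\<forall>x. sconv (\<lambda>n. Some (complex_of_real (x n))) c \<longrightarrow>
       (\<forall>n. f (Some (complex_of_real (x n))) = Some (complex_of_real (x (Suc n)))) \<longrightarrow>
       (\<forall>\<^sub>F n in sequentially. Some (complex_of_real (x n)) = c \<or> x n \<in> N)"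
proof -
  obtain r G where G: "local_rep f c r G" by (rule rational_map_local_rep[OF rat])
  note G' = local_repD[OF G]
  define g where "g = (\<lambda>t. Re (G (complex_of_real t)))"
  have Gg: "G (complex_of_real t) = complex_of_real (g t)" if "\<bar>t\<bar> < r" for t
  proof -
    have "G (cnj (complex_of_real t)) = cnj (G (complex_of_real t))"
      by (rule local_rep_real_deriv(2)[OF rat c G]) (use that in simp)
    then show ?thesis by (simp add: g_def complex_eq_iff)
  qed
  have g0: "g 0 = 0" using G'(3) by (simp add: g_def)
  have "\<exists>\<delta> N. 0 < \<delta> \<and> \<delta> \<le> r \<and> open N \<and> tame N \<and> (c = None \<longrightarrow> 0 \<notin> N) \<and> N \<subseteq> {-\<delta><..<\<delta>} \<and> g ` N \<subseteq> N \<and>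
    (\<forall>t. t \<longlonglongrightarrow> 0 \<longrightarrow> (\<forall>n. \<bar>t n\<bar> < \<delta> \<longrightarrow> t (Suc n) = g (t n)) \<longrightarrow>
       (\<forall>\<^sub>F n in sequentially. t n = 0 \<or> t n \<in> N))"
  \<comment> \<open>With zero derivative injectivity may fail, but a whole interval is attracted,
    and \<open>c\<close> is finite since infinity is not stable. With nonzero derivative the germ is
    injective.\<close>
  proof (cases "deriv G 0 = 0")
    case True
    then have "norm (deriv G 0) < 1" by simp
    from local_attracting[OF G'(1-3) this] obtain s \<rho> where
      s: "s > 0" "s \<le> r" "0 \<le> \<rho>" "\<rho> < 1" "\<And>t. norm t < s \<Longrightarrow> norm (G t) \<le> \<rho> * norm t" by metis
    have "\<bar>g t\<bar> < s" if "\<bar>t\<bar> < s" for t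
    proof -
      have "\<bar>g t\<bar> \<le> \<rho> * \<bar>t\<bar>" using s(5)[of "complex_of_real t"] that Gg[of t] s(2) by simp
      also have "\<dots> \<le> 1 * \<bar>t\<bar>" using s(4) by (intro mult_right_mono) auto
      finally show ?thesis using that by simp
    qed
    then have "g ` {-s<..<s} \<subseteq> {-s<..<s}" by (fastforce simp: abs_less_iff)
    moreover have "c \<noteq> None"
    proof
      assume "c = None"
      then show False using deriv_at_infinity_nonzero[of r G] G True by simp
    qed
    moreover have "\<forall>\<^sub>F n in sequentially. t n = 0 \<or> t n \<in> {-s<..<s}" if "t \<longlonglongrightarrow> 0" for t :: "nat \<Rightarrow> real"
    proof -
      have "\<forall>\<^sub>F n in sequentially. dist (t n) 0 < s" by (rule tendstoD[OF that s(1)])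
      then show ?thesis by (rule eventually_mono) (simp add: abs_less_iff)
    qed
    ultimately show ?thesis using s(1,2)
      by (intro exI[of _ s] exI[of _ "{-s<..<s}"]) (simp add: connected_tame)
  next
    case False
    have "0 \<in> ball (0::complex) r" using G'(1) by simp
    from has_complex_derivative_locally_injective[OF G'(2) this open_ball False]
    obtain s where s: "s > 0" "ball 0 s \<subseteq> ball (0::complex) r" "inj_on G (ball 0 s)" by blast
    have sr: "s \<le> r" using s(1,2) by (simp add: ball_subset_ball_iff)
    have in_ball: "complex_of_real t \<in> ball 0 s" if "t \<in> {-s<..<s}" for t using that by (auto
        simp: abs_less_iff)
    have inj: "inj_on g {-s<..<s}"
    proof (rule inj_onI)
      fix x y assume xy: "x \<in> {-s<..<s}" "y \<in> {-s<..<s}" "g x = g y"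
      then have "\<bar>x\<bar> < r" "\<bar>y\<bar> < r" using sr by (auto simp: abs_less_iff)
      then have "G (complex_of_real x) = G (complex_of_real y)" using Gg xy(3) by simp
      then have "complex_of_real x = complex_of_real y" by (rule inj_onD[OF s(3) _ in_ball[OF
          xy(1)] in_ball[OF xy(2)]])
      then show "x = y" by simp
    qed
    have "continuous_on (ball 0 s) G"
      using holomorphic_on_imp_continuous_on[OF G'(2)] s(2) by (rule continuous_on_subset)
    moreover have "complex_of_real ` {-s<..<s} \<subseteq> ball 0 s" using in_ball by blast
    ultimately have "continuous_on {-s<..<s} (\<lambda>t. G (complex_of_real t))"
      by (intro continuous_on_compose2[OF _ continuous_on_of_real[OF continuous_on_id]])
    then have cont: "continuous_on {-s<..<s} g" unfolding g_def by (intro continuous_intros)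
    obtain N where "open N" "tame N" "0 \<notin> N" "N \<subseteq> {-s<..<s}" "g ` N \<subseteq> N"
      "\<forall>t. t \<longlonglongrightarrow> 0 \<longrightarrow> (\<forall>n. \<bar>t n\<bar> < s \<longrightarrow> t (Suc n) = g (t n)) \<longrightarrow>
         (\<forall>\<^sub>F n in sequentially. t n = 0 \<or> t n \<in> N)"
      by (rule injective_fixed_point_invariant[OF s(1) cont inj g0]) (rule that)
    then show ?thesis using s(1) sr by (intro exI[of _ s] exI[of _ N]) blast
  qed
  then obtain \<delta> N where N: "0 < \<delta>" "\<delta> \<le> r" "open N" "tame N" "c = None \<longrightarrow> 0 \<notin> N" "N \<subseteq> {-\<delta><..<\<delta>}" "g
      ` N \<subseteq> N"
    and ev: "\<And>t. t \<longlonglongrightarrow> 0 \<Longrightarrow> (\<And>n. \<bar>t n\<bar> < \<delta> \<Longrightarrow> t (Suc n) = g (t n)) \<Longrightarrow>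
       \<forall>\<^sub>F n in sequentially. t n = 0 \<or> t n \<in> N" by blast
  \<comment> \<open>The real form of the chart at \<open>c\<close>. At infinity it is
    \<open>1 / t\<close>, which is why \<open>N\<close> must avoid \<open>0\<close> there.\<close>
  define \<kappa> where "\<kappa> = (\<lambda>t. case c of Some z \<Rightarrow> Re z + t | None \<Rightarrow> 1 / t)"
  have \<kappa>: "chart c (complex_of_real t) = Some (complex_of_real (\<kappa> t))" if "c = None \<longrightarrow> t \<noteq> 0" for t
    using that c(2) by (cases c) (auto simp: \<kappa>_def complex_eq_iff)
  have \<kappa>c: "continuous_on N \<kappa>" unfolding \<kappa>_def
    by (cases c) (use N(5) in \<open>auto intro!: continuous_intros\<close>)
  have \<kappa>i: "inj_on \<kappa> N" unfolding \<kappa>_def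
    by (cases c) (use N(5) in \<open>auto simp: inj_on_def\<close>)
  have N\<kappa>: "chart c (complex_of_real t) = Some (complex_of_real (\<kappa> t))" if "t \<in> N" for t
    using N(5) that by (intro \<kappa>) auto
  show thesis
  proof (rule that[of "\<kappa> ` N"])
    show "open (\<kappa> ` N)" by (rule injective_into_1d_imp_open_map_UNIV[OF N(3) \<kappa>c \<kappa>i order_refl])
    show "tame (\<kappa> ` N)" by (rule tame_image[OF N(4) \<kappa>c])
    fix x assume "x \<in> \<kappa> ` N"
    then obtain t where t: "t \<in> N" "x = \<kappa> t" by blast
    have tr: "\<bar>t\<bar> < r" using t(1) N(2,6) by (auto simp: abs_less_iff)
    have gt: "g t \<in> N" using t(1) N(7) by blast
    have "f (Some (complex_of_real x)) = f (chart c (complex_of_real t))" using N\<kappa>[OF t(1)] t(2) by simp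
    also have "\<dots> = chart c (complex_of_real (g t))" using G'(4)[of "complex_of_real t"] tr Gg[OF
        tr] c(1) by simp
    also have "\<dots> = Some (complex_of_real (\<kappa> (g t)))" by (rule N\<kappa>[OF gt])
    finally have "f (Some (complex_of_real x)) = Some (complex_of_real (\<kappa> (g t)))" .
    moreover from this have "fr x = \<kappa> (g t)" by (simp add: fr_def)
    ultimately show "f (Some (complex_of_real x)) = Some (complex_of_real (fr x)) \<and> fr x \<in> \<kappa> ` N"
      using gt by simp
  next
    show "\<forall>x. sconv (\<lambda>n. Some (complex_of_real (x n))) c \<longrightarrow>
       (\<forall>n. f (Some (complex_of_real (x n))) = Some (complex_of_real (x (Suc n)))) \<longrightarrow>
       (\<forall>\<^sub>F n in sequentially. Some (complex_of_real (x n)) = c \<or> x n \<in> \<kappa> ` N)"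
    proof (intro allI impI)
      fix x assume x: "sconv (\<lambda>n. Some (complex_of_real (x n))) c"
        and "\<forall>n. f (Some (complex_of_real (x n))) = Some (complex_of_real (x (Suc n)))"
      then have step: "\<And>n. f (Some (complex_of_real (x n))) = Some (complex_of_real (x (Suc n)))"
          by blast
      have "\<forall>\<^sub>F n in sequentially. Some (complex_of_real (x n)) \<in> disc c \<delta>"
        using x N(1) by (simp add: sconv_def)
      then obtain n0 where n0: "\<And>n. n \<ge> n0 \<Longrightarrow> Some (complex_of_real (x n)) \<in> disc c \<delta>"
        by (auto simp: eventually_sequentially)
      have "\<exists>t. \<bar>t\<bar> < \<delta> \<and> Some (complex_of_real (x (n0 + n))) = chart c (complex_of_real t)" for n
      proof -
        obtain \<tau> where \<tau>: "norm \<tau> < \<delta>" "Some (complex_of_real (x (n0 + n))) = chart c \<tau>"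
          using n0[of "n0 + n"] by (auto simp: disc_def)
        have "chart c (cnj \<tau>) = map_option cnj (chart c \<tau>)" by (rule chart_cnj[OF c(2)])
        also have "\<dots> = chart c \<tau>" by (simp flip: \<tau>(2))
        finally have "cnj \<tau> = \<tau>" by (simp add: chart_inj)
        then have "\<tau> = complex_of_real (Re \<tau>)" by (simp add: complex_eq_iff)
        then show ?thesis using \<tau> by (metis norm_of_real)
      qed
      then obtain t where t: "\<And>n. \<bar>t n\<bar> < \<delta>" "\<And>n. Some (complex_of_real (x (n0 + n))) = chart c
          (complex_of_real (t n))"
        by metis
      have "sconv (\<lambda>n. Some (complex_of_real (x (n0 + n)))) c"
        using sconv_subseq[OF x, of "\<lambda>n. n0 + n"] by (simp add: strict_mono_def)
      then have "(\<lambda>n. complex_of_real (t n)) \<longlonglongrightarrow> 0" by (simp add: t(2) sconv_chart_iff)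
      then have "(\<lambda>n. complex_of_real (t n)) \<longlonglongrightarrow> complex_of_real 0" by simp
      then have t0: "t \<longlonglongrightarrow> 0" by (simp only: tendsto_of_real_iff)
      have "t (Suc n) = g (t n)" for n
      proof -
        have tr: "\<bar>t n\<bar> < r" using t(1)[of n] N(2) by simp
        have "chart c (complex_of_real (t (Suc n))) = Some (complex_of_real (x (Suc (n0 + n))))"
          using t(2)[of "Suc n"] by simp
        also have "\<dots> = f (chart c (complex_of_real (t n)))" using step[of "n0 + n"] t(2)[of n] by simp
        also have "\<dots> = chart c (complex_of_real (g (t n)))"
          using G'(4)[of "complex_of_real (t n)"] tr Gg[OF tr] c(1) by simp
        finally show ?thesis by (simp add: chart_inj)
      qed
      then have "\<forall>\<^sub>F n in sequentially. t n = 0 \<or> t n \<in> N" by (intro ev t0)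
      then have "\<forall>\<^sub>F n in sequentially. Some (complex_of_real (x (n + n0))) = c \<or> x (n + n0) \<in> \<kappa> ` N"
      proof (rule eventually_mono)
        fix n assume "t n = 0 \<or> t n \<in> N"
        then show "Some (complex_of_real (x (n + n0))) = c \<or> x (n + n0) \<in> \<kappa> ` N"
        proof
          assume "t n = 0"
          then show ?thesis using t(2)[of n] by (simp add: add.commute)
        next
          assume "t n \<in> N"
          then have "x (n0 + n) = \<kappa> (t n)" using t(2)[of n] N\<kappa> by simp
          then show ?thesis using \<open>t n \<in> N\<close> by (simp add: add.commute)
        qed
      qed
      then show "\<forall>\<^sub>F n in sequentially. Some (complex_of_real (x n)) = c \<or> x n \<in> \<kappa> ` N"
        by (simp only: eventually_sequentially_seg[of "\<lambda>n. Some (complex_of_real (x n)) = c \<or> x n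
            \<in> \<kappa> ` N"])
    qed
  qed
qed

text \<open>\<open>T\<close> is \<open>reach\<close> together with the set \<open>N\<close> near
  \<open>c\<close>. Each interval of \<open>hit\<close> contains a point whose orbit converges to
  \<open>c\<close>, so its images eventually meet \<open>N\<close> or contain \<open>c\<close> and
  merge.\<close>

lemma tame_invariant_set:
  assumes real: "only_real_periodic_points f"
  obtains T where "open T" "tame T"
    "\<And>z. Im z \<noteq> 0 \<or> Re z \<in> T \<Longrightarrow> \<exists>w. f (Some z) = Some w \<and> (Im w \<noteq> 0 \<or> Re w \<in> T)"
proof -
  obtain c where c: "f c = c" "c \<in> real_points" "\<And>w. w \<in> U \<Longrightarrow> sconv (\<lambda>n. (f ^^ n) (Some w)) c"
    using orbits_converge[OF real] by metis
  obtain N where N: "open N" "tame N"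
    "\<And>x. x \<in> N \<Longrightarrow> f (Some (complex_of_real x)) = Some (complex_of_real (fr x)) \<and> fr x \<in> N"
    and ev: "\<forall>x. sconv (\<lambda>n. Some (complex_of_real (x n))) c \<longrightarrow>
       (\<forall>n. f (Some (complex_of_real (x n))) = Some (complex_of_real (x (Suc n)))) \<longrightarrow>
       (\<forall>\<^sub>F n in sequentially. Some (complex_of_real (x n)) = c \<or> x n \<in> N)"
    by (rule real_neighbourhood_of_fixed_point[OF c(1,2)]) (rule that)
  obtain \<A>0 where A0: "finite \<A>0" "\<And>C. C \<in> \<A>0 \<Longrightarrow> connected C" "hit = \<Union>\<A>0"
    using tame_hit unfolding tame_def by blast
  obtain \<N>0 where N0: "finite \<N>0" "\<And>C. C \<in> \<N>0 \<Longrightarrow> connected C" "N = \<Union>\<N>0"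
    using N(2) unfolding tame_def by blast
  \<comment> \<open>Every remaining interval contains a point whose orbit can be followed.\<close>
  define \<A> where "\<A> = \<A>0 - {{}}"
  have A: "finite \<A>" "\<And>C. C \<in> \<A> \<Longrightarrow> connected C" "hit = \<Union>\<A>" "{} \<notin> \<A>"
    using A0 by (auto simp: \<A>_def)
  \<comment> \<open>At most one point: \<open>c\<close> itself, added as a degenerate interval to be
    met by the images of orbits that land on \<open>c\<close>.\<close>
  define Z where "Z = {x. Some (complex_of_real x) = c} \<inter> reach"
  define \<N> where "\<N> = insert Z \<N>0"
  have "Z \<subseteq> {x}" if "x \<in> Z" for x using that by (auto simp: Z_def)
  then have cZ: "connected Z" by (metis connected_empty connected_sing ex_in_conv subset_singletonD)
  have "tame ((\<Union>C\<in>\<A>. \<Union>n. (fr ^^ n) ` C) \<union> \<Union>\<N>)"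
  proof (rule tame_eventually_meeting[OF A(1)])
    fix C n assume "C \<in> \<A>"
    then show "connected ((fr ^^ n) ` C)"
      using A(2,3) hit_subset_reach
      by (intro connected_continuous_image continuous_on_subset[OF continuous_on_fr_funpow]) auto
  next
    show "finite \<N>" using N0(1) by (simp add: \<N>_def)
    show "connected D" if "D \<in> \<N>" for D using that N0(2) cZ by (auto simp: \<N>_def)
  next
    fix C assume C: "C \<in> \<A>"
    then obtain x where x: "x \<in> C" using A(4) by (metis ex_in_conv)
    then have xh: "x \<in> hit" using C A(3) by blast
    then have xr: "x \<in> reach" using hit_subset_reach by blast
    obtain u where u: "Im u \<noteq> 0" "f (Some u) = Some (complex_of_real x)" using xh by (auto simp:
        hit_def)
    have "(f ^^ Suc n) (Some u) = Some (complex_of_real ((fr ^^ n) x))" for n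
      using reach_funpow(2)[OF xr, of n] u(2) by (simp add: funpow_swap1)
    moreover have "sconv (\<lambda>n. (f ^^ Suc n) (Some u)) c"
      using sconv_subseq[OF c(3)[of u], of Suc] u(1) by (simp add: strict_mono_def)
    ultimately have "sconv (\<lambda>n. Some (complex_of_real ((fr ^^ n) x))) c" by simp
    then have "\<forall>\<^sub>F n in sequentially. Some (complex_of_real ((fr ^^ n) x)) = c \<or> (fr ^^ n) x \<in> N"
      by (rule ev[rule_format]) (use reach_step(1) reach_funpow(1)[OF xr] in simp)
    then show "\<forall>\<^sub>F n in sequentially. \<exists>D\<in>\<N>. (fr ^^ n) ` C \<inter> D \<noteq> {}"
    proof (rule eventually_mono)
      fix n assume "Some (complex_of_real ((fr ^^ n) x)) = c \<or> (fr ^^ n) x \<in> N"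
      then have "(fr ^^ n) x \<in> Z \<or> (fr ^^ n) x \<in> N" using reach_funpow(1)[OF xr] by (auto simp: Z_def)
      then obtain D where "D \<in> \<N>" "(fr ^^ n) x \<in> D" unfolding \<N>_def N0(3) by blast
      then show "\<exists>D\<in>\<N>. (fr ^^ n) ` C \<inter> D \<noteq> {}" using x by blast
    qed
  qed
  moreover have "(\<Union>C\<in>\<A>. \<Union>n. (fr ^^ n) ` C) \<union> \<Union>\<N> = reach \<union> N"
  proof -
    have "(\<Union>C\<in>\<A>. \<Union>n. (fr ^^ n) ` C) = reach" unfolding reach_eq A(3) by blast
    moreover have "Z \<subseteq> reach" by (simp add: Z_def)
    ultimately show ?thesis unfolding \<N>_def N0(3) by blast
  qed
  ultimately have tT: "tame (reach \<union> N)" by simp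
  show thesis
  proof (rule that[of "reach \<union> N"])
    show "open (reach \<union> N)" using open_reach N(1) by blast
    show "tame (reach \<union> N)" by (rule tT)
    fix z assume z: "Im z \<noteq> 0 \<or> Re z \<in> reach \<union> N"
    show "\<exists>w. f (Some z) = Some w \<and> (Im w \<noteq> 0 \<or> Re w \<in> reach \<union> N)"
    proof (cases "Im z = 0")
      case False
      obtain w where w: "f (Some z) = Some w" using NU[OF False, of 1] by auto
      have "Re w \<in> reach" if "Im w = 0"
      proof -
        have "w = complex_of_real (Re w)" using that by (simp add: complex_eq_iff)
        then have "Re w \<in> hit" using w False unfolding hit_def by force
        then show ?thesis using hit_subset_reach by blast
      qed
      then show ?thesis using w by blast
    next
      case True
      then have zr: "z = complex_of_real (Re z)" by (simp add: complex_eq_iff)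
      have "f (Some (complex_of_real (Re z))) = Some (complex_of_real (fr (Re z))) \<and> fr (Re z) \<in>
          reach \<union> N"
        using z True reach_step[of "Re z"] N(3)[of "Re z"] by auto
      then show ?thesis using zr by (metis Re_complex_of_real)
    qed
  qed
qed

end

section \<open>The criterion\<close>

lemma fixed_point_period:
  assumes "f z = z"
  shows "periodic_point f z" "period f z = 1"
proof -
  have 1: "(f ^^ 1) z = z" using assms by simp
  then show "periodic_point f z" unfolding periodic_point_def by blast
  from periodicD(2)[OF this] least_power_le[OF 1] show "period f z = 1" by simp
qed

lemma nonattracting_unstable:
  assumes f: "rational_map d f" "d \<ge> 2" and z: "periodic_point f z" "z \<in> real_points"
      "nonattracting f z"
  shows "\<not> stable (f ^^ period f z) z"
proof -
  note p = periodicD[OF z(1)]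
  note g = rational_map_iterate[OF f p(2)]
  obtain r G where G: "local_rep (f ^^ period f z) z r G" by (rule rational_map_local_rep[OF g(1)])
  have "norm (deriv G 0) \<ge> 1"
    using z(3) multiplier_local_rep[OF f z(1) G] by (simp add: nonattracting_def)
  then show ?thesis by (rule not_attracting_imp_unstable[OF g p(1) z(2) G])
qed

text \<open>A real point that is not fixed is moved to infinity, so that the index formula runs over
  finite fixed points only.\<close>

lemma nonattracting_fixed_point_exists:
  assumes f: "rational_map d f" "d \<ge> 2" and real: "only_real_periodic_points f"
  obtains z where "f z = z" "nonattracting f z" "z \<in> real_points"
proof -
  have fixed_real: "z \<in> real_points" if "h z = z" "only_real_periodic_points h" for h z
  proof -
    have "(h ^^ 1) z = z" using that by simp
    then show ?thesis using that(2) unfolding only_real_periodic_points_def by blast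
  qed
  have "\<exists>z. f z = z \<and> nonattracting f z"
  proof (rule ccontr)
    assume none: "\<nexists>z. f z = z \<and> nonattracting f z"
    have "finite ((\<lambda>x. Some (complex_of_real x)) -` {z. f z = z})"
      by (rule finite_vimageI[OF rational_map_finite_fixed[OF f]]) (simp add: inj_on_def)
    then obtain r where "r \<notin> (\<lambda>x. Some (complex_of_real x)) -` {z. f z = z}"
      using ex_new_if_finite infinite_UNIV_char_0 by blast
    then have r: "f (Some (complex_of_real r)) \<noteq> Some (complex_of_real r)" by simp
    obtain \<phi> \<psi> where m: "real_moebius \<phi> \<psi>" and \<phi>r: "\<phi> (Some (complex_of_real r)) = None"
      using real_moebius_at by metis
    note m' = real_moebiusD[OF m]
    define F where "F = \<phi> \<circ> f \<circ> \<psi>"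
    have rF: "rational_map d F" unfolding F_def by (rule rational_map_conj[OF m f(1)])
    have realF: "only_real_periodic_points F" unfolding F_def by (rule
        only_real_periodic_points_conj[OF m real])
    obtain p q where pq: "nondeg d p q" "F = ratfun_map d p q" using rF by (auto simp: rational_map_def)
    have \<psi>N: "\<psi> None = Some (complex_of_real r)" using m'(5)[of "Some (complex_of_real r)"] \<phi>r by simp
    show False
    proof (rule not_all_fixed_points_attracting[OF pq f(2)])
      show "F None \<noteq> None"
      proof
        assume "F None = None"
        then have "\<psi> (\<phi> (f (\<psi> None))) = \<psi> None" by (simp add: F_def)
        then show False using r by (simp add: m'(5) \<psi>N)
      qed
      fix w s G assume Fw: "F (Some w) = Some w" and G: "local_rep F (Some w) s G"
      define z where "z = \<psi> (Some w)"
      have "\<psi> (\<phi> (f (\<psi> (Some w)))) = \<psi> (Some w)" using Fw by (simp add: F_def)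
      then have fz: "f z = z" by (simp add: m'(5) z_def)
      obtain s' G' where G': "local_rep f z s' G'" by (rule rational_map_local_rep[OF f(1)])
      have "norm (deriv G' 0) < 1"
      proof -
        have "multiplier f z = deriv G' 0"
          using multiplier_local_rep[OF f fixed_point_period(1)[of f z, OF fz], of s' G'] G'
          by (simp add: fixed_point_period(2)[of f z, OF fz])
        then show ?thesis using none fz by (auto simp: nonattracting_def not_le)
      qed
      then have "stable f z" by (rule attracting_imp_stable[OF G' fz])
      \<comment> \<open>Stability is what passes to the conjugate; the bound on its multiplier is
        recovered from instability in the nonattracting case.\<close>
      then have "stable F (Some w)"
        using conj_stable[OF m'(1-4), of f z] by (simp add: F_def z_def m'(6))
      then show "norm (deriv G 0) < 1"
        using not_attracting_imp_unstable[OF rF f(2) Fw fixed_real[OF Fw realF] G] by force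
    qed
  qed
  then show thesis using that fixed_real real by blast
qed

text \<open>The last clause carries finite unions of intervals back to the original coordinate, in
  which semialgebraicity of \<open>S\<close> is claimed.\<close>

lemma normalize_at:
  assumes f: "rational_map d f" "d \<ge> 2" and z: "f z = z" "z \<in> real_points" "\<not> stable f z"
  obtains \<phi> \<psi> p q where "real_moebius \<phi> \<psi>" "\<phi> z = None" "normalized d p q (\<phi> \<circ> f \<circ> \<psi>)"
    "\<And>T. tame T \<Longrightarrow> tame {x. \<exists>y\<in>T. \<phi> (Some (complex_of_real x)) = Some (complex_of_real y)}"
proof -
  have "\<exists>\<phi> \<psi>. real_moebius \<phi> \<psi> \<and> \<phi> z = None \<and>
    (\<forall>T. tame T \<longrightarrow> tame {x. \<exists>y\<in>T. \<phi> (Some (complex_of_real x)) = Some (complex_of_real y)})"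
  proof (cases z)
    case None
    then show ?thesis using real_moebius_id by (intro exI[of _ id]) simp
  next
    case (Some w)
    then have w: "w = complex_of_real (Re w)" using z(2) by (simp add: complex_eq_iff)
    obtain \<phi> \<psi> where m: "real_moebius \<phi> \<psi>" "\<phi> (Some (complex_of_real (Re w))) = None"
      "\<And>z. z \<noteq> of_real (Re w) \<Longrightarrow> \<phi> (Some z) = Some (1 / (z - of_real (Re w)))"
      using real_moebius_at by metis
    have "{x. \<exists>y\<in>T. \<phi> (Some (complex_of_real x)) = Some (complex_of_real y)} =
        {x. x \<noteq> Re w \<and> 1 / (x - Re w) \<in> T}" for T
    proof -
      have "(\<exists>y\<in>T. \<phi> (Some (complex_of_real x)) = Some (complex_of_real y)) \<longleftrightarrow>
          x \<noteq> Re w \<and> 1 / (x - Re w) \<in> T" for x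
      proof (cases "x = Re w")
        case False
        then have "\<phi> (Some (complex_of_real x)) = Some (1 / (complex_of_real x - complex_of_real
            (Re w)))"
          by (intro m(3)) simp
        also have "\<dots> = Some (complex_of_real (1 / (x - Re w)))" by simp
        finally show ?thesis using False by (auto simp del: of_real_divide)
      qed (use m(2) in simp)
      then show ?thesis by blast
    qed
    then show ?thesis using m(1,2) w Some tame_moebius by (intro exI[of _ \<phi>] exI[of _ \<psi>]) simp
  qed
  then obtain \<phi> \<psi> where m: "real_moebius \<phi> \<psi>" "\<phi> z = None"
    "\<And>T. tame T \<Longrightarrow> tame {x. \<exists>y\<in>T. \<phi> (Some (complex_of_real x)) = Some (complex_of_real y)}" by blast
  note m' = real_moebiusD[OF m(1)]
  define F where "F = \<phi> \<circ> f \<circ> \<psi>"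
  have "rational_map d F" unfolding F_def by (rule rational_map_conj[OF m(1) f(1)])
  then obtain p q where pq: "nondeg d p q" "F = ratfun_map d p q" by (auto simp: rational_map_def)
  have "\<psi> None = z" using m'(5)[of z] m(2) by simp
  then have "F None = None" using z(1) m(2) by (simp add: F_def)
  then have "coeff q d = 0" by (simp add: pq(2) ratfun_map_def split: if_splits)
  moreover have "\<not> stable F None"
    using conj_stable_iff[OF m'(1-4), of f z] z(3) m(2) by (simp add: F_def)
  ultimately have "normalized d p q (\<phi> \<circ> f \<circ> \<psi>)"
    using pq f(2) unfolding F_def by unfold_locales auto
  then show thesis using that m by blast
qed

lemma closedin_real_points: "closedin sphere_topology real_points"
  unfolding closedin_sphere_iff
proof (intro allI impI)
  fix z :: sphere assume "z \<notin> real_points"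
  then obtain w where w: "z = Some w" "Im w \<noteq> 0" by (cases z) auto
  have "x \<notin> real_points" if x: "x \<in> disc z \<bar>Im w\<bar>" for x
  proof -
    obtain u where u: "x = Some u" "norm (u - w) < \<bar>Im w\<bar>" using x w(1) by (cases x) auto
    then have "\<bar>Im (u - w)\<bar> < \<bar>Im w\<bar>" using abs_Im_le_cmod[of "u - w"] by linarith
    then show ?thesis using u(1) by auto
  qed
  then show "\<exists>e>0. disc z e \<inter> real_points = {}" using w(2) by (intro exI[of _ "\<bar>Im w\<bar>"]) auto
qed

lemma backward_invariant_setD:
  assumes "backward_invariant_set f S"
  shows "S \<subseteq> real_points" "f -` S \<subseteq> S" "z \<notin> S \<Longrightarrow> \<exists>e>0. disc z e \<inter> S = {}"
proof -
  show "S \<subseteq> real_points" "f -` S \<subseteq> S"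
    using assms unfolding backward_invariant_set_def semialgebraic_P1_def by blast+
  have "closedin (subtopology sphere_topology real_points) S"
    using assms unfolding backward_invariant_set_def by blast
  then have "closedin sphere_topology S" using closedin_real_points by (rule closedin_trans_full)
  then show "z \<notin> S \<Longrightarrow> \<exists>e>0. disc z e \<inter> S = {}" unfolding closedin_sphere_iff by blast
qed

text \<open>The fixed point in \<open>S\<close> becomes infinity. A nonreal point reaching infinity
  would belong to the transported set by backward invariance, but that set is real.\<close>

lemma normalize_backward_invariant_set:
  assumes f: "rational_map d f" "d \<ge> 2" and S: "backward_invariant_set f S"
  obtains \<phi> \<psi> p q S' where "real_moebius \<phi> \<psi>" "omitting d p q (\<phi> \<circ> f \<circ> \<psi>)"
    "None \<in> S'" "(\<phi> \<circ> f \<circ> \<psi>) -` S' \<subseteq> S'" "\<And>z. z \<notin> S' \<Longrightarrow> \<exists>e>0. disc z e \<inter> S' = {}"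
    "\<And>z. \<phi> z \<in> S' \<longleftrightarrow> z \<in> S"
proof -
  note S' = backward_invariant_setD[OF S]
  obtain \<zeta> where \<zeta>: "\<zeta> \<in> S" "f \<zeta> = \<zeta>" "nonattracting f \<zeta>"
    using S unfolding backward_invariant_set_def by blast
  have \<zeta>r: "\<zeta> \<in> real_points" using S'(1) \<zeta>(1) by blast
  have "\<not> stable f \<zeta>"
    using nonattracting_unstable[OF f fixed_point_period(1)[of f \<zeta>, OF \<zeta>(2)] \<zeta>r \<zeta>(3)]
    by (simp add: fixed_point_period(2)[of f \<zeta>, OF \<zeta>(2)])
  from normalize_at[OF f \<zeta>(2) \<zeta>r this] obtain \<phi> \<psi> p q where
    m: "real_moebius \<phi> \<psi>" "\<phi> \<zeta> = None" and norm: "normalized d p q (\<phi> \<circ> f \<circ> \<psi>)" by metis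
  note m' = real_moebiusD[OF m(1)]
  define F where "F = \<phi> \<circ> f \<circ> \<psi>"
  interpret normalized d p q F using norm by (simp add: F_def)
  define T where "T = {z. \<psi> z \<in> S}"
  have TF: "F -` T \<subseteq> T"
  proof
    fix z assume "z \<in> F -` T"
    then have "f (\<psi> z) \<in> S" by (simp add: T_def F_def m'(5))
    then have "\<psi> z \<in> S" using S'(2) by blast
    then show "z \<in> T" by (simp add: T_def)
  qed
  have NT: "None \<in> T" using m'(5)[of \<zeta>] m(2) \<zeta>(1) by (simp add: T_def)
  have Treal: "T \<subseteq> real_points"
  proof
    fix z assume "z \<in> T"
    then have "\<psi> z \<in> real_points" using S'(1) by (auto simp: T_def)
    then show "z \<in> real_points" using real_moebiusD(7)[OF real_moebius_sym[OF m(1)]] by simp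
  qed
  show thesis
  proof (rule that[OF m(1), of p q T])
    show "omitting d p q (\<phi> \<circ> f \<circ> \<psi>)"
      unfolding F_def[symmetric]
    proof unfold_locales
      fix z n assume z: "Im z \<noteq> 0"
      show "(F ^^ n) (Some z) \<noteq> None"
      proof
        assume "(F ^^ n) (Some z) = None"
        then have "Some z \<in> T" using backward_funpow[OF TF, of n "Some z"] NT by simp
        then show False using Treal z by auto
      qed
    qed
    show "(\<phi> \<circ> f \<circ> \<psi>) -` T \<subseteq> T" using TF by (simp add: F_def)
    show "\<phi> z \<in> T \<longleftrightarrow> z \<in> S" for z by (simp add: T_def m'(5))
    fix z assume "z \<notin> T"
    then have "\<psi> z \<notin> S" by (simp add: T_def)
    then obtain e where e: "e > 0" "disc (\<psi> z) e \<inter> S = {}" using S'(3) by blast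
    obtain s where s: "s > 0" "\<psi> ` disc z s \<subseteq> disc (\<psi> z) e" by (rule rational_map_continuous[OF
        m'(2) e(1)])
    have "disc z s \<inter> T = {}" using s(2) e(2) by (auto simp: T_def)
    then show "\<exists>e>0. disc z e \<inter> T = {}" using s(1) by blast
  qed (rule NT)
qed

text \<open>The cycle captures an open set, which is transported to the normalised map, where
  capture excludes nonreal periodic points.\<close>

lemma criterion_imp_only_real:
  assumes f: "rational_map d f" "d \<ge> 2" and S: "backward_invariant_set f S"
    and cyc: "has_short_nonrepelling_real_cycle f"
  shows "only_real_periodic_points f"
proof -
  from normalize_backward_invariant_set[OF f S] obtain \<phi> \<psi> p q where
    m: "real_moebius \<phi> \<psi>" and om: "omitting d p q (\<phi> \<circ> f \<circ> \<psi>)" by metis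
  note m' = real_moebiusD[OF m]
  define F where "F = \<phi> \<circ> f \<circ> \<psi>"
  interpret omitting d p q F using om by (simp add: F_def)
  obtain z where z: "periodic_point f z" "cycle_of_point f z \<subseteq> real_points" "nonrepelling f z"
    using cyc unfolding has_short_nonrepelling_real_cycle_def by blast
  define k where "k = period f z"
  note pz = periodicD[OF z(1), folded k_def]
  note g = rational_map_iterate[OF f pz(2)]
  have "(f ^^ 0) z \<in> cycle_of_point f z" unfolding cycle_of_point_def using pz(2) k_def by fastforce
  then have zr: "z \<in> real_points" using z(2) by auto
  obtain r G where G: "local_rep (f ^^ k) z r G" by (rule rational_map_local_rep[OF g(1)])
  have "norm (deriv G 0) \<le> 1"
    using z(3) multiplier_local_rep[OF f z(1) G[unfolded k_def]] by (simp add: nonrepelling_def)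
  from nonrepelling_captures[OF g pz(1) zr G this] obtain P0 where
    P0: "open P0" "P0 \<noteq> {}" "\<And>u. u \<in> P0 \<Longrightarrow> sconv (\<lambda>n. ((f ^^ k) ^^ (2 * n)) (Some u)) z" by blast
  define P' where "P' = {w. \<psi> (Some w) \<in> Some ` P0}"
  have "only_real_periodic_points F"
  \<comment> \<open>The capture is by even iterates of \<open>f ^^ k\<close>, whence the exponent
    \<open>2 * k\<close>.\<close>
  proof (rule only_real_if_captured[of "\<phi> z" "2 * k" P'])
    show "\<phi> z \<in> real_points" using m'(7) zr by simp
    show "1 \<le> 2 * k" using pz(2) by simp
    show "open P'" unfolding open_contains_ball
    proof
      fix w assume "w \<in> P'"
      then obtain u where u: "u \<in> P0" "\<psi> (Some w) = Some u" by (auto simp: P'_def)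
      obtain e where e: "e > 0" "ball u e \<subseteq> P0" using P0(1) u(1) by (meson openE)
      obtain s where s: "s > 0" "\<psi> ` disc (Some w) s \<subseteq> disc (Some u) e"
        using rational_map_continuous[OF m'(2) e(1), of "Some w"] u(2) by metis
      have "ball w s \<subseteq> P'"
      proof
        fix v assume "v \<in> ball w s"
        then have "Some v \<in> disc (Some w) s" by (simp add: dist_norm norm_minus_commute)
        then have "\<psi> (Some v) \<in> disc (Some u) e" using s(2) by blast
        then obtain x where x: "\<psi> (Some v) = Some x" "norm (x - u) < e" by (cases "\<psi> (Some v)") auto
        then have "x \<in> P0" using e(2) by (auto simp: dist_norm norm_minus_commute)
        then show "v \<in> P'" using x(1) by (simp add: P'_def)
      qed
      then show "\<exists>e>0. ball w e \<subseteq> P'" using s(1) by blast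
    qed
    \<comment> \<open>Only one point is sent to infinity by the Moebius map, and \<open>P0\<close>
      contains two.\<close>
    have "\<exists>u\<in>P0. \<phi> (Some u) \<noteq> None"
    proof -
      obtain u where u: "u \<in> P0" using P0(2) by blast
      obtain e where e: "e > 0" "ball u e \<subseteq> P0" using P0(1) u by (meson openE)
      have v: "u + complex_of_real (e / 2) \<in> P0" using e by (intro subsetD[OF e(2)]) (simp add:
          dist_norm)
      show ?thesis
      proof (cases "\<phi> (Some u) = None")
        case True
        then have "Some u = \<psi> None" using m'(5)[of "Some u"] by simp
        moreover have "Some (u + complex_of_real (e / 2)) \<noteq> Some u" using e(1) by simp
        ultimately have "\<phi> (Some (u + complex_of_real (e / 2))) \<noteq> None" using m'(5) by metis
        then show ?thesis using v by blast
      qed (use u in blast)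
    qed
    then obtain u w where u: "u \<in> P0" "\<phi> (Some u) = Some w" by blast
    then have "\<psi> (Some w) = Some u" using m'(5)[of "Some u"] by simp
    then have "w \<in> P'" using u(1) by (simp add: P'_def)
    then show "P' \<noteq> {}" by blast
    fix w assume "w \<in> P'"
    then obtain v where v: "v \<in> P0" "\<psi> (Some w) = Some v" by (auto simp: P'_def)
    have "sconv (\<lambda>n. \<phi> (((f ^^ k) ^^ (2 * n)) (Some v))) (\<phi> z)" by (rule sconv_map[OF m'(1)
        P0(3)[OF v(1)]])
    moreover have "(F ^^ (2 * k * n)) (Some w) = \<phi> (((f ^^ k) ^^ (2 * n)) (Some v))" for n
      unfolding F_def conj_funpow[OF m'(3,4)] by (simp add: v(2) funpow_mult mult_ac)
    ultimately show "sconv (\<lambda>n. (F ^^ (2 * k * n)) (Some w)) (\<phi> z)" by simp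
  qed
  from only_real_periodic_points_conj[OF real_moebius_sym[OF m] this]
  have "only_real_periodic_points ((\<psi> \<circ> \<phi>) \<circ> f \<circ> (\<psi> \<circ> \<phi>))" by (simp add: F_def comp_assoc)
  then show ?thesis unfolding m'(3) by simp
qed

text \<open>Outside \<open>S\<close> a periodic point is stable for its return map, whereas a real
  nonattracting one is unstable.\<close>

lemma nonattracting_in_backward_invariant_set:
  assumes f: "rational_map d f" "d \<ge> 2" and S: "backward_invariant_set f S"
    and real: "only_real_periodic_points f" and z: "periodic_point f z" "nonattracting f z"
  shows "z \<in> S"
proof (rule ccontr)
  assume "z \<notin> S"
  obtain \<phi> \<psi> p q S' where m: "real_moebius \<phi> \<psi>" and om: "omitting d p q (\<phi> \<circ> f \<circ> \<psi>)"
    and S': "None \<in> S'" "(\<phi> \<circ> f \<circ> \<psi>) -` S' \<subseteq> S'" "\<And>z. z \<notin> S' \<Longrightarrow> \<exists>e>0. disc z e \<inter> S' = {}"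
    and SS': "\<And>z. \<phi> z \<in> S' \<longleftrightarrow> z \<in> S"
    by (rule normalize_backward_invariant_set[OF f S]) (rule that)
  note m' = real_moebiusD[OF m]
  define F where "F = \<phi> \<circ> f \<circ> \<psi>"
  interpret omitting d p q F using om by (simp add: F_def)
  define k where "k = period f z"
  note pz = periodicD[OF z(1), folded k_def]
  have zr: "z \<in> real_points" using real pz unfolding only_real_periodic_points_def by blast
  have Fk: "F ^^ n = \<phi> \<circ> f ^^ n \<circ> \<psi>" for n unfolding F_def by (rule conj_funpow[OF m'(3,4)])
  have "stable (F ^^ k) (\<phi> z)"
  proof (rule stable_outside_backward_invariant[OF S'(1) _ S'(3)])
    show "F -` S' \<subseteq> S'" using S'(2) by (simp add: F_def)
    show "(F ^^ k) (\<phi> z) = \<phi> z" by (simp add: Fk m'(5) pz(1))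
    show "\<phi> z \<notin> S'" using \<open>z \<notin> S\<close> SS' by simp
  qed
  then have "stable (f ^^ k) z" unfolding Fk using conj_stable_iff[OF m'(1-4)] by blast
  then show False using nonattracting_unstable[OF f z(1) zr z(2)] by (simp add: k_def)
qed

text \<open>The common limit of the nonreal orbits supplies a nonrepelling cycle of length 1;
  \<open>S\<close> is the complement of a forward invariant open set that avoids the nonattracting
  fixed point placed at infinity.\<close>

lemma only_real_imp_criterion:
  assumes f: "rational_map d f" "d \<ge> 2" and real: "only_real_periodic_points f"
  shows "has_short_nonrepelling_real_cycle f \<and> (\<exists>S. backward_invariant_set f S)"
proof -
  obtain \<zeta> where \<zeta>: "f \<zeta> = \<zeta>" "nonattracting f \<zeta>" "\<zeta> \<in> real_points"
    by (rule nonattracting_fixed_point_exists[OF f real])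
  have "\<not> stable f \<zeta>"
    using nonattracting_unstable[OF f fixed_point_period(1)[of f \<zeta>, OF \<zeta>(1)] \<zeta>(3,2)]
    by (simp add: fixed_point_period(2)[of f \<zeta>, OF \<zeta>(1)])
  then obtain \<phi> \<psi> p q where
    m: "real_moebius \<phi> \<psi>" "\<phi> \<zeta> = None" and norm: "normalized d p q (\<phi> \<circ> f \<circ> \<psi>)"
    and tm: "\<And>T. tame T \<Longrightarrow> tame {x. \<exists>y\<in>T. \<phi> (Some (complex_of_real x)) = Some (complex_of_real y)}"
    by (rule normalize_at[OF f \<zeta>(1,3)]) (rule that)
  note m' = real_moebiusD[OF m(1)]
  define F where "F = \<phi> \<circ> f \<circ> \<psi>"
  have realF: "only_real_periodic_points F" unfolding F_def by (rule
      only_real_periodic_points_conj[OF m(1) real])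
  interpret N: normalized d p q F using norm by (simp add: F_def)
  interpret omitting d p q F
    by unfold_locales (rule N.nonreal_never_infinite[OF realF])
  have Fk: "F ^^ n = \<phi> \<circ> f ^^ n \<circ> \<psi>" for n unfolding F_def by (rule conj_funpow[OF m'(3,4)])
  obtain c where c: "F c = c" "c \<in> real_points" "\<And>w. w \<in> U \<Longrightarrow> sconv (\<lambda>n. (F ^^ n) (Some w)) c"
    using orbits_converge[OF realF] by metis
  \<comment> \<open>An orbit that converges to \<open>c\<close> without landing there; a repelling
    \<open>c\<close> would not allow it.\<close>
  obtain w where w: "w \<in> U" "\<And>n. (F ^^ n) (Some w) \<noteq> c" using nonlanding_orbit by metis
  have fz: "f (\<psi> c) = \<psi> c" using arg_cong[OF c(1), of \<psi>] by (simp add: F_def m'(5))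
  have zr: "\<psi> c \<in> real_points" using c(2) real_moebiusD(7)[OF real_moebius_sym[OF m(1)]] by simp
  obtain r G where G: "local_rep f (\<psi> c) r G" by (rule rational_map_local_rep[OF f(1)])
  have mult: "multiplier f (\<psi> c) = deriv G 0"
    using multiplier_local_rep[OF f fixed_point_period(1)[of f "\<psi> c", OF fz], of r G] G
    by (simp add: fixed_point_period(2)[of f "\<psi> c", OF fz])
  have eq: "(f ^^ n) (\<psi> (Some w)) = \<psi> ((F ^^ n) (Some w))" for n by (simp add: Fk m'(5))
  have conv: "sconv (\<lambda>n. (f ^^ n) (\<psi> (Some w))) (\<psi> c)"
    unfolding eq by (rule sconv_map[OF m'(2) c(3)[OF w(1)]])
  have "norm (deriv G 0) \<le> 1"
  proof (rule ccontr)
    assume "\<not> norm (deriv G 0) \<le> 1"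
    then have "norm (deriv G 0) > 1" by simp
    from repelling_landing[OF G fz this conv] obtain n where "\<psi> ((F ^^ n) (Some w)) = \<psi> c"
      unfolding eq by blast
    then have "(F ^^ n) (Some w) = c" using m'(6) by metis
    then show False using w(2) by blast
  qed
  then have "nonrepelling f (\<psi> c)" by (simp add: nonrepelling_def mult)
  moreover have "cycle_of_point f (\<psi> c) \<subseteq> real_points"
    unfolding cycle_of_point_def fixed_point_period(2)[of f "\<psi> c", OF fz] using zr by auto
  ultimately have cyc: "has_short_nonrepelling_real_cycle f"
    unfolding has_short_nonrepelling_real_cycle_def
    using fixed_point_period[of f "\<psi> c", OF fz] by (intro exI[of _ "\<psi> c"]) simp
  obtain T where T: "open T" "tame T"
    "\<And>z. Im z \<noteq> 0 \<or> Re z \<in> T \<Longrightarrow> \<exists>w. F (Some z) = Some w \<and> (Im w \<noteq> 0 \<or> Re w \<in> T)"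
    by (rule tame_invariant_set[OF realF]) (rule that)
  \<comment> \<open>Exactly the points whose normalised image is infinity or a real point outside
    \<open>T\<close>.\<close>
  define S where "S = {z. \<not> (\<exists>w. \<phi> z = Some w \<and> (Im w \<noteq> 0 \<or> Re w \<in> T))}"
  have Sreal: "S \<subseteq> real_points"
  proof
    fix z assume z: "z \<in> S"
    show "z \<in> real_points"
    proof (cases "\<phi> z")
      case (Some w)
      then have "Im w = 0" using z by (auto simp: S_def)
      then show ?thesis using m'(7)[of z] Some by simp
    qed (use m'(7)[of z] in simp)
  qed
  have oO: "open {w. Im w \<noteq> 0 \<or> Re w \<in> T}"
  proof -
    have "open {w. Im w \<noteq> 0}" by (intro open_Collect_neq continuous_intros)
    moreover have "open (Re -` T)" using T(1) by (intro open_vimage continuous_intros)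
    moreover have "{w. Im w \<noteq> 0 \<or> Re w \<in> T} = {w. Im w \<noteq> 0} \<union> Re -` T" by auto
    ultimately show ?thesis by (simp add: open_Un)
  qed
  have "closedin sphere_topology S" unfolding closedin_sphere_iff
  proof (intro allI impI)
    fix z assume "z \<notin> S"
    then obtain w where w: "\<phi> z = Some w" "w \<in> {w. Im w \<noteq> 0 \<or> Re w \<in> T}" by (auto simp: S_def)
    obtain e where e: "e > 0" "ball w e \<subseteq> {w. Im w \<noteq> 0 \<or> Re w \<in> T}" using oO w(2) by (meson openE)
    obtain s where s: "s > 0" "\<phi> ` disc z s \<subseteq> disc (\<phi> z) e" by (rule rational_map_continuous[OF
        m'(1) e(1)])
    have "x \<notin> S" if "x \<in> disc z s" for x
    proof -
      have "\<phi> x \<in> disc (Some w) e" using s(2) that w(1) by auto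
      then obtain v where v: "\<phi> x = Some v" "norm (v - w) < e" by (cases "\<phi> x") auto
      then have "v \<in> ball w e" by (simp add: dist_norm norm_minus_commute)
      then have "v \<in> {w. Im w \<noteq> 0 \<or> Re w \<in> T}" using e(2) by blast
      then show ?thesis using v(1) by (simp add: S_def)
    qed
    then show "\<exists>e>0. disc z e \<inter> S = {}" using s(1) by blast
  qed
  then have "closedin (subtopology sphere_topology real_points) S"
    unfolding closedin_subtopology using Sreal by blast
  moreover have "semialgebraic_P1 S"
  proof (rule semialgebraic_P1_tame_complement[OF Sreal])
    have "Some (complex_of_real x) \<notin> S \<longleftrightarrow> (\<exists>y\<in>T. \<phi> (Some (complex_of_real x)) = Some
        (complex_of_real y))" for x
    proof
      assume "Some (complex_of_real x) \<notin> S"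
      then obtain w where w: "\<phi> (Some (complex_of_real x)) = Some w" "Im w \<noteq> 0 \<or> Re w \<in> T" by
          (auto simp: S_def)
      have "Some w \<in> real_points" using m'(7)[of "Some (complex_of_real x)"] w(1) by simp
      then have "Im w = 0" by simp
      then show "\<exists>y\<in>T. \<phi> (Some (complex_of_real x)) = Some (complex_of_real y)"
        using w by (intro bexI[of _ "Re w"]) (auto simp: complex_eq_iff)
    qed (auto simp: S_def)
    then show "tame {x. Some (complex_of_real x) \<notin> S}" using tm[OF T(2)] by simp
  qed
  moreover have "\<zeta> \<in> S" using m(2) by (simp add: S_def)
  \<comment> \<open>Backward invariance of \<open>S\<close> is forward invariance of its complement,
    which \<open>T\<close> was built to satisfy.\<close>
  moreover have "f -` S \<subseteq> S"
  proof (rule subsetI, rule ccontr)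
    fix z assume z: "z \<in> f -` S" "z \<notin> S"
    then obtain w where w: "\<phi> z = Some w" "Im w \<noteq> 0 \<or> Re w \<in> T" by (auto simp: S_def)
    obtain w' where w': "F (Some w) = Some w'" "Im w' \<noteq> 0 \<or> Re w' \<in> T" using T(3)[OF w(2)] by blast
    have "\<phi> (f z) = F (\<phi> z)" by (simp add: F_def m'(5))
    then have "f z \<notin> S" using w(1) w' by (auto simp: S_def)
    then show False using z(1) by simp
  qed
  ultimately have "backward_invariant_set f S"
    unfolding backward_invariant_set_def using \<zeta>(1,2) by blast
  then show ?thesis using cyc by blast
qed

theorem theorem2:
  fixes f :: "sphere \<Rightarrow> sphere" and d :: nat
  assumes "d \<ge> 2" and "f \<in> real_ratfuns d"
  shows "(only_real_periodic_points f \<longleftrightarrow>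
            has_short_nonrepelling_real_cycle f \<and> (\<exists>S. backward_invariant_set f S)) \<and>
         (only_real_periodic_points f \<and> has_short_nonrepelling_real_cycle f \<longrightarrow>
            (\<forall>S. backward_invariant_set f S \<longrightarrow>
              (\<forall>z. periodic_point f z \<and> nonattracting f z \<longrightarrow> z \<in> S)))"
proof -
  have f: "rational_map d f" by (rule real_ratfuns_rational_map[OF assms(2)])
  show ?thesis
    using only_real_imp_criterion[OF f assms(1)] criterion_imp_only_real[OF f assms(1)]
      nonattracting_in_backward_invariant_set[OF f assms(1)] by blast
qed

end
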